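(* Let $L$ be a finite-dimensional Lie algebra over a field $\mathbb{F}$ of prime characteristic $p$, let $M$ be a finite-dimensional $L$-module, and let $\mathfrak{L}$ be a $p$-envelope of $L$ with $k:=\dim_{\mathbb{F}}\mathfrak{L}/L<\infty$. Then the following statements hold: (1) $\dim_{\mathbb{F}}H^n(\mathfrak{L},M)=\sum_{j=0}^{k}\binom{k}{j}\dim_{\mathbb{F}}H^{n-j}(L,M)$ for every non-negative integer $n$. (2) $\dim_{\mathbb{F}}H^n(L,M)=\sum_{\nu=0}^{n}(-1)^{\nu}\binom{\nu+k-1}{k-1}\dim_{\mathbb{F}}H^{n-\nu}(\mathfrak{L},M)$ for every non-negative integer $n$.
   Context: $H^n(\cdot,M)$ denotes ordinary (Chevalley-Eilenberg) Lie algebra cohomology, with $H^n=0$ for $n<0$. A $p$-envelope of a Lie algebra $L$ over a field of characteristic $p$ is a triple $(\mathfrak{L},(\cdot)^{[p]},\iota)$ where $\mathfrak{L}$ is a restricted Lie algebra with $p$-mapping $(\cdot)^{[p]}$ and $\iota:L\to\mathfrak{L}$ is an injective Lie algebra homomorphism such that the smallest restricted subalgebra ($p$-subalgebra) of $\mathfrak{L}$ containing $\iota(L)$ is $\mathfrak{L}$ itself; $L$ is identified with $\iota(L)$, and $\mathfrak{L}/L$ is the quotient vector space. Module structure: let $\hat L$ be the universal $p$-envelope of $L$, i.e. the restricted Lie subalgebra of the universal enveloping algebra $U(L)$ (with $p$-mapping $u\mapsto u^p$) generated by $L$, and $\hat\iota:L\to\hat L$ the inclusion. Every $L$-module $M$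 is a $U(L)$-module, hence an $\hat L$-module. There exists a Lie algebra homomorphism $\phi:\mathfrak{L}\to\hat L$ with $\phi\circ\iota=\hat\iota$; fix any such $\phi$. Then $M$ is regarded as an $\mathfrak{L}$-module via $\phi$, extending the action of $L$. For $k=0$ the convention is $\binom{\nu-1}{-1}=1$ if $\nu=0$ and $0$ if $\nu\ge 1$. *)

theory Defs
  imports
    "HOL-Library.Poly_Mapping"
    "HOL-Library.Function_Algebras"
    "HOL-Algebra.QuotRing"
    "Jordan_Normal_Form.VS_Connect"
begin

section \<open>Vector spaces and quotients\<close>

definition fin_dim_space :: "('a::field \<Rightarrow> 'v::ab_group_add \<Rightarrow> 'v) \<Rightarrow> bool" where
  "fin_dim_space s \<longleftrightarrow> (\<exists>B. finite_dimensional_vector_space s B)"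

text \<open>The quotient vector space \<open>V/W\<close>, with the cosets \<open>v + W\<close> as elements.
  \<open>V\<close> and \<open>W\<close> are meant to be subspaces with \<open>W \<subseteq> V\<close>. The ring fields of the module record
  play no role.\<close>

definition quotient_space ::
  "('a::field \<Rightarrow> 'v::ab_group_add \<Rightarrow> 'v) \<Rightarrow> 'v set \<Rightarrow> 'v set \<Rightarrow> ('a, 'v set) module" where
  "quotient_space s V W =
    \<lparr>carrier = (\<lambda>v. {v + w |w. w \<in> W}) ` V, mult = undefined, one = undefined,
     zero = W, add = (\<lambda>A B. {a + b |a b. a \<in> A \<and> b \<in> B}),
     smult = (\<lambda>c A. {s c a + w |a w. a \<in> A \<and> w \<in> W})\<rparr>"

lemma quotient_space_vectorspace:
  fixes s :: "'a::field \<Rightarrow> 'v::ab_group_add \<Rightarrow> 'v"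
  assumes "vector_space s" and V: "module.subspace s V" and W: "module.subspace s W"
    and WV: "W \<subseteq> V"
  shows "vectorspace class_ring (quotient_space s V W)"
proof -
  interpret vector_space s by fact
  define c where "c v = {v + w |w. w \<in> W}" for v
  let ?Q = "quotient_space s V W"
  note Vs = V[unfolded subspace_def] and Ws = W[unfolded subspace_def]
  have neg: "- w \<in> W" if "w \<in> W" for w
    using Ws that by (metis scale_minus_left scale_one)
  have negV: "- v \<in> V" if "v \<in> V" for v
    using Vs that by (metis scale_minus_left scale_one)
  have zero: "\<zero>\<^bsub>?Q\<^esub> = c 0"
    by (simp add: quotient_space_def c_def)
  have plus: "c u \<oplus>\<^bsub>?Q\<^esub> c v = c (u + v)" for u v
  proof (intro equalityI subsetI)
    fix x assume "x \<in> c u \<oplus>\<^bsub>?Q\<^esub> c v"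
    then obtain w w' where "x = (u + w) + (v + w')" "w \<in> W" "w' \<in> W"
      by (auto simp: quotient_space_def c_def)
    then have "x = (u + v) + (w + w')" "w + w' \<in> W"
      using Ws by (auto simp: algebra_simps)
    then show "x \<in> c (u + v)" unfolding c_def by blast
  next
    fix x assume "x \<in> c (u + v)"
    then obtain w where "x = (u + w) + (v + 0)" "w \<in> W"
      by (auto simp: c_def algebra_simps)
    moreover have "0 \<in> W" using Ws by simp
    ultimately have "\<exists>a b. x = a + b \<and> a \<in> c u \<and> b \<in> c v" unfolding c_def by blast
    then show "x \<in> c u \<oplus>\<^bsub>?Q\<^esub> c v"
      by (simp add: quotient_space_def c_def)
  qed
  have smult: "r \<odot>\<^bsub>?Q\<^esub> c v = c (s r v)" for r v
  proof (intro equalityI subsetI)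
    fix x assume "x \<in> r \<odot>\<^bsub>?Q\<^esub> c v"
    then obtain w w' where "x = s r (v + w) + w'" "w \<in> W" "w' \<in> W"
      by (auto simp: quotient_space_def c_def)
    then have "x = s r v + (s r w + w')" "s r w + w' \<in> W"
      using Ws by (auto simp: algebra_simps)
    then show "x \<in> c (s r v)" unfolding c_def by blast
  next
    fix x assume "x \<in> c (s r v)"
    then obtain w where "x = s r (v + 0) + w" "w \<in> W" by (auto simp: c_def)
    moreover have "0 \<in> W" using Ws by simp
    ultimately have "\<exists>a w. x = s r a + w \<and> a \<in> c v \<and> w \<in> W" unfolding c_def by blast
    then show "x \<in> r \<odot>\<^bsub>?Q\<^esub> c v"
      by (simp add: quotient_space_def c_def)
  qed
  have carr: "carrier ?Q = c ` V"
    by (auto simp: quotient_space_def c_def)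
  have ag: "abelian_group ?Q"
  proof (rule abelian_groupI, goal_cases)
    case (6 x)
    then obtain v where v: "v \<in> V" "x = c v" unfolding carr by blast
    have "c (- v) \<oplus>\<^bsub>?Q\<^esub> x = \<zero>\<^bsub>?Q\<^esub>"
      unfolding v zero plus by simp
    then show ?case using negV[OF v(1)] unfolding carr by blast
  qed (use Vs in \<open>auto simp: carr zero plus ac_simps\<close>)
  have "Module.module class_ring ?Q"
  proof (rule moduleI)
    show "cring (class_ring :: 'a ring)" by unfold_locales
    show "abelian_group ?Q" by (rule ag)
  qed (use Vs in \<open>auto simp: carr smult plus algebra_simps\<close>)
  then show ?thesis
    by (rule vectorspace.intro) unfold_locales
qed

section \<open>Lie algebras and their modules\<close>

locale lie_algebra = vector_space scale
  for scale :: "'a::field \<Rightarrow> 'l::ab_group_add \<Rightarrow> 'l" +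
  fixes bracket :: "'l \<Rightarrow> 'l \<Rightarrow> 'l"
  assumes bracket_add_left: "bracket (x + y) z = bracket x z + bracket y z"
    and bracket_add_right: "bracket x (y + z) = bracket x y + bracket x z"
    and bracket_scale_left: "bracket (scale c x) y = scale c (bracket x y)"
    and bracket_scale_right: "bracket x (scale c y) = scale c (bracket x y)"
    and bracket_self: "bracket x x = 0"
    and jacobi: "bracket x (bracket y z) + bracket y (bracket z x) + bracket z (bracket x y) = 0"

locale lie_module = L: lie_algebra scaleL bracket + M: vector_space scaleM
  for scaleL :: "'a::field \<Rightarrow> 'l::ab_group_add \<Rightarrow> 'l"
    and bracket :: "'l \<Rightarrow> 'l \<Rightarrow> 'l"
    and scaleM :: "'a \<Rightarrow> 'm::ab_group_add \<Rightarrow> 'm" +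
  fixes act :: "'l \<Rightarrow> 'm \<Rightarrow> 'm"
  assumes act_add_left: "act (x + y) m = act x m + act y m"
    and act_add_right: "act x (m + m') = act x m + act x m'"
    and act_scale_left: "act (scaleL c x) m = scaleM c (act x m)"
    and act_scale_right: "act x (scaleM c m) = scaleM c (act x m)"
    and act_bracket: "act (bracket x y) m = act x (act y m) - act y (act x m)"

definition lie_hom ::
  "('a::field \<Rightarrow> 'l::ab_group_add \<Rightarrow> 'l) \<Rightarrow> ('l \<Rightarrow> 'l \<Rightarrow> 'l) \<Rightarrow>
   ('a \<Rightarrow> 'e::ab_group_add \<Rightarrow> 'e) \<Rightarrow> ('e \<Rightarrow> 'e \<Rightarrow> 'e) \<Rightarrow> ('l \<Rightarrow> 'e) \<Rightarrow> bool" where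
  "lie_hom scaleL bracketL scaleE bracketE f \<longleftrightarrow>
    Vector_Spaces.linear scaleL scaleE f \<and>
    (\<forall>x y. f (bracketL x y) = bracketE (f x) (f y))"

section \<open>Restricted Lie algebras and p-envelopes\<close>

text \<open>Jacobson's elements \<open>s\<^sub>i(x, y)\<close>, defined by
  \<open>(ad (x \<otimes> X + y \<otimes> 1))\<^sup>p\<^sup>-\<^sup>1 (x \<otimes> 1) = (\<Sum>i=1..p-1. i s\<^sub>i(x, y) \<otimes> X\<^sup>i\<^sup>-\<^sup>1)\<close> in the Lie algebra
  \<open>L \<otimes> F[X]\<close>, whose elements are represented as polynomials with coefficients in \<open>L\<close>.
  Here \<open>p\<close> is the characteristic of the ground field.\<close>

definition ad_poly :: "('l::ab_group_add \<Rightarrow> 'l \<Rightarrow> 'l) \<Rightarrow> 'l \<Rightarrow> 'l \<Rightarrow> 'l poly \<Rightarrow> 'l poly" where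
  "ad_poly bracket x y q = pCons 0 (map_poly (bracket x) q) + map_poly (bracket y) q"

definition jacobson_s ::
  "('a::field \<Rightarrow> 'l::ab_group_add \<Rightarrow> 'l) \<Rightarrow> ('l \<Rightarrow> 'l \<Rightarrow> 'l) \<Rightarrow> nat \<Rightarrow> 'l \<Rightarrow> 'l \<Rightarrow> 'l" where
  "jacobson_s scale bracket i x y =
    scale (inverse (of_nat i))
      (Polynomial.coeff ((ad_poly bracket x y ^^ (CHAR('a) - 1)) [:x:]) (i - 1))"

locale restricted_lie_algebra = lie_algebra scale bracket
  for scale :: "'a::field \<Rightarrow> 'l::ab_group_add \<Rightarrow> 'l"
    and bracket :: "'l \<Rightarrow> 'l \<Rightarrow> 'l" +
  fixes pmap :: "'l \<Rightarrow> 'l"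
  assumes prime_char: "prime CHAR('a)"
    and ad_pmap: "bracket (pmap x) y = (bracket x ^^ CHAR('a)) y"
    and pmap_scale: "pmap (scale c x) = scale (c ^ CHAR('a)) (pmap x)"
    and pmap_add:
      "pmap (x + y) = pmap x + pmap y + (\<Sum>i = 1..CHAR('a) - 1. jacobson_s scale bracket i x y)"
begin

definition p_subalgebra :: "'l set \<Rightarrow> bool" where
  "p_subalgebra S \<longleftrightarrow>
    subspace S \<and> (\<forall>x\<in>S. \<forall>y\<in>S. bracket x y \<in> S) \<and> (\<forall>x\<in>S. pmap x \<in> S)"

end

locale p_envelope =
  L: lie_algebra scaleL bracketL + E: restricted_lie_algebra scaleE bracketE pmap
  for scaleL :: "'a::field \<Rightarrow> 'l::ab_group_add \<Rightarrow> 'l"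
    and bracketL :: "'l \<Rightarrow> 'l \<Rightarrow> 'l"
    and scaleE :: "'a \<Rightarrow> 'e::ab_group_add \<Rightarrow> 'e"
    and bracketE :: "'e \<Rightarrow> 'e \<Rightarrow> 'e"
    and pmap :: "'e \<Rightarrow> 'e" +
  fixes incl :: "'l \<Rightarrow> 'e"
  assumes incl_hom: "lie_hom scaleL bracketL scaleE bracketE incl"
    and incl_inj: "inj incl"
    and generated: "\<Inter>{S. E.p_subalgebra S \<and> range incl \<subseteq> S} = UNIV"

section \<open>The universal enveloping algebra and the universal p-envelope\<close>

text \<open>Words under concatenation form the free monoid, so that finitely supported functions on words
  with the convolution product form the free associative unital algebra on a set.\<close>

datatype 'l word = Word (letters: "'l list")

instantiation word :: (type) monoid_add
begin

definition zero_word :: "'a word" where "0 = Word []"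
definition plus_word :: "'a word \<Rightarrow> 'a word \<Rightarrow> 'a word" where
  "v + w = Word (letters v @ letters w)"

instance by standard (simp_all add: zero_word_def plus_word_def)

end

type_synonym ('l, 'a) free_algebra = "'l word \<Rightarrow>\<^sub>0 'a"

definition free_gen :: "'l \<Rightarrow> ('l, 'a::field) free_algebra" where
  "free_gen x = Poly_Mapping.single (Word [x]) 1"

definition free_scalar :: "'a::field \<Rightarrow> ('l, 'a) free_algebra" where
  "free_scalar c = Poly_Mapping.single 0 c"

text \<open>The first two families of relations turn the free algebra on the set underlying \<open>L\<close> into the
  tensor algebra of the vector space \<open>L\<close>.\<close>

definition uea_relations ::
  "('a::field \<Rightarrow> 'l::ab_group_add \<Rightarrow> 'l) \<Rightarrow> ('l \<Rightarrow> 'l \<Rightarrow> 'l) \<Rightarrow> ('l, 'a) free_algebra set" where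
  "uea_relations scale bracket =
    {free_gen (x + y) - free_gen x - free_gen y |x y. True} \<union>
    {free_gen (scale c x) - free_scalar c * free_gen x |c x. True} \<union>
    {free_gen x * free_gen y - free_gen y * free_gen x - free_gen (bracket x y) |x y. True}"

definition uea_ideal ::
  "('a::field \<Rightarrow> 'l::ab_group_add \<Rightarrow> 'l) \<Rightarrow> ('l \<Rightarrow> 'l \<Rightarrow> 'l) \<Rightarrow> ('l, 'a) free_algebra set" where
  "uea_ideal scale bracket = Idl\<^bsub>class_ring\<^esub> (uea_relations scale bracket)"

definition uea ::
  "('a::field \<Rightarrow> 'l::ab_group_add \<Rightarrow> 'l) \<Rightarrow> ('l \<Rightarrow> 'l \<Rightarrow> 'l) \<Rightarrow> ('l, 'a) free_algebra set ring" where
  "uea scale bracket = class_ring Quot (uea_ideal scale bracket)"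

definition uea_proj ::
  "('a::field \<Rightarrow> 'l::ab_group_add \<Rightarrow> 'l) \<Rightarrow> ('l \<Rightarrow> 'l \<Rightarrow> 'l) \<Rightarrow>
   ('l, 'a) free_algebra \<Rightarrow> ('l, 'a) free_algebra set" where
  "uea_proj scale bracket f = uea_ideal scale bracket +>\<^bsub>class_ring\<^esub> f"

definition uea_incl ::
  "('a::field \<Rightarrow> 'l::ab_group_add \<Rightarrow> 'l) \<Rightarrow> ('l \<Rightarrow> 'l \<Rightarrow> 'l) \<Rightarrow> 'l \<Rightarrow> ('l, 'a) free_algebra set" where
  "uea_incl scale bracket x = uea_proj scale bracket (free_gen x)"

definition uea_scale ::
  "('a::field \<Rightarrow> 'l::ab_group_add \<Rightarrow> 'l) \<Rightarrow> ('l \<Rightarrow> 'l \<Rightarrow> 'l) \<Rightarrow>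
   'a \<Rightarrow> ('l, 'a) free_algebra set \<Rightarrow> ('l, 'a) free_algebra set" where
  "uea_scale scale bracket c u =
    uea_proj scale bracket (free_scalar c) \<otimes>\<^bsub>uea scale bracket\<^esub> u"

definition uea_bracket ::
  "('a::field \<Rightarrow> 'l::ab_group_add \<Rightarrow> 'l) \<Rightarrow> ('l \<Rightarrow> 'l \<Rightarrow> 'l) \<Rightarrow>
   ('l, 'a) free_algebra set \<Rightarrow> ('l, 'a) free_algebra set \<Rightarrow> ('l, 'a) free_algebra set" where
  "uea_bracket scale bracket u v =
    u \<otimes>\<^bsub>uea scale bracket\<^esub> v \<ominus>\<^bsub>uea scale bracket\<^esub> v \<otimes>\<^bsub>uea scale bracket\<^esub> u"

text \<open>The smallest subspace of \<open>U(L)\<close> that contains \<open>L\<close> and is closed under commutators and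
  \<open>p\<close>-th powers.\<close>

definition universal_p_envelope ::
  "('a::field \<Rightarrow> 'l::ab_group_add \<Rightarrow> 'l) \<Rightarrow> ('l \<Rightarrow> 'l \<Rightarrow> 'l) \<Rightarrow> ('l, 'a) free_algebra set set" where
  "universal_p_envelope scale bracket =
    \<Inter>{S. S \<subseteq> carrier (uea scale bracket) \<and>
        range (uea_incl scale bracket) \<subseteq> S \<and>
        \<zero>\<^bsub>uea scale bracket\<^esub> \<in> S \<and>
        (\<forall>u\<in>S. \<forall>v\<in>S. u \<oplus>\<^bsub>uea scale bracket\<^esub> v \<in> S) \<and>
        (\<forall>c. \<forall>u\<in>S. uea_scale scale bracket c u \<in> S) \<and>
        (\<forall>u\<in>S. \<forall>v\<in>S. uea_bracket scale bracket u v \<in> S) \<and>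
        (\<forall>u\<in>S. u [^]\<^bsub>uea scale bracket\<^esub> CHAR('a) \<in> S)}"

definition hom_universal_p_envelope ::
  "('a::field \<Rightarrow> 'l::ab_group_add \<Rightarrow> 'l) \<Rightarrow> ('l \<Rightarrow> 'l \<Rightarrow> 'l) \<Rightarrow>
   ('a \<Rightarrow> 'e::ab_group_add \<Rightarrow> 'e) \<Rightarrow> ('e \<Rightarrow> 'e \<Rightarrow> 'e) \<Rightarrow>
   ('e \<Rightarrow> ('l, 'a) free_algebra set) \<Rightarrow> bool" where
  "hom_universal_p_envelope scaleL bracketL scaleE bracketE \<phi> \<longleftrightarrow>
    (\<forall>g. \<phi> g \<in> universal_p_envelope scaleL bracketL) \<and>
    (\<forall>g h. \<phi> (g + h) = \<phi> g \<oplus>\<^bsub>uea scaleL bracketL\<^esub> \<phi> h) \<and>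
    (\<forall>c g. \<phi> (scaleE c g) = uea_scale scaleL bracketL c (\<phi> g)) \<and>
    (\<forall>g h. \<phi> (bracketE g h) = uea_bracket scaleL bracketL (\<phi> g) (\<phi> h))"

definition free_act ::
  "('a::field \<Rightarrow> 'm::ab_group_add \<Rightarrow> 'm) \<Rightarrow> ('l \<Rightarrow> 'm \<Rightarrow> 'm) \<Rightarrow>
   ('l, 'a) free_algebra \<Rightarrow> 'm \<Rightarrow> 'm" where
  "free_act scaleM act f m =
    (\<Sum>w\<in>Poly_Mapping.keys f. scaleM (Poly_Mapping.lookup f w) (foldr act (letters w) m))"

text \<open>The action of \<open>U(L)\<close> on an \<open>L\<close>-module. For such a module, all representatives \<open>f\<close> of the
  coset \<open>u\<close> act in the same way.\<close>

definition uea_act ::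
  "('a::field \<Rightarrow> 'm::ab_group_add \<Rightarrow> 'm) \<Rightarrow> ('l \<Rightarrow> 'm \<Rightarrow> 'm) \<Rightarrow>
   ('l, 'a) free_algebra set \<Rightarrow> 'm \<Rightarrow> 'm" where
  "uea_act scaleM act u m = the_elem ((\<lambda>f. free_act scaleM act f m) ` u)"

section \<open>Chevalley-Eilenberg cohomology\<close>

text \<open>An \<open>n\<close>-cochain is an alternating \<open>n\<close>-linear map \<open>L \<times> \<dots> \<times> L \<Rightarrow> M\<close>, represented as a function on
  lists which vanishes on lists whose length is not \<open>n\<close>. In particular, the only cochain of
  negative degree is \<open>0\<close>.\<close>

definition cochains ::
  "('a::field \<Rightarrow> 'l::ab_group_add \<Rightarrow> 'l) \<Rightarrow> ('a \<Rightarrow> 'm::ab_group_add \<Rightarrow> 'm) \<Rightarrow>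
   int \<Rightarrow> ('l list \<Rightarrow> 'm) set" where
  "cochains scaleL scaleM n =
    {f. (\<forall>xs. int (length xs) \<noteq> n \<longrightarrow> f xs = 0) \<and>
        (\<forall>xs x y ys. f (xs @ (x + y) # ys) = f (xs @ x # ys) + f (xs @ y # ys)) \<and>
        (\<forall>xs c x ys. f (xs @ scaleL c x # ys) = scaleM c (f (xs @ x # ys))) \<and>
        (\<forall>xs. \<not> distinct xs \<longrightarrow> f xs = 0)}"

definition omit_nth :: "nat \<Rightarrow> 'l list \<Rightarrow> 'l list" where
  "omit_nth i xs = take i xs @ drop (Suc i) xs"

definition coboundary ::
  "('l \<Rightarrow> 'l \<Rightarrow> 'l) \<Rightarrow> ('a::field \<Rightarrow> 'm::ab_group_add \<Rightarrow> 'm) \<Rightarrow> ('l \<Rightarrow> 'm \<Rightarrow> 'm) \<Rightarrow>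
   ('l list \<Rightarrow> 'm) \<Rightarrow> 'l list \<Rightarrow> 'm" where
  "coboundary bracket scaleM act f xs =
    (\<Sum>i<length xs. scaleM ((-1) ^ i) (act (xs ! i) (f (omit_nth i xs)))) +
    (\<Sum>j<length xs. \<Sum>i<j.
       scaleM ((-1) ^ (i + j)) (f (bracket (xs ! i) (xs ! j) # omit_nth i (omit_nth j xs))))"

definition cocycles ::
  "('a::field \<Rightarrow> 'l::ab_group_add \<Rightarrow> 'l) \<Rightarrow> ('l \<Rightarrow> 'l \<Rightarrow> 'l) \<Rightarrow>
   ('a \<Rightarrow> 'm::ab_group_add \<Rightarrow> 'm) \<Rightarrow> ('l \<Rightarrow> 'm \<Rightarrow> 'm) \<Rightarrow> int \<Rightarrow> ('l list \<Rightarrow> 'm) set" where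
  "cocycles scaleL bracket scaleM act n =
    {f \<in> cochains scaleL scaleM n. coboundary bracket scaleM act f = 0}"

definition coboundaries ::
  "('a::field \<Rightarrow> 'l::ab_group_add \<Rightarrow> 'l) \<Rightarrow> ('l \<Rightarrow> 'l \<Rightarrow> 'l) \<Rightarrow>
   ('a \<Rightarrow> 'm::ab_group_add \<Rightarrow> 'm) \<Rightarrow> ('l \<Rightarrow> 'm \<Rightarrow> 'm) \<Rightarrow> int \<Rightarrow> ('l list \<Rightarrow> 'm) set" where
  "coboundaries scaleL bracket scaleM act n =
    coboundary bracket scaleM act ` cochains scaleL scaleM (n - 1)"

definition cohomology ::
  "('a::field \<Rightarrow> 'l::ab_group_add \<Rightarrow> 'l) \<Rightarrow> ('l \<Rightarrow> 'l \<Rightarrow> 'l) \<Rightarrow>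
   ('a \<Rightarrow> 'm::ab_group_add \<Rightarrow> 'm) \<Rightarrow> ('l \<Rightarrow> 'm \<Rightarrow> 'm) \<Rightarrow> int \<Rightarrow>
   ('a, ('l list \<Rightarrow> 'm) set) module" where
  "cohomology scaleL bracket scaleM act n =
    quotient_space (\<lambda>c f xs. scaleM c (f xs))
      (cocycles scaleL bracket scaleM act n) (coboundaries scaleL bracket scaleM act n)"

definition cohomology_dim ::
  "('a::field \<Rightarrow> 'l::ab_group_add \<Rightarrow> 'l) \<Rightarrow> ('l \<Rightarrow> 'l \<Rightarrow> 'l) \<Rightarrow>
   ('a \<Rightarrow> 'm::ab_group_add \<Rightarrow> 'm) \<Rightarrow> ('l \<Rightarrow> 'm \<Rightarrow> 'm) \<Rightarrow> int \<Rightarrow> nat" where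
  "cohomology_dim scaleL bracket scaleM act n =
    vectorspace.dim class_ring (cohomology scaleL bracket scaleM act n)"

text \<open>The binomial coefficient \<open>\<nu> + k - 1\<close> over \<open>k - 1\<close>, where for \<open>k = 0\<close> the binomial
  coefficient \<open>\<nu> - 1\<close> over \<open>-1\<close> is \<open>1\<close> if \<open>\<nu> = 0\<close> and \<open>0\<close> otherwise.\<close>

definition shifted_binomial :: "nat \<Rightarrow> nat \<Rightarrow> nat" where
  "shifted_binomial \<nu> k =
    (if k = 0 then (if \<nu> = 0 then 1 else 0) else (\<nu> + k - 1) choose (k - 1))"

end

theory Submission
  imports Defs
begin

text \<open>For a subspace \<open>K\<close> of the p-envelope \<open>E\<close> that contains \<open>L\<close>, let \<open>C(K)\<close> be the complex of cochains
  on \<open>K\<close>. Since \<open>[E, E] \<subseteq> L\<close>, such a \<open>K\<close> is an ideal of \<open>E\<close>, and a cochain on \<open>K + F t\<close> amounts to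
  a pair \<open>(a, b)\<close> of cochains on \<open>K\<close>, of degrees \<open>n\<close> and \<open>n - 1\<close>, with differential
  \<open>(d a, \<theta>\<^sub>t a - d b)\<close>. If \<open>\<theta>\<^sub>t\<close> maps cocycles to coboundaries, then counting dimensions gives
  \<open>h\<^sup>n(K + F t) = h\<^sup>n(K) + h\<^sup>n\<^sup>-\<^sup>1(K)\<close>, and iterating this along a chain from \<open>L\<close> to \<open>E\<close> gives (1),
  of which (2) is the inversion.

  The operators \<open>\<theta>\<^sub>t\<close> do map cocycles to coboundaries for every \<open>t \<in> E\<close>: by Cartan's formula this is
  true for \<open>t \<in> L\<close>, and the elements \<open>u\<close> of \<open>U(L)\<close> for which the operator defined by the action of
  \<open>u\<close> on \<open>M\<close> and on the adjoint module \<open>E\<close> has this property are closed under linear combinations,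
  commutators and, because \<open>(P - Q)\<^sup>p = P\<^sup>p - Q\<^sup>p\<close> for commuting operators in characteristic \<open>p\<close>, under
  \<open>p\<close>-th powers. So they contain the universal p-envelope. For \<open>u = \<phi>(t)\<close> the action of \<open>u\<close> on \<open>E\<close> is
  the adjoint action of \<open>t\<close> by the injectivity of \<open>L \<rightarrow> U(L)\<close>.\<close>


section \<open>Dimension counting\<close>

text \<open>The obstacle is that \<open>\<phi>\<close> is only a Lie homomorphism: it need not turn
  \<open>pmap\<close> into p-th powers, nor be injective. On \<open>M\<close> the operator of
  \<open>pmap x\<close> may therefore differ from the p-th power of that of \<open>x\<close>, and an
  induction over the generation of \<open>E\<close> by \<open>pmap\<close> says nothing about
  \<open>M\<close>. The induction runs over the universal p-envelope instead, whose elements act on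
  \<open>M\<close> and on \<open>E\<close> at once and whose p-th powers are genuine powers of both
  operators. The price is the return from U(L) to \<open>E\<close>: the operator attached to
  \<open>\<phi> t\<close> has to be compared with \<open>ad t\<close>. This comparison is what the
  Poincare-Birkhoff-Witt part is for, and only injectivity on \<open>L\<close> is proved there, by a
  single faithful module. Coboundaries never enter the induction along the chain. By rank-nullity
  the dimension of the cohomology in degree \<open>n\<close> is that of the cocycles in degrees
  \<open>n\<close> and \<open>n - 1\<close> minus that of the cochains in degree
  \<open>n - 1\<close>, so it is enough to follow cochains and cocycles.\<close>

definition finitely_spanned :: "('a::field \<Rightarrow> 'v::ab_group_add \<Rightarrow> 'v) \<Rightarrow> 'v set \<Rightarrow> bool" where
  "finitely_spanned s V \<longleftrightarrow> (\<exists>B. finite B \<and> V \<subseteq> module.span s B)"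

context vector_space
begin

lemma finitely_spannedI: "finite B \<Longrightarrow> V \<subseteq> span B \<Longrightarrow> finitely_spanned scale V"
  by (auto simp: finitely_spanned_def)

text \<open>A finite spanning set is allowed to leave \<open>V\<close>, which makes the property
  hereditary. It is a property of sets because the surrounding spaces of all functions on lists are
  usually infinite-dimensional.\<close>

lemma finitely_spanned_subset: "finitely_spanned scale V \<Longrightarrow> W \<subseteq> V \<Longrightarrow> finitely_spanned scale W"
  by (auto simp: finitely_spanned_def)

lemma finite_independent_subset:
  assumes "finitely_spanned scale V" "B \<subseteq> V" "independent B"
  shows "finite B"
  using assms independent_span_bound by (metis finitely_spanned_def subset_trans)

lemma extend_to_basis:
  assumes "finitely_spanned scale V" "C \<subseteq> V" "independent C"
  obtains B where "C \<subseteq> B" "B \<subseteq> V" "V \<subseteq> span B" "independent B" "finite B" "card B = dim V"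
proof -
  obtain B where B: "C \<subseteq> B" "B \<subseteq> V" "independent B" "V \<subseteq> span B"
    using maximal_independent_subset_extend[OF assms(2,3)] by metis
  moreover have "finite B" by (rule finite_independent_subset[OF assms(1) B(2,3)])
  moreover have "card B = dim V" by (rule basis_card_eq_dim[OF B(2,4,3)])
  ultimately show ?thesis using that by blast
qed

lemma finite_basis:
  assumes "finitely_spanned scale V"
  obtains B where "B \<subseteq> V" "V \<subseteq> span B" "independent B" "finite B" "card B = dim V"
  by (rule extend_to_basis[OF assms empty_subsetI independent_empty]) (rule that)

end

lemma subspace_kernel_in:
  assumes f: "Vector_Spaces.linear s t f" and V: "module.subspace s V"
  shows "module.subspace s {v \<in> V. f v = 0}"
proof -
  interpret f: Vector_Spaces.linear s t f by fact
  show ?thesis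
    using V by (auto simp: f.vs1.subspace_def f.add f.scale f.zero)
qed

text \<open>A basis of the kernel together with preimages of a basis of the image spans
  \<open>V\<close>; conversely, a basis of the kernel extends to one of \<open>V\<close>, and the
  images of the new members span the image. Finiteness is a separate part because \<open>dim\<close>
  is informative only on finitely spanned sets, and finiteness has to be carried in both
  directions.\<close>

lemma rank_nullity:
  assumes f: "Vector_Spaces.linear s t f" and V: "module.subspace s V"
  defines "N \<equiv> {v \<in> V. f v = 0}"
  shows "finitely_spanned s V \<longleftrightarrow>
      finitely_spanned s N \<and> finitely_spanned t (f ` V)"
    and "finitely_spanned s V \<Longrightarrow>
      vector_space.dim s V = vector_space.dim s N + vector_space.dim t (f ` V)"
proof -
  interpret f: Vector_Spaces.linear s t f by fact
  have NV: "N \<subseteq> V" by (auto simp: N_def)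
  have N: "f.vs1.subspace N"
    unfolding N_def by (rule subspace_kernel_in[OF f V])
  have fV: "f.vs2.subspace (f ` V)" by (rule f.subspace_image[OF V])
  have A: "finitely_spanned s V \<and> f.vs1.dim V \<le> f.vs1.dim N + f.vs2.dim (f ` V)"
    if fd: "finitely_spanned s N" "finitely_spanned t (f ` V)"
  proof -
    obtain C where C: "C \<subseteq> N" "N \<subseteq> f.vs1.span C" "finite C" "card C = f.vs1.dim N"
      using f.vs1.finite_basis[OF fd(1)] by metis
    obtain D where D: "D \<subseteq> f ` V" "f ` V \<subseteq> f.vs2.span D" "finite D" "card D = f.vs2.dim (f ` V)"
      using f.vs2.finite_basis[OF fd(2)] by metis
    obtain R where R: "R \<subseteq> V" "finite R" "D = f ` R" "card R = card D"
    proof -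
      obtain R where "R \<subseteq> V" "inj_on f R" "D = f ` R"
        using D(1) by (meson subset_image_inj)
      then show ?thesis using that D(3) card_image finite_image_iff by metis
    qed
    have sub: "V \<subseteq> f.vs1.span (C \<union> R)"
    proof
      fix v assume v: "v \<in> V"
      then have "f v \<in> f ` f.vs1.span R" using D(2) by (auto simp: R(3) f.span_image)
      then obtain u where u: "u \<in> f.vs1.span R" "f u = f v" by auto
      then have "u \<in> V" using R(1) V f.vs1.span_minimal by blast
      then have "v - u \<in> N" using v u(2) V by (auto simp: N_def f.diff f.vs1.subspace_diff)
      then have "v - u \<in> f.vs1.span (C \<union> R)" "u \<in> f.vs1.span (C \<union> R)"
        using C(2) u(1) f.vs1.span_mono[of C "C \<union> R"] f.vs1.span_mono[of R "C \<union> R"] by auto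
      then show "v \<in> f.vs1.span (C \<union> R)" using f.vs1.span_add by fastforce
    qed
    have card: "card (C \<union> R) \<le> f.vs1.dim N + f.vs2.dim (f ` V)"
      using card_Un_le[of C R] C(4) D(4) R(4) by simp
    have fin: "finite (C \<union> R)" using C(3) R(2) by simp
    show ?thesis
      using le_trans[OF f.vs1.dim_le_card[OF sub fin] card] f.vs1.finitely_spannedI[OF fin sub] by blast
  qed
  have B: "finitely_spanned t (f ` V) \<and> f.vs1.dim V \<ge> f.vs1.dim N + f.vs2.dim (f ` V)"
    if fd: "finitely_spanned s V"
  proof -
    have "finitely_spanned s N" using fd NV f.vs1.finitely_spanned_subset by blast
    then obtain C where C: "C \<subseteq> N" "N \<subseteq> f.vs1.span C" "f.vs1.independent C" "finite C"
      "card C = f.vs1.dim N"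
      using f.vs1.finite_basis by metis
    obtain B where B: "C \<subseteq> B" "B \<subseteq> V" "V \<subseteq> f.vs1.span B" "finite B" "card B = f.vs1.dim V"
      using f.vs1.extend_to_basis[OF fd _ C(3)] C(1) NV by (metis subset_trans)
    have "f ` B \<subseteq> f.vs2.span (f ` (B - C))"
    proof
      fix x assume "x \<in> f ` B"
      then obtain b where b: "b \<in> B" "x = f b" by blast
      show "x \<in> f.vs2.span (f ` (B - C))"
      proof (cases "b \<in> C")
        case True
        then have "x = 0" using b C(1) by (auto simp: N_def)
        then show ?thesis by (simp add: f.vs2.span_zero)
      next
        case False
        then show ?thesis using b by (auto intro: f.vs2.span_base)
      qed
    qed
    then have "f ` f.vs1.span B \<subseteq> f.vs2.span (f ` (B - C))"
      unfolding f.span_image[symmetric] using f.vs2.span_minimal f.vs2.subspace_span by blast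
    then have *: "f ` V \<subseteq> f.vs2.span (f ` (B - C))" using B(3) by blast
    have "f.vs2.dim (f ` V) \<le> card (f ` (B - C))"
      by (rule f.vs2.dim_le_card[OF *]) (use B in auto)
    also have "\<dots> \<le> card (B - C)" by (rule card_image_le) (use B in auto)
    also have "\<dots> = card B - card C" using B C by (simp add: card_Diff_subset)
    finally have "f.vs1.dim N + f.vs2.dim (f ` V) \<le> f.vs1.dim V"
      using B(5) C(5) card_mono[OF B(4,1)] by simp
    moreover have "finitely_spanned t (f ` V)"
      by (rule f.vs2.finitely_spannedI[OF _ *]) (use B in simp)
    ultimately show ?thesis by blast
  qed
  show "finitely_spanned s V \<longleftrightarrow> finitely_spanned s N \<and> finitely_spanned t (f ` V)"
    using A B NV f.vs1.finitely_spanned_subset by blast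
  show "f.vs1.dim V = f.vs1.dim N + f.vs2.dim (f ` V)" if "finitely_spanned s V"
    using A B that NV f.vs1.finitely_spanned_subset by (meson order_antisym)
qed

lemma linear_bij_dim:
  assumes f: "Vector_Spaces.linear s t f" and V: "module.subspace s V" and inj: "inj_on f V"
  shows "finitely_spanned s V \<longleftrightarrow> finitely_spanned t (f ` V)"
    and "finitely_spanned s V \<Longrightarrow> vector_space.dim s V = vector_space.dim t (f ` V)"
proof -
  interpret f: Vector_Spaces.linear s t f by fact
  have "v = 0" if "v \<in> V" "f v = 0" for v
    using inj_onD[OF inj _ that(1) f.vs1.subspace_0[OF V]] that(2) f.zero by simp
  then have ker: "{v \<in> V. f v = 0} = {0}"
    using f.vs1.subspace_0[OF V] f.zero by blast
  have fd0: "finitely_spanned s {0}" 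
    by (rule f.vs1.finitely_spannedI[of "{}"]) auto
  have dim0: "f.vs1.dim {0} = 0"
    using f.vs1.dim_unique[of "{}" "{0}" 0] f.vs1.independent_empty by simp
  show "finitely_spanned s V \<longleftrightarrow> finitely_spanned t (f ` V)"
    using rank_nullity(1)[OF f V] fd0 by (simp only: ker simp_thms)
  show "f.vs1.dim V = f.vs2.dim (f ` V)" if "finitely_spanned s V"
    using rank_nullity(2)[OF f V that] by (simp only: ker dim0 add_0)
qed

text \<open>This bridges two notions of dimension: the size of a basis for a subset of a type, and
  the least size of a finite generating set for the space of cosets. Generating cosets lift to
  \<open>V\<close> and are completed by a basis of \<open>W\<close>; a basis of \<open>W\<close>
  extended to \<open>V\<close> yields generating cosets from its new members.\<close>

lemma quotient_space_dim:
  fixes s :: "'a::field \<Rightarrow> 'v::ab_group_add \<Rightarrow> 'v"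
  assumes s: "vector_space s" and V: "module.subspace s V" and W: "module.subspace s W"
    and WV: "W \<subseteq> V" and fdW: "finitely_spanned s W"
  shows "vectorspace.fin_dim class_ring (quotient_space s V W) \<longleftrightarrow>
      finitely_spanned s V"
    and "finitely_spanned s V \<Longrightarrow>
      vector_space.dim s V = vectorspace.dim class_ring (quotient_space s V W) + vector_space.dim s W"
proof -
  interpret s: vector_space s by fact
  let ?Q = "quotient_space s V W"
  interpret Q: vectorspace class_ring ?Q
    by (rule quotient_space_vectorspace[OF s V W WV])
  define c where "c v = {v + w |w. w \<in> W}" for v
  note Ws = W[unfolded s.subspace_def]
  have W0: "0 \<in> W" using Ws by simp
  have carr: "carrier ?Q = c ` V"
    by (auto simp: quotient_space_def c_def)
  have zero: "\<zero>\<^bsub>?Q\<^esub> = c 0"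
    by (simp add: quotient_space_def c_def)
  have plus: "c u \<oplus>\<^bsub>?Q\<^esub> c v = c (u + v)" for u v
  proof (intro equalityI subsetI)
    fix x assume "x \<in> c u \<oplus>\<^bsub>?Q\<^esub> c v"
    then obtain w w' where "x = (u + w) + (v + w')" "w \<in> W" "w' \<in> W"
      by (auto simp: quotient_space_def c_def)
    then have "x = (u + v) + (w + w')" "w + w' \<in> W"
      using Ws by (auto simp: algebra_simps)
    then show "x \<in> c (u + v)" unfolding c_def by blast
  next
    fix x assume "x \<in> c (u + v)"
    then obtain w where "x = (u + w) + (v + 0)" "w \<in> W"
      by (auto simp: c_def algebra_simps)
    then have "\<exists>a b. x = a + b \<and> a \<in> c u \<and> b \<in> c v" using W0 unfolding c_def by blast
    then show "x \<in> c u \<oplus>\<^bsub>?Q\<^esub> c v"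
      by (simp add: quotient_space_def c_def)
  qed
  have smult: "r \<odot>\<^bsub>?Q\<^esub> c v = c (s r v)" for r v
  proof (intro equalityI subsetI)
    fix x assume "x \<in> r \<odot>\<^bsub>?Q\<^esub> c v"
    then obtain w w' where "x = s r (v + w) + w'" "w \<in> W" "w' \<in> W"
      by (auto simp: quotient_space_def c_def)
    then have "x = s r v + (s r w + w')" "s r w + w' \<in> W"
      using Ws by (auto simp: s.scale_right_distrib algebra_simps)
    then show "x \<in> c (s r v)" unfolding c_def by blast
  next
    fix x assume "x \<in> c (s r v)"
    then obtain w where "x = s r (v + 0) + w" "w \<in> W" by (auto simp: c_def)
    then have "\<exists>a w. x = s r a + w \<and> a \<in> c v \<and> w \<in> W" using W0 unfolding c_def by blast
    then show "x \<in> r \<odot>\<^bsub>?Q\<^esub> c v"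
      by (simp add: quotient_space_def c_def)
  qed
  have modQ: "Module.module class_ring ?Q" ..
  have ceq: "u - v \<in> W" if "c u = c v" for u v
  proof -
    have "u + 0 \<in> c u" using W0 unfolding c_def by blast
    then have "u \<in> c v" using that by simp
    then show ?thesis by (auto simp: c_def)
  qed
  have c0: "c w = c 0" if "w \<in> W" for w
  proof -
    have "w + v \<in> W \<longleftrightarrow> v \<in> W" for v
      using that W by (metis add_diff_cancel_left' s.subspace_add s.subspace_diff)
    then show ?thesis using that Ws by (auto simp: c_def) (metis add.commute diff_add_cancel that)
  qed
  have A: "finitely_spanned s V \<and> s.dim V \<le> card A + s.dim W"
    if A: "finite A" "A \<subseteq> carrier ?Q" "Q.gen_set A" for A
  proof -
    obtain R where R: "R \<subseteq> V" "inj_on c R" "A = c ` R"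
      using A(2) unfolding carr by (meson subset_image_inj)
    then have R': "finite R" "card R = card A" using A(1) finite_image_iff card_image by metis+
    obtain B where B: "B \<subseteq> W" "W \<subseteq> s.span B" "finite B" "card B = s.dim W"
      using s.finite_basis[OF fdW] by metis
    let ?S = "s.span (R \<union> B)"
    have SV: "?S \<subseteq> V" using R(1) B(1) WV V by (intro s.span_minimal) auto
    have "submodule class_ring (c ` ?S) ?Q"
    proof (rule submodule.intro)
      show "c ` ?S \<subseteq> carrier ?Q" using SV by (auto simp: carr)
      show "\<zero>\<^bsub>?Q\<^esub> \<in> c ` ?S" by (simp add: zero s.span_zero)
    qed (auto simp: modQ plus smult s.span_add s.span_scale)
    moreover have "A \<subseteq> c ` ?S" unfolding R(3) by (auto intro: s.span_base)
    ultimately have "Q.span A \<subseteq> c ` ?S" by (intro Q.span_is_subset)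
    then have cV: "c ` V \<subseteq> c ` ?S" using A(3) carr by simp
    have sub: "V \<subseteq> ?S"
    proof
      fix v assume "v \<in> V"
      then obtain u where u: "u \<in> ?S" "c v = c u" using cV by blast
      then have "v - u \<in> W" using ceq by simp
      then have "v - u \<in> ?S" using B(2) s.span_mono[of B "R \<union> B"] by auto
      then show "v \<in> ?S" using u(1) s.span_add by fastforce
    qed
    have card: "card (R \<union> B) \<le> card A + s.dim W"
      using card_Un_le[of R B] B(4) R'(2) by simp
    have fin: "finite (R \<union> B)" using R'(1) B(3) by simp
    show ?thesis
      using le_trans[OF s.dim_le_card[OF sub fin] card] s.finitely_spannedI[OF fin sub] by blast
  qed
  have B: "\<exists>A. finite A \<and> A \<subseteq> carrier ?Q \<and> Q.gen_set A \<and> card A + s.dim W \<le> s.dim V"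
    if fd: "finitely_spanned s V"
  proof -
    obtain C where C: "C \<subseteq> W" "W \<subseteq> s.span C" "s.independent C" "finite C" "card C = s.dim W"
      using s.finite_basis[OF fdW] by metis
    obtain B where B: "C \<subseteq> B" "B \<subseteq> V" "V \<subseteq> s.span B" "finite B" "card B = s.dim V"
      using s.extend_to_basis[OF fd _ C(3)] C(1) WV by (metis subset_trans)
    let ?A = "c ` (B - C)"
    have AQ: "?A \<subseteq> carrier ?Q" using B(2) by (auto simp: carr)
    have sm: "submodule class_ring (Q.span ?A) ?Q" by (rule Q.span_is_submodule[OF AQ])
    have "s.subspace {v. c v \<in> Q.span ?A}"
      unfolding s.subspace_def
      using submodule.m_closed[OF sm] submodule.zero_closed[OF sm] submodule.smult_closed[OF sm]
      by (auto simp flip: plus smult zero)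
    moreover have "B \<subseteq> {v. c v \<in> Q.span ?A}"
    proof
      fix b assume b: "b \<in> B"
      show "b \<in> {v. c v \<in> Q.span ?A}"
      proof (cases "b \<in> C")
        case True
        then have "c b = c 0" using C(1) c0 by blast
        then show ?thesis using submodule.zero_closed[OF sm] by (simp add: zero)
      next
        case False
        then show ?thesis using b Q.in_own_span[OF AQ] by auto
      qed
    qed
    ultimately have "s.span B \<subseteq> {v. c v \<in> Q.span ?A}" by (rule s.span_minimal[rotated])
    then have "carrier ?Q \<subseteq> Q.span ?A" using B(3) by (auto simp: carr)
    then have "Q.gen_set ?A" using Q.span_is_subset2[OF AQ] by blast
    moreover have "card ?A + s.dim W \<le> s.dim V"
    proof -
      have "card ?A \<le> card (B - C)" by (rule card_image_le) (use B in auto)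
      also have "\<dots> = card B - card C" using B C by (simp add: card_Diff_subset)
      finally show ?thesis using card_mono[OF B(4,1)] B(5) C(5) by simp
    qed
    moreover have "finite ?A" using B(4) by simp
    ultimately show ?thesis using AQ by (intro exI[of _ ?A]) simp
  qed
  show "Q.fin_dim \<longleftrightarrow> finitely_spanned s V"
  proof
    assume Q.fin_dim
    then obtain A1 where A1: "finite A1" "A1 \<subseteq> carrier ?Q" "Q.gen_set A1"
      unfolding Q.fin_dim_def by (elim exE conjE)
    then show "finitely_spanned s V" by (rule A[THEN conjunct1])
  next
    assume "finitely_spanned s V"
    from B[OF this] obtain A1 where A1: "finite A1" "A1 \<subseteq> carrier ?Q" "Q.gen_set A1"
      by (elim exE conjE)
    then show Q.fin_dim unfolding Q.fin_dim_def by (intro exI[of _ A1] conjI)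
  qed
  show "s.dim V = Q.dim + s.dim W" if fd: "finitely_spanned s V"
  proof (rule antisym)
    let ?P = "\<lambda>n. \<exists>A. finite A \<and> card A = n \<and> A \<subseteq> carrier ?Q \<and> Q.gen_set A"
    obtain A0 where A0: "finite A0" "A0 \<subseteq> carrier ?Q" "Q.gen_set A0" "card A0 + s.dim W \<le> s.dim V"
      using B[OF fd] by (elim exE conjE)
    \<comment> \<open>The minimum in the definition of \<open>Q.dim\<close> is attained only if some
      finite generating set exists; \<open>A0\<close> provides one.\<close>
    have "?P Q.dim" unfolding Q.dim_def
      by (rule LeastI_ex) (intro exI[of _ "card A0"] exI[of _ A0] conjI refl A0)
    from this obtain A1 where A1: "finite A1" "card A1 = Q.dim" "A1 \<subseteq> carrier ?Q" "Q.gen_set A1"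
      by (elim exE conjE)
    from A[OF A1(1,3,4)] show "s.dim V \<le> Q.dim + s.dim W" unfolding A1(2) by (rule conjunct2)
    have "Q.dim \<le> card A0" unfolding Q.dim_def by (rule Least_le) (intro exI[of _ A0] conjI refl A0)
    then show "Q.dim + s.dim W \<le> s.dim V" using A0(4) by simp
  qed
qed

section \<open>Cochains on a subspace\<close>

text \<open>The interior product (contraction) with \<open>x\<close>. Cochains are studied through
  their contractions, so that recursion on the argument list replaces alternating sums.\<close>

definition ins :: "'l \<Rightarrow> ('l list \<Rightarrow> 'm) \<Rightarrow> 'l list \<Rightarrow> 'm" where
  "ins x f = (\<lambda>xs. f (x # xs))"

text \<open>The domain is left arbitrary because \<open>lie_der_power\<close> also scales families
  of cochains, by a nested \<open>fscale\<close>.\<close>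

definition fscale :: "('a \<Rightarrow> 'm \<Rightarrow> 'm) \<Rightarrow> 'a \<Rightarrow> ('x \<Rightarrow> 'm) \<Rightarrow> 'x \<Rightarrow> 'm" where
  "fscale s c f = (\<lambda>xs. s c (f xs))"

text \<open>Subspaces of \<open>E\<close> are sets and not types, so a cochain on \<open>K\<close>
  is normalised to vanish off \<open>K\<close>, and identities between cochains on \<open>K\<close>
  are stated after applying \<open>restr K\<close>.\<close>

definition restr :: "'l set \<Rightarrow> ('l list \<Rightarrow> 'm::zero) \<Rightarrow> 'l list \<Rightarrow> 'm" where
  "restr K f = (\<lambda>xs. if set xs \<subseteq> K then f xs else 0)"

text \<open>\<open>cochains_on sL sM K n\<close> consists of the cochains of degree \<open>n - 1\<close> on \<open>K\<close>, so that the zero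
  space in degree \<open>-1\<close> starts the recursion. They vanish on lists with an entry outside of \<open>K\<close>.\<close>

primrec cochains_on ::
  "('a::field \<Rightarrow> 'l::ab_group_add \<Rightarrow> 'l) \<Rightarrow> ('a \<Rightarrow> 'm::ab_group_add \<Rightarrow> 'm) \<Rightarrow>
   'l set \<Rightarrow> nat \<Rightarrow> ('l list \<Rightarrow> 'm) set" where
  "cochains_on sL sM K 0 = {0}"
| "cochains_on sL sM K (Suc n) =
    {f. (n \<noteq> 0 \<longrightarrow> f [] = 0) \<and> (\<forall>x. ins x f \<in> cochains_on sL sM K n) \<and>
        (\<forall>x. x \<notin> K \<longrightarrow> ins x f = 0) \<and>
        (\<forall>x\<in>K. \<forall>y\<in>K. ins (x + y) f = ins x f + ins y f) \<and>
        (\<forall>c. \<forall>x\<in>K. ins (sL c x) f = fscale sM c (ins x f)) \<and>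
        (\<forall>x. ins x (ins x f) = 0)}"

text \<open>The Lie derivative: \<open>A\<close> applied to the value of \<open>f\<close>, minus the
  sum over all positions of \<open>f\<close> with \<open>D\<close> applied to that entry. The pair
  is arbitrary because elements of U(L), acting on \<open>M\<close> and on \<open>E\<close>, will
  supply it. The recursion is the rule that the commutator of the Lie derivative with
  \<open>ins x\<close> is \<open>ins (D x)\<close>.\<close>

fun lie_der :: "('m::ab_group_add \<Rightarrow> 'm) \<Rightarrow> ('l \<Rightarrow> 'l) \<Rightarrow> ('l list \<Rightarrow> 'm) \<Rightarrow> 'l list \<Rightarrow> 'm" where
  "lie_der A D f [] = A (f [])"
| "lie_der A D f (x # xs) = lie_der A D (ins x f) xs - f (D x # xs)"

text \<open>Cartan's formula \<open>ins x (d f) + d (ins x f) = \<theta> x f\<close>, taken as a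
  definition by recursion on the arguments. It is matched with the alternating sum in
  \<open>coboundary_eq\<close>.\<close>

fun diff :: "('l \<Rightarrow> 'm \<Rightarrow> 'm) \<Rightarrow> ('l \<Rightarrow> 'l \<Rightarrow> 'l) \<Rightarrow> ('l list \<Rightarrow> 'm::ab_group_add) \<Rightarrow> 'l list \<Rightarrow> 'm" where
  "diff act br f [] = 0"
| "diff act br f (x # xs) = lie_der (act x) (br x) f xs - diff act br (ins x f) xs"

lemma ins_apply [simp]: "ins x f xs = f (x # xs)"
  by (simp add: ins_def)

lemma ins_add [simp]: "ins x (f + g) = ins x f + ins x g"
  and ins_diff [simp]: "ins x (f - g) = ins x f - ins x g"
  and ins_uminus [simp]: "ins x (- f) = - ins x f"
  and ins_zero [simp]: "ins x 0 = 0"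
  by (auto simp: fun_eq_iff)

lemma fscale_apply [simp]: "fscale s c f xs = s c (f xs)"
  by (simp add: fscale_def)

lemma ins_scale [simp]: "ins x (fscale s c f) = fscale s c (ins x f)"
  by (auto simp: fun_eq_iff)

lemma ins_lie_der: "ins x (lie_der A D f) = lie_der A D (ins x f) - ins (D x) f"
  by (auto simp: fun_eq_iff)

lemma ins_diff_op: "ins x (diff act br f) = lie_der (act x) (br x) f - diff act br (ins x f)"
  by (auto simp: fun_eq_iff)

lemma restr_apply: "restr K f xs = (if set xs \<subseteq> K then f xs else 0)"
  by (simp add: restr_def)

lemma ins_restr: "ins x (restr K f) = (if x \<in> K then restr K (ins x f) else 0)"
  by (auto simp: fun_eq_iff restr_apply)

lemma restr_add: "restr K (f + g) = restr K f + restr K (g :: _ \<Rightarrow> 'm::ab_group_add)"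
  and restr_diff: "restr K (f - g) = restr K f - restr K (g :: _ \<Rightarrow> 'm::ab_group_add)"
  and restr_zero [simp]: "restr K 0 = 0"
  by (auto simp: fun_eq_iff restr_apply)

lemma restr_eq_iff: "restr K f = restr K g \<longleftrightarrow> (\<forall>xs. set xs \<subseteq> K \<longrightarrow> f xs = g xs)"
  by (auto simp: fun_eq_iff restr_apply)

lemma restr_eqI: "(\<And>xs. set xs \<subseteq> K \<Longrightarrow> f xs = g xs) \<Longrightarrow> restr K f = restr K g"
  by (simp add: restr_eq_iff)

section \<open>Locality on a subspace, and linearity in the cochain\<close>

lemma lie_der_cong:
  assumes "set xs \<subseteq> K" "\<And>x. x \<in> K \<Longrightarrow> D x \<in> K" "\<And>xs. set xs \<subseteq> K \<Longrightarrow> f xs = g xs"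
  shows "lie_der A D f xs = lie_der A D g xs"
  using assms(1,3)
proof (induction xs arbitrary: f g)
  case (Cons x xs)
  have "lie_der A D (ins x f) xs = lie_der A D (ins x g) xs"
    using Cons.prems by (intro Cons.IH) auto
  moreover have "f (D x # xs) = g (D x # xs)" using Cons.prems assms(2) by auto
  ultimately show ?case by simp
qed simp

lemma diff_cong:
  assumes "set xs \<subseteq> K" "\<And>x y. x \<in> K \<Longrightarrow> y \<in> K \<Longrightarrow> br x y \<in> K"
    "\<And>xs. set xs \<subseteq> K \<Longrightarrow> f xs = g xs"
  shows "diff act br f xs = diff act br g xs"
  using assms(1,3)
proof (induction xs arbitrary: f g)
  case (Cons x xs)
  have "diff act br (ins x f) xs = diff act br (ins x g) xs"
    using Cons.prems by (intro Cons.IH) auto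
  moreover have "lie_der (act x) (br x) f xs = lie_der (act x) (br x) g xs"
    using Cons.prems assms(2) by (intro lie_der_cong[of _ K]) auto
  ultimately show ?case by simp
qed simp

lemma restr_lie_der_restr:
  assumes "\<And>x. x \<in> K \<Longrightarrow> D x \<in> K"
  shows "restr K (lie_der A D (restr K f)) = restr K (lie_der A D f)"
  by (intro restr_eqI lie_der_cong[of _ K] assms) (auto simp: restr_apply)

lemma restr_diff_restr:
  assumes "\<And>x y. x \<in> K \<Longrightarrow> y \<in> K \<Longrightarrow> br x y \<in> K"
  shows "restr K (diff act br (restr K f)) = restr K (diff act br f)"
  by (intro restr_eqI diff_cong[of _ K] assms) (auto simp: restr_apply)

lemma lie_der_add:
  assumes "\<And>m m'. A (m + m') = A m + A m'"
  shows "lie_der A D (f + g) = lie_der A D f + lie_der A D g"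
proof
  show "lie_der A D (f + g) xs = (lie_der A D f + lie_der A D g) xs" for xs
    by (induction xs arbitrary: f g) (simp_all add: assms)
qed

lemma lie_der_scale:
  assumes "\<And>m. A (s c m) = s c (A m)" "\<And>m m'. s c (m - m') = s c m - s c m'"
  shows "lie_der A D (fscale s c f) = fscale s c (lie_der A D f)"
proof
  show "lie_der A D (fscale s c f) xs = fscale s c (lie_der A D f) xs" for xs
    by (induction xs arbitrary: f) (simp_all add: assms)
qed

lemma lie_der_zero:
  assumes "\<And>m m'. A (m + m') = A m + A m'"
  shows "lie_der A D 0 = 0"
  using lie_der_add[OF assms, of D 0 0] by simp

lemma lie_der_diff:
  assumes "\<And>m m'. A (m + m') = A m + A m'"
  shows "lie_der A D (f - g) = lie_der A D f - lie_der A D g"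
  using lie_der_add[OF assms, of D "f - g" g] by (simp add: eq_diff_eq)

lemma (in vector_space) vector_space_pointwise: "vector_space (fscale scale)"
  by unfold_locales (auto simp: fun_eq_iff algebra_simps)

context lie_algebra
begin

lemma bracket_minus [simp]: "bracket x (- y) = - bracket x y" "bracket (- x) y = - bracket x y"
  using bracket_scale_right[of x "-1" y] bracket_scale_left[of "-1" x y] by simp_all

lemma bracket_swap: "bracket y x = - bracket x y"
proof -
  have "0 = bracket (x + y) (x + y)" by (simp only: bracket_self)
  also have "\<dots> = bracket x y + bracket y x"
    by (simp only: bracket_add_left bracket_add_right) (simp add: bracket_self)
  finally have "bracket x y + bracket y x = 0" by (rule sym)
  from minus_unique[OF this] show ?thesis by (rule sym)
qed

lemma bracket_bracket: "bracket (bracket x y) z = bracket x (bracket y z) - bracket y (bracket x z)"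
  using jacobi[of x y z] bracket_swap[of z x] bracket_swap[of "bracket x y" z]
  by (simp add: algebra_simps add_eq_0_iff)

end

section \<open>The recursively defined cochain spaces of a Lie module\<close>

context lie_module
begin

abbreviation "C \<equiv> cochains_on scaleL scaleM"
abbreviation "d \<equiv> diff act bracket"
abbreviation "scaleF \<equiv> fscale scaleM :: _ \<Rightarrow> ('l list \<Rightarrow> _) \<Rightarrow> _"

sublocale F: vector_space scaleF
  by (rule M.vector_space_pointwise)

lemma diff_add: "d (f + g) = d f + d g"
proof
  show "d (f + g) xs = (d f + d g) xs" for xs
    by (induction xs arbitrary: f g) (simp_all add: lie_der_add act_add_right)
qed

lemma diff_scale: "d (scaleF c f) = scaleF c (d f)"
proof
  show "d (scaleF c f) xs = scaleF c (d f) xs" for xs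
    by (induction xs arbitrary: f)
      (simp_all add: lie_der_scale act_scale_right M.scale_right_diff_distrib)
qed

lemma linear_diff: "Vector_Spaces.linear scaleF scaleF d"
  by (auto simp: Vector_Spaces.linear_iff F.vector_space_axioms diff_add diff_scale)

lemma linear_restr: "Vector_Spaces.linear scaleF scaleF (restr K)"
  by (auto simp: Vector_Spaces.linear_iff F.vector_space_axioms restr_add fun_eq_iff restr_apply)

lemma linear_ins: "Vector_Spaces.linear scaleF scaleF (ins x)"
  by (auto simp: Vector_Spaces.linear_iff F.vector_space_axioms)

lemma linear_restr_diff: "Vector_Spaces.linear scaleF scaleF (\<lambda>f. restr K (d f))"
  using Vector_Spaces.linear_compose[OF linear_diff linear_restr] by (simp add: o_def)

lemma restr_scale: "restr K (scaleF c f) = scaleF c (restr K f)"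
  by (auto simp: fun_eq_iff restr_apply)

lemma cochains_subspace: "F.subspace (C K n)"
proof (induction n)
  case 0
  show "F.subspace (C K 0)" by (simp add: F.subspace_single_0)
next
  case (Suc n)
  then show "F.subspace (C K (Suc n))"
    unfolding F.subspace_def
    by (auto simp: M.scale_right_distrib M.scale_left_commute algebra_simps fun_eq_iff)
qed

lemma zero_cochain [simp]: "0 \<in> C K n"
  using cochains_subspace F.subspace_0 by blast

lemma cochains_SucD:
  assumes "f \<in> C K (Suc n)"
  shows "n \<noteq> 0 \<Longrightarrow> f [] = 0" "ins x f \<in> C K n" "x \<notin> K \<Longrightarrow> ins x f = 0"
  using assms by auto

lemma ins_cochain: "f \<in> C K n \<Longrightarrow> ins x f \<in> C K (n - 1)"
  by (cases n) auto

lemma cochain_linear: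
  assumes "f \<in> C K n" "x \<in> K"
  shows "y \<in> K \<Longrightarrow> ins (x + y) f = ins x f + ins y f"
    and "ins (scaleL c x) f = scaleF c (ins x f)"
  using assms by (cases n; auto simp: fun_eq_iff)+

lemma cochain_ins_ins [simp]: "f \<in> C K n \<Longrightarrow> ins x (ins x f) = 0"
  by (cases n) auto

lemma cochain_ins_outside: "f \<in> C K n \<Longrightarrow> x \<notin> K \<Longrightarrow> ins x f = 0"
  by (cases n) auto

lemma cochain_support:
  assumes "f \<in> C K n" "f xs \<noteq> 0"
  shows "set xs \<subseteq> K" "Suc (length xs) = n"
proof -
  have "set xs \<subseteq> K \<and> Suc (length xs) = n"
    using assms
  proof (induction n arbitrary: f xs)
    case (Suc n)
    show ?case
    proof (cases xs)
      case Nil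
      then show ?thesis using Suc.prems by auto
    next
      case (Cons x ys)
      then have *: "f (x # ys) \<noteq> 0" "ins x f \<in> C K n" using Suc.prems by auto
      have "x \<in> K"
      proof (rule ccontr)
        assume "x \<notin> K"
        then have "ins x f = 0" by (rule cochain_ins_outside[OF Suc.prems(1)])
        then show False using * by (simp add: fun_eq_iff)
      qed
      moreover have "set ys \<subseteq> K \<and> Suc (length ys) = n"
        by (rule Suc.IH[OF *(2)]) (simp add: *(1))
      ultimately show ?thesis using Cons by simp
    qed
  qed simp
  then show "set xs \<subseteq> K" "Suc (length xs) = n" by auto
qed

lemma restr_cochain: "f \<in> C K n \<Longrightarrow> restr K f = f"
  using cochain_support(1) by (fastforce simp: fun_eq_iff restr_apply)

end

section \<open>Antisymmetry, and Lie derivatives by arbitrary pairs of operators\<close>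

locale lie_module_subspace = lie_module scaleL bracket scaleM act
  for scaleL :: "'a::field \<Rightarrow> 'l::ab_group_add \<Rightarrow> 'l" and bracket
    and scaleM :: "'a \<Rightarrow> 'm::ab_group_add \<Rightarrow> 'm" and act +
  fixes K :: "'l set"
  assumes K: "L.subspace K"
begin

text \<open>Polarise the vanishing of the double contraction with \<open>x + y\<close>. If one of
  the vectors lies outside \<open>K\<close>, both sides vanish.\<close>

lemma ins_swap:
  assumes f: "f \<in> C K n"
  shows "ins x (ins y f) = - ins y (ins x f)"
proof (cases "x \<in> K \<and> y \<in> K")
  case True
  have "x + y \<in> K" using True K L.subspace_add by blast
  then have "0 = ins (x + y) (ins (x + y) f)" using f by simp
  also have "\<dots> = ins x (ins y f) + ins y (ins x f)"
    using True f ins_cochain[OF f]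
    by (simp add: cochain_linear[OF f] cochain_linear[OF ins_cochain[OF f]])
  finally show ?thesis by (simp add: eq_neg_iff_add_eq_0)
next
  case False
  then show ?thesis
    using cochain_ins_outside[OF f] cochain_ins_outside[OF ins_cochain[OF f]]
    by (metis ins_zero neg_equal_zero add.inverse_neutral)
qed

lemma swap: "f \<in> C K n \<Longrightarrow> f (x # y # xs) = - f (y # x # xs)"
  using ins_swap[of f n y x] by (simp add: fun_eq_iff)

lemma cochain_uminus: "f \<in> C K n \<Longrightarrow> - f \<in> C K n"
  using F.subspace_neg[OF cochains_subspace] by blast

lemma cochain_diff: "f \<in> C K n \<Longrightarrow> g \<in> C K n \<Longrightarrow> f - g \<in> C K n"
  using F.subspace_diff[OF cochains_subspace] by blast

definition linear_on_K :: "('l \<Rightarrow> 'l) \<Rightarrow> bool" where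
  "linear_on_K D \<longleftrightarrow> (\<forall>x\<in>K. D x \<in> K) \<and> (\<forall>x\<in>K. \<forall>y\<in>K. D (x + y) = D x + D y) \<and>
    (\<forall>c. \<forall>x\<in>K. D (scaleL c x) = scaleL c (D x))"

lemma restr_lie_der_cochain:
  assumes A: "Vector_Spaces.linear scaleM scaleM A" and D: "linear_on_K D"
  shows "f \<in> C K n \<Longrightarrow> restr K (lie_der A D f) \<in> C K n"
proof (induction n arbitrary: f)
  case 0
  interpret A: Vector_Spaces.linear scaleM scaleM A by fact
  have "f = 0" using 0 by simp
  then show "restr K (lie_der A D f) \<in> C K 0" by (simp add: lie_der_zero A.add)
next
  case (Suc n)
  interpret A: Vector_Spaces.linear scaleM scaleM A by fact
  have Dx: "D x \<in> K" if "x \<in> K" for x using D that by (auto simp: linear_on_K_def)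
  note f = Suc.prems
  let ?g = "restr K (lie_der A D f)"
  have ins: "ins x ?g = restr K (lie_der A D (ins x f)) - ins (D x) f" if "x \<in> K" for x
    using that f restr_cochain[OF cochains_SucD(2)[OF f]]
    by (simp add: ins_restr ins_lie_der restr_diff)
  have out: "ins x ?g = 0" if "x \<notin> K" for x using that by (simp add: ins_restr)
  have 1: "ins x ?g \<in> C K n" for x
  proof (cases "x \<in> K")
    case True
    show ?thesis unfolding ins[OF True]
      by (intro cochain_diff Suc.IH cochains_SucD(2)[OF f])
  qed (simp add: out)
  have 2: "ins (x + y) ?g = ins x ?g + ins y ?g" if "x \<in> K" "y \<in> K" for x y
  proof -
    have "D (x + y) = D x + D y" "x + y \<in> K"
      using that D K L.subspace_add by (auto simp: linear_on_K_def)
    then show ?thesis using that Dx cochain_linear(1)[OF f]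
      by (simp add: ins lie_der_add A.add restr_add)
  qed
  have 3: "ins (scaleL c x) ?g = scaleF c (ins x ?g)" if "x \<in> K" for x c
  proof -
    have D': "D (scaleL c x) = scaleL c (D x)" "scaleL c x \<in> K"
      using that D K L.subspace_scale by (auto simp: linear_on_K_def)
    have *: "lie_der A D (scaleF c (ins x f)) = scaleF c (lie_der A D (ins x f))"
      by (rule lie_der_scale) (auto simp: A.scale M.scale_right_diff_distrib)
    show ?thesis
      unfolding ins[OF D'(2)] ins[OF that] cochain_linear(2)[OF f that] D'(1)
        cochain_linear(2)[OF f Dx[OF that]] * restr_scale F.scale_right_diff_distrib ..
  qed
  have 4: "ins x (ins x ?g) = 0" for x
  proof (cases "x \<in> K")
    case True
    \<comment> \<open>The last two terms cancel because contractions with \<open>x\<close> and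
      \<open>D x\<close> anticommute.\<close>
    have "ins x (ins x ?g) = restr K (lie_der A D (ins x (ins x f))) - ins (D x) (ins x f)
        - ins x (ins (D x) f)"
      using True restr_cochain[OF cochains_SucD(2)[OF f]] restr_cochain[OF ins_cochain[OF cochains_SucD(2)[OF f]]]
      by (simp add: ins ins_restr ins_lie_der restr_diff)
    also have "\<dots> = 0" using f ins_swap[OF f, of x "D x"] by (simp add: lie_der_zero A.add del: cochains_on.simps)
    finally show ?thesis .
  qed (simp add: out)
  have 5: "?g [] = 0" if "n \<noteq> 0" using that cochains_SucD(1)[OF f] by (simp add: restr_apply A.zero)
  show ?case using 1 2 3 4 5 out by simp
qed

text \<open>In contrast to additivity in \<open>f\<close>, this rests on the additivity of
  \<open>f\<close> in each argument, and so on \<open>f\<close> being a cochain on \<open>K\<close>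
  and on all entries staying in \<open>K\<close>.\<close>

lemma lie_der_add_ops:
  assumes "f \<in> C K n" "set xs \<subseteq> K" "\<And>x. x \<in> K \<Longrightarrow> D x \<in> K" "\<And>x. x \<in> K \<Longrightarrow> D' x \<in> K"
  shows "lie_der (\<lambda>m. A m + A' m) (\<lambda>x. D x + D' x) f xs = lie_der A D f xs + lie_der A' D' f xs"
  using assms(1,2)
proof (induction xs arbitrary: f n)
  case (Cons x xs)
  have "f ((D x + D' x) # xs) = f (D x # xs) + f (D' x # xs)"
    using cochain_linear(1)[OF Cons.prems(1), of "D x" "D' x"] Cons.prems(2) assms(3,4)
    by (simp add: fun_eq_iff)
  moreover have "lie_der (\<lambda>m. A m + A' m) (\<lambda>x. D x + D' x) (ins x f) xs =
      lie_der A D (ins x f) xs + lie_der A' D' (ins x f) xs"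
    by (rule Cons.IH[OF ins_cochain[OF Cons.prems(1)]]) (use Cons.prems in simp)
  ultimately show ?case by simp
qed simp

lemma lie_der_scale_ops:
  assumes "f \<in> C K n" "set xs \<subseteq> K" "\<And>x. x \<in> K \<Longrightarrow> D x \<in> K"
  shows "lie_der (\<lambda>m. scaleM c (A m)) (\<lambda>x. scaleL c (D x)) f xs = scaleM c (lie_der A D f xs)"
  using assms(1,2)
proof (induction xs arbitrary: f n)
  case (Cons x xs)
  have "f (scaleL c (D x) # xs) = scaleM c (f (D x # xs))"
    using cochain_linear(2)[OF Cons.prems(1), of "D x"] Cons.prems(2) assms(3)
    by (simp add: fun_eq_iff)
  moreover have "lie_der (\<lambda>m. scaleM c (A m)) (\<lambda>x. scaleL c (D x)) (ins x f) xs =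
      scaleM c (lie_der A D (ins x f) xs)"
    by (rule Cons.IH[OF ins_cochain[OF Cons.prems(1)]]) (use Cons.prems in simp)
  ultimately show ?case by (simp add: M.scale_right_diff_distrib)
qed simp

text \<open>In a composite of two Lie derivatives, the terms in which the operators hit different
  places occur in both orders and cancel in the commutator. What survives is a commutator on the
  value and a commutator in a single slot.\<close>

lemma lie_der_commutator:
  assumes A: "Vector_Spaces.linear scaleM scaleM A" and A': "Vector_Spaces.linear scaleM scaleM A'"
    and f: "f \<in> C K n" and xs: "set xs \<subseteq> K"
    and D: "\<And>x. x \<in> K \<Longrightarrow> D x \<in> K" "\<And>x. x \<in> K \<Longrightarrow> D' x \<in> K"
  shows "lie_der (\<lambda>m. A (A' m) - A' (A m)) (\<lambda>x. D (D' x) - D' (D x)) f xs =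
    lie_der A D (lie_der A' D' f) xs - lie_der A' D' (lie_der A D f) xs"
  using f xs
proof (induction xs arbitrary: f n)
  case (Cons x xs)
  interpret A: Vector_Spaces.linear scaleM scaleM A by fact
  interpret A': Vector_Spaces.linear scaleM scaleM A' by fact
  note f = Cons.prems(1)
  have x: "x \<in> K" using Cons.prems by simp
  have "ins (D (D' x)) f = ins (D (D' x) - D' (D x)) f + ins (D' (D x)) f"
    using cochain_linear(1)[OF f, of "D (D' x) - D' (D x)" "D' (D x)"] D x K
    by (simp add: L.subspace_diff)
  then have "f ((D (D' x) - D' (D x)) # xs) = f (D (D' x) # xs) - f (D' (D x) # xs)"
    by (simp add: fun_eq_iff eq_diff_eq)
  moreover have "lie_der (\<lambda>m. A (A' m) - A' (A m)) (\<lambda>x. D (D' x) - D' (D x)) (ins x f) xs =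
      lie_der A D (lie_der A' D' (ins x f)) xs - lie_der A' D' (lie_der A D (ins x f)) xs"
    by (rule Cons.IH[OF ins_cochain[OF f]]) (use Cons.prems in simp)
  ultimately show ?case
    by (simp add: ins_lie_der lie_der_diff A.add A'.add)
qed simp

end

section \<open>Cartan calculus on a subalgebra\<close>

locale lie_module_subalgebra = lie_module_subspace scaleL bracket scaleM act K
  for scaleL :: "'a::field \<Rightarrow> 'l::ab_group_add \<Rightarrow> 'l" and bracket
    and scaleM :: "'a \<Rightarrow> 'm::ab_group_add \<Rightarrow> 'm" and act and K :: "'l set" +
  assumes bracket_closed: "x \<in> K \<Longrightarrow> y \<in> K \<Longrightarrow> bracket x y \<in> K"
begin

abbreviation "\<theta> x \<equiv> lie_der (act x) (bracket x)"

lemma linear_act: "Vector_Spaces.linear scaleM scaleM (act x)"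
  by (auto simp: Vector_Spaces.linear_iff M.vector_space_axioms act_add_right act_scale_right)

lemma bracket_linear_on_K: "x \<in> K \<Longrightarrow> linear_on_K (bracket x)"
  by (auto simp: linear_on_K_def bracket_closed L.bracket_add_right L.bracket_scale_right)

lemma theta_commutator:
  assumes "f \<in> C K n" "set xs \<subseteq> K" "x \<in> K" "y \<in> K"
  shows "\<theta> (bracket x y) f xs = \<theta> x (\<theta> y f) xs - \<theta> y (\<theta> x f) xs"
proof -
  have "\<theta> (bracket x y) = lie_der (\<lambda>m. act x (act y m) - act y (act x m))
      (\<lambda>z. bracket x (bracket y z) - bracket y (bracket x z))"
    by (simp add: act_bracket[abs_def] L.bracket_bracket[abs_def])
  then show ?thesis
    using lie_der_commutator[OF linear_act linear_act assms(1,2)] assms(3,4) bracket_closed by simp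
qed

text \<open>Contract with the first argument \<open>y\<close> and apply Cartan's formula on both
  sides: apart from the induction hypothesis, the difference is exactly the relation in
  \<open>theta_commutator\<close>.\<close>

lemma theta_diff_commute:
  assumes "f \<in> C K n" "set xs \<subseteq> K" "x \<in> K"
  shows "\<theta> x (d f) xs = d (\<theta> x f) xs"
  using assms(1,2)
proof (induction xs arbitrary: f n)
  case Nil
  then show ?case using act_add_right[of x 0 0] by simp
next
  case (Cons y ys)
  have "\<theta> (bracket x y) f ys = \<theta> x (\<theta> y f) ys - \<theta> y (\<theta> x f) ys"
    using Cons.prems assms(3) by (intro theta_commutator) auto
  moreover have "\<theta> x (d (ins y f)) ys = d (\<theta> x (ins y f)) ys"
    using Cons.prems by (intro Cons.IH[OF ins_cochain]) auto
  moreover have "d (ins y (\<theta> x f)) ys = d (\<theta> x (ins y f)) ys - d (ins (bracket x y) f) ys"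
    unfolding ins_lie_der using diff_add[of "\<theta> x (ins y f) - ins (bracket x y) f" "ins (bracket x y) f"]
    by (simp add: eq_diff_eq fun_eq_iff)
  ultimately show ?case
    by (simp add: ins_diff_op lie_der_diff act_add_right)
qed

text \<open>Cartan's formula gives \<open>ins y (d (d f)) = \<theta> y (d f) - d (\<theta> y f) + d
  (d (ins y f))\<close>. The first two terms cancel on \<open>K\<close>, and the last one is covered
  by the induction.\<close>

lemma diff_diff:
  assumes "f \<in> C K n" "set xs \<subseteq> K"
  shows "d (d f) xs = 0"
  using assms
proof (induction xs arbitrary: f n)
  case (Cons y ys)
  have "d (ins y (d f)) ys = d (\<theta> y f) ys - d (d (ins y f)) ys"
    unfolding ins_diff_op using diff_add[of "\<theta> y f - d (ins y f)" "d (ins y f)"]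
    by (simp add: eq_diff_eq fun_eq_iff)
  moreover have "d (d (ins y f)) ys = 0"
    using Cons.prems by (intro Cons.IH[OF ins_cochain]) auto
  ultimately show ?case using theta_diff_commute[OF Cons.prems(1), of ys y] Cons.prems(2) by simp
qed simp

lemma diff_zero [simp]: "d 0 = 0"
  using diff_add[of 0 0] by simp

lemma restr_diff_cochain: "f \<in> C K n \<Longrightarrow> restr K (d f) \<in> C K (Suc n)"
proof (induction n arbitrary: f)
  case 0
  have "f = 0" using 0 by simp
  then show "restr K (d f) \<in> C K (Suc 0)" using zero_cochain[of K "Suc 0"] by simp
next
  case (Suc n)
  note f = Suc.prems
  let ?g = "restr K (d f)"
  have ins: "ins x ?g = restr K (\<theta> x f) - restr K (d (ins x f))" if "x \<in> K" for x
    using that by (simp add: ins_restr ins_diff_op restr_diff)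
  have out: "ins x ?g = 0" if "x \<notin> K" for x using that by (simp add: ins_restr)
  have 1: "ins x ?g \<in> C K (Suc n)" for x
  proof (cases "x \<in> K")
    case True
    show ?thesis unfolding ins[OF True]
      by (intro cochain_diff Suc.IH cochains_SucD(2)[OF f]
          restr_lie_der_cochain[OF linear_act bracket_linear_on_K[OF True] f])
  next
    case False
    show ?thesis unfolding out[OF False] by (rule zero_cochain)
  qed
  have 2: "ins (x + y) ?g = ins x ?g + ins y ?g" if xy: "x \<in> K" "y \<in> K" for x y
  proof -
    have "x + y \<in> K" using xy K L.subspace_add by blast
    moreover have "restr K (\<theta> (x + y) f) = restr K (\<theta> x f) + restr K (\<theta> y f)"
      unfolding restr_add[symmetric]
      using lie_der_add_ops[OF f, of _ "bracket x" "bracket y" "act x" "act y"] bracket_closed xy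
      by (intro restr_eqI) (simp add: act_add_left[abs_def] L.bracket_add_left[abs_def])
    ultimately show ?thesis using xy
      by (simp add: ins cochain_linear(1)[OF f] diff_add restr_add del: cochains_on.simps)
  qed
  have 3: "ins (scaleL c x) ?g = scaleF c (ins x ?g)" if x: "x \<in> K" for x c
  proof -
    have "scaleL c x \<in> K" using x K L.subspace_scale by blast
    moreover have "restr K (\<theta> (scaleL c x) f) = scaleF c (restr K (\<theta> x f))"
      using lie_der_scale_ops[OF f, of _ "bracket x" c "act x"] bracket_closed x
      unfolding restr_scale[symmetric]
      by (intro restr_eqI) (simp add: act_scale_left[abs_def] L.bracket_scale_left[abs_def])
    moreover have "restr K (d (ins (scaleL c x) f)) = scaleF c (restr K (d (ins x f)))"
      by (simp only: cochain_linear(2)[OF f x] diff_scale restr_scale)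
    ultimately show ?thesis using x
      by (simp only: ins F.scale_right_diff_distrib)
  qed
  have 4: "ins x (ins x ?g) = 0" for x
  proof (cases "x \<in> K")
    case True
    \<comment> \<open>Two uses of Cartan's formula produce \<open>\<theta> x (ins x f)\<close> with
      opposite signs; what remains are a double contraction with \<open>x\<close> and a contraction
      with \<open>bracket x x\<close>, both zero.\<close>
    have "ins x (ins x ?g) = restr K (\<theta> x (ins x f) - ins (bracket x x) f)
       - restr K (\<theta> x (ins x f) - d (ins x (ins x f)))"
      by (simp only: ins[OF True] ins_diff ins_restr True if_True ins_lie_der ins_diff_op restr_diff)
    also have "\<dots> = - restr K (ins 0 f)" using f
      by (simp add: L.bracket_self restr_diff del: cochains_on.simps)
    also have "ins 0 f = 0"
      using cochain_linear(1)[OF f, of 0 0] L.subspace_0[OF K] by simp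
    finally show ?thesis by (simp only: restr_zero add.inverse_neutral)
  qed (simp add: out)
  have 5: "?g [] = 0" by (simp add: restr_apply)
  show ?case unfolding cochains_on.simps(2)[of _ _ _ "Suc n"] using 1 2 3 4 5 out
    by (simp del: cochains_on.simps)
qed

end

section \<open>Adjoining one element to a subalgebra\<close>

text \<open>With \<open>\<pi>\<close> the projection along \<open>t\<close> and \<open>l\<close> the
  coordinate along \<open>t\<close>, this is the pullback of \<open>a\<close> under
  \<open>\<pi>\<close> plus the exterior product of \<open>l\<close> with the pullback of
  \<open>b\<close>. The recursive clause is the product rule for contraction with \<open>x\<close>;
  on \<open>[]\<close> the exterior product contributes nothing.\<close>

fun extend ::
  "('l \<Rightarrow> 'l) \<Rightarrow> ('l \<Rightarrow> 'a) \<Rightarrow> ('a \<Rightarrow> 'm \<Rightarrow> 'm) \<Rightarrow> ('l list \<Rightarrow> 'm::ab_group_add) \<Rightarrow> ('l list \<Rightarrow> 'm) \<Rightarrow> 'l list \<Rightarrow> 'm" where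
  "extend \<pi> l s a b [] = a []"
| "extend \<pi> l s a b (x # xs) =
    extend \<pi> l s (ins (\<pi> x) a + fscale s (l x) b) (- ins (\<pi> x) b) xs"

definition (in lie_module) cocycles_on :: "'l set \<Rightarrow> nat \<Rightarrow> ('l list \<Rightarrow> 'm) set" where
  "cocycles_on K n = {f \<in> C K n. restr K (d f) = 0}"

lemma (in lie_module) cocycles_on_subset: "cocycles_on K n \<subseteq> C K n"
  by (auto simp only: cocycles_on_def)

lemma (in lie_module) cocycles_on_subspace: "F.subspace (cocycles_on K n)"
  unfolding cocycles_on_def by (rule subspace_kernel_in[OF linear_restr_diff cochains_subspace])

section \<open>Splitting cochains on \<open>K + F t\<close> into two components on
  \<open>K\<close>\<close>

locale adjoin_element = lie_module_subspace scaleL bracket scaleM act K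
  for scaleL :: "'a::field \<Rightarrow> 'l::ab_group_add \<Rightarrow> 'l" and bracket
    and scaleM :: "'a \<Rightarrow> 'm::ab_group_add \<Rightarrow> 'm" and act and K :: "'l set" +
  fixes t K'
  assumes t: "t \<notin> K"
    and K'_def: "K' = L.span (insert t K)"
begin

sublocale K': lie_module_subspace scaleL bracket scaleM act K'
  by unfold_locales (simp add: K'_def)

text \<open>The coordinate along \<open>t\<close> in the decomposition of \<open>K'\<close> into
  \<open>K\<close> and the line through \<open>t\<close>. Outside \<open>K'\<close> it has no
  meaning, which is why \<open>ext\<close> has to be cut off by \<open>restr K'\<close> to become a
  cochain.\<close>

definition coef :: "'l \<Rightarrow> 'a" where "coef x = (SOME c. x - scaleL c t \<in> K)"
definition proj :: "'l \<Rightarrow> 'l" where "proj x = x - scaleL (coef x) t"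

lemma K_K': "K \<subseteq> K'" and t_K': "t \<in> K'"
  by (auto simp: K'_def intro: L.span_base)

lemma coef_unique:
  assumes "x - scaleL c t \<in> K"
  shows "coef x = c"
proof (rule ccontr)
  have "x - scaleL (coef x) t \<in> K" unfolding coef_def by (rule someI) (rule assms)
  then have "x - scaleL c t - (x - scaleL (coef x) t) \<in> K"
    using assms K L.subspace_diff by blast
  then have *: "scaleL (coef x - c) t \<in> K" by (simp add: L.scale_left_diff_distrib)
  assume "coef x \<noteq> c"
  then have "t = scaleL (inverse (coef x - c)) (scaleL (coef x - c) t)" by simp
  then have "t \<in> K" using L.subspace_scale[OF K *] by metis
  then show False using t by blast
qed

lemma proj_K: "x \<in> K' \<Longrightarrow> proj x \<in> K"
proof -
  assume "x \<in> K'"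
  then obtain c where "x - scaleL c t \<in> L.span K"
    unfolding K'_def using L.span_breakdown_eq by blast
  then have "x - scaleL c t \<in> K" using K L.span_subspace by (metis L.span_eq_iff)
  then show ?thesis using coef_unique by (simp add: proj_def)
qed

lemma coef_add: "x \<in> K' \<Longrightarrow> y \<in> K' \<Longrightarrow> coef (x + y) = coef x + coef y"
  using L.subspace_add[OF K proj_K proj_K, of x y]
  by (intro coef_unique) (simp add: proj_def algebra_simps)

lemma coef_scale: "x \<in> K' \<Longrightarrow> coef (scaleL c x) = c * coef x"
  using L.subspace_scale[OF K proj_K, of x c]
  by (intro coef_unique) (simp add: proj_def algebra_simps)

lemma proj_add: "x \<in> K' \<Longrightarrow> y \<in> K' \<Longrightarrow> proj (x + y) = proj x + proj y"
  by (simp add: proj_def coef_add algebra_simps)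

lemma proj_scale: "x \<in> K' \<Longrightarrow> proj (scaleL c x) = scaleL c (proj x)"
  by (simp add: proj_def coef_scale algebra_simps)

lemma coef_K: "x \<in> K \<Longrightarrow> coef x = 0" and proj_id: "x \<in> K \<Longrightarrow> proj x = x"
  using coef_unique[of x 0] by (simp_all add: proj_def)

lemma coef_t: "coef t = 1" and proj_t: "proj t = 0"
  using coef_unique[of t 1] L.subspace_0[OF K] by (simp_all add: proj_def)

abbreviation "ext \<equiv> extend proj coef scaleM"

lemma ins_ext: "ins x (ext a b) = ext (ins (proj x) a + scaleF (coef x) b) (- ins (proj x) b)"
  by (auto simp: fun_eq_iff)

lemma ext_add: "ext (a + a') (b + b') = ext a b + ext a' b'"
proof
  show "ext (a + a') (b + b') xs = (ext a b + ext a' b') xs" for xs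
  proof (induction xs arbitrary: a a' b b')
    case (Cons x xs)
    have "ext (a + a') (b + b') (x # xs) =
      ext ((ins (proj x) a + scaleF (coef x) b) + (ins (proj x) a' + scaleF (coef x) b'))
        (- ins (proj x) b + - ins (proj x) b') xs"
      by (simp only: extend.simps ins_add F.scale_right_distrib minus_add_distrib add_ac)
    also have "\<dots> = ext (ins (proj x) a + scaleF (coef x) b) (- ins (proj x) b) xs +
        ext (ins (proj x) a' + scaleF (coef x) b') (- ins (proj x) b') xs"
      unfolding Cons.IH by (rule plus_fun_apply)
    also have "\<dots> = (ext a b + ext a' b') (x # xs)"
      by (simp only: extend.simps plus_fun_apply)
    finally show ?case .
  qed simp
qed

lemma ext_scale: "ext (scaleF c a) (scaleF c b) = scaleF c (ext a b)"
proof
  show "ext (scaleF c a) (scaleF c b) xs = scaleF c (ext a b) xs" for xs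
  proof (induction xs arbitrary: a b)
    case (Cons x xs)
    have "ext (scaleF c a) (scaleF c b) (x # xs) =
      ext (scaleF c (ins (proj x) a + scaleF (coef x) b)) (scaleF c (- ins (proj x) b)) xs"
      by (simp only: extend.simps ins_scale F.scale_right_distrib F.scale_minus_right
          F.scale_scale mult.commute)
    also have "\<dots> = scaleF c (ext (ins (proj x) a + scaleF (coef x) b) (- ins (proj x) b)) xs"
      by (rule Cons.IH)
    also have "\<dots> = scaleM c (ext a b (x # xs))" by simp
    also have "\<dots> = scaleF c (ext a b) (x # xs)" by (rule fscale_apply[symmetric])
    finally show ?case .
  qed simp
qed

lemma ext_zero: "ext 0 0 = 0"
  using ext_add[of 0 0 0 0] by (simp only: add_0 add_cancel_right_right)

lemma ins_0_cochain: "f \<in> C K n \<Longrightarrow> ins 0 f = 0"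
  using cochain_linear(1)[of f K n 0 0] L.subspace_0[OF K] by (simp only: add_0 add_cancel_right_right)

lemma cochain_add: "f \<in> C K n \<Longrightarrow> g \<in> C K n \<Longrightarrow> f + g \<in> C K n"
  using F.subspace_add[OF cochains_subspace] by blast

lemma cochain_scale: "f \<in> C K n \<Longrightarrow> scaleF c f \<in> C K n"
  using F.subspace_scale[OF cochains_subspace] by blast

text \<open>\<open>b\<close> has one degree less than \<open>a\<close>. For \<open>n = 0\<close> the
  truncated \<open>n - 1\<close> is harmless, as both spaces are then zero.\<close>

lemma ext_cochain:
  assumes "a \<in> C K n" "b \<in> C K (n - 1)"
  shows "restr K' (ext a b) \<in> C K' n"
  using assms
proof (induction n arbitrary: a b)
  case 0
  then have "a = 0" "b = 0" by auto
  then show "restr K' (ext a b) \<in> C K' 0" by (simp only: ext_zero restr_zero zero_cochain)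
next
  case (Suc n)
  then have a: "a \<in> C K (Suc n)" and b: "b \<in> C K n" by (simp_all only: diff_Suc_1)
  let ?g = "restr K' (ext a b)"
  let ?A = "\<lambda>x. ins (proj x) a + scaleF (coef x) b" and ?B = "\<lambda>x. - ins (proj x) b"
  have ins: "ins x ?g = restr K' (ext (?A x) (?B x))" if "x \<in> K'" for x
    by (simp only: ins_restr that if_True ins_ext)
  have out: "ins x ?g = 0" if "x \<notin> K'" for x
    by (simp only: ins_restr that if_False)
  have A: "?A x \<in> C K n" for x
    by (intro cochain_add cochain_scale b cochains_SucD(2)[OF a])
  have B: "?B x \<in> C K (n - 1)" for x
    by (intro cochain_uminus ins_cochain[OF b])
  have 1: "ins x ?g \<in> C K' n" for x
  proof (cases "x \<in> K'")
    case True
    show ?thesis unfolding ins[OF True] by (intro Suc.IH A B)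
  next
    case False
    show ?thesis unfolding out[OF False] by (rule zero_cochain)
  qed
  have 2: "ins (x + y) ?g = ins x ?g + ins y ?g" if xy: "x \<in> K'" "y \<in> K'" for x y
  proof -
    have s: "x + y \<in> K'" using xy K'.K L.subspace_add by blast
    have "?A (x + y) = ?A x + ?A y"
      by (simp only: proj_add[OF xy] coef_add[OF xy] cochain_linear(1)[OF a proj_K proj_K, OF xy]
          F.scale_left_distrib add_ac)
    moreover have "?B (x + y) = ?B x + ?B y"
      by (simp only: proj_add[OF xy] cochain_linear(1)[OF b proj_K proj_K, OF xy] minus_add_distrib)
    ultimately show ?thesis
      by (simp only: ins[OF s] ins[OF xy(1)] ins[OF xy(2)] ext_add restr_add)
  qed
  have 3: "ins (scaleL c x) ?g = scaleF c (ins x ?g)" if x: "x \<in> K'" for x c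
  proof -
    have s: "scaleL c x \<in> K'" using x K'.K L.subspace_scale by blast
    have "?A (scaleL c x) = scaleF c (?A x)"
      by (simp only: proj_scale[OF x] coef_scale[OF x] cochain_linear(2)[OF a proj_K, OF x]
          F.scale_scale F.scale_right_distrib)
    moreover have "?B (scaleL c x) = scaleF c (?B x)"
      by (simp only: proj_scale[OF x] cochain_linear(2)[OF b proj_K, OF x] F.scale_minus_right)
    ultimately show ?thesis
      by (simp only: ins[OF s] ins[OF x] ext_scale restr_scale)
  qed
  have 4: "ins x (ins x ?g) = 0" for x
  proof (cases "x \<in> K'")
    case True
    \<comment> \<open>In the first component, \<open>coef x\<close> times
      \<open>ins (proj x) b\<close> occurs twice, once from contracting \<open>?A x\<close> and once
      with the opposite sign from \<open>?B x\<close>.\<close>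
    have "ins x (ins x ?g) = restr K' (ext (ins (proj x) (?A x) + scaleF (coef x) (?B x)) (- ins (proj x) (?B x)))"
      by (simp only: ins[OF True] ins_restr True if_True ins_ext)
    also have "ins (proj x) (?A x) + scaleF (coef x) (?B x) = 0"
      by (simp only: ins_add ins_scale cochain_ins_ins[OF a] F.scale_minus_right add_0 add.right_inverse)
    also have "- ins (proj x) (?B x) = 0"
      by (simp only: ins_uminus cochain_ins_ins[OF b] add.inverse_neutral)
    finally show ?thesis by (simp only: ext_zero restr_zero)
  next
    case False
    show ?thesis by (simp only: out[OF False] ins_zero)
  qed
  have 5: "?g [] = 0" if "n \<noteq> 0" using cochains_SucD(1)[OF a that] by (simp add: restr_apply)
  show ?case using 1 2 3 4 5 out by simp
qed

lemma ext_on_K: "set xs \<subseteq> K \<Longrightarrow> ext a b xs = a xs"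
proof (induction xs arbitrary: a b)
  case (Cons x xs)
  have "ext a b (x # xs) = (ins x a + scaleF 0 b) xs"
    using Cons.prems by (simp add: coef_K proj_id Cons.IH)
  then show ?case by simp
qed simp

lemma restr_K_restr_K': "restr K (restr K' f) = restr K f"
  using K_K' by (intro restr_eqI) (auto simp: restr_apply)

lemma restr_ext: "a \<in> C K n \<Longrightarrow> restr K (restr K' (ext a b)) = a"
proof -
  assume "a \<in> C K n"
  then have "restr K a = a" by (rule restr_cochain)
  moreover have "restr K (ext a b) = restr K a" by (intro restr_eqI ext_on_K)
  ultimately show ?thesis by (simp only: restr_K_restr_K')
qed

lemma restr_ins_ext:
  assumes "a \<in> C K n" "b \<in> C K (n - 1)"
  shows "restr K (ins t (restr K' (ext a b))) = b"
proof -
  have "ins t (restr K' (ext a b)) = restr K' (ext (ins 0 a + scaleF 1 b) (- ins 0 b))"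
    by (simp only: ins_restr t_K' if_True ins_ext proj_t coef_t)
  then have "restr K (ins t (restr K' (ext a b))) = restr K (ins 0 a + scaleF 1 b)"
    by (simp only: restr_K_restr_K') (intro restr_eqI ext_on_K)
  also have "\<dots> = b"
    by (simp only: ins_0_cochain[OF assms(1)] add_0 F.scale_one restr_cochain[OF assms(2)])
  finally show ?thesis .
qed

lemma restr_K_cochain: "f \<in> C K' n \<Longrightarrow> restr K f \<in> C K n"
proof (induction n arbitrary: f)
  case 0
  then have "f = 0" by simp
  then show "restr K f \<in> C K 0" by (simp only: restr_zero zero_cochain)
next
  case (Suc n)
  note f = Suc.prems
  let ?g = "restr K f"
  have ins: "ins x ?g = restr K (ins x f)" if "x \<in> K" for x
    by (simp only: ins_restr that if_True)
  have out: "ins x ?g = 0" if "x \<notin> K" for x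
    by (simp only: ins_restr that if_False)
  have 1: "ins x ?g \<in> C K n" for x
  proof (cases "x \<in> K")
    case True
    show ?thesis unfolding ins[OF True] by (intro Suc.IH cochains_SucD(2)[OF f])
  next
    case False
    show ?thesis unfolding out[OF False] by (rule zero_cochain)
  qed
  have 2: "ins (x + y) ?g = ins x ?g + ins y ?g" if xy: "x \<in> K" "y \<in> K" for x y
    using cochain_linear(1)[OF f, of x y] xy K_K' L.subspace_add[OF K xy]
    by (simp only: ins restr_add[symmetric] subset_iff)
  have 3: "ins (scaleL c x) ?g = scaleF c (ins x ?g)" if x: "x \<in> K" for x c
    using cochain_linear(2)[OF f, of x c] x K_K' L.subspace_scale[OF K x]
    by (simp only: ins restr_scale[symmetric] subset_iff)
  have 4: "ins x (ins x ?g) = 0" for x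
  proof (cases "x \<in> K")
    case True
    then show ?thesis by (simp only: ins ins_restr if_True cochain_ins_ins[OF f] restr_zero)
  next
    case False
    show ?thesis by (simp only: out[OF False] ins_zero)
  qed
  have 5: "?g [] = 0" if "n \<noteq> 0" using cochains_SucD(1)[OF f that] by (simp add: restr_apply)
  show ?case using 1 2 3 4 5 out by simp
qed

text \<open>A cochain on \<open>K'\<close> is determined by its values on \<open>K\<close> and by
  those with one argument \<open>t\<close>, since alternation excludes a second \<open>t\<close>.
  Both hypotheses pass to the contractions with \<open>t\<close> and with elements of
  \<open>K\<close>, which together give all contractions.\<close>

lemma cochain_K'_eq_0:
  assumes "f \<in> C K' n" "restr K f = 0" "restr K (ins t f) = 0"
  shows "f = 0"
  using assms
proof (induction n arbitrary: f)
  case 0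
  then show "f = 0" by simp
next
  case (Suc n)
  note f = Suc.prems(1) and f0 = Suc.prems(2) and f1 = Suc.prems(3)
  have t0: "ins t f = 0"
    by (rule Suc.IH[OF cochains_SucD(2)[OF f] f1]) (simp only: cochain_ins_ins[OF f] restr_zero)
  have K0: "ins x f = 0" if x: "x \<in> K" for x
  proof (rule Suc.IH[OF cochains_SucD(2)[OF f]])
    have "ins x (restr K f) = 0" by (simp only: f0 ins_zero)
    then show "restr K (ins x f) = 0" using x by (simp only: ins_restr if_True)
    have "ins t (ins x f) = 0"
      by (simp only: K'.ins_swap[OF f, of t x] t0 ins_zero add.inverse_neutral)
    then show "restr K (ins t (ins x f)) = 0" by (simp only: restr_zero)
  qed
  have "ins x f = 0" if x: "x \<in> K'" for x
  proof -
    have "proj x \<in> K'" "scaleL (coef x) t \<in> K'"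
      using proj_K[OF x] K_K' L.subspace_scale[OF K'.K t_K'] by auto
    then have "ins (proj x + scaleL (coef x) t) f = ins (proj x) f + scaleF (coef x) (ins t f)"
      by (simp only: cochain_linear[OF f] t_K')
    also have "\<dots> = 0" by (simp only: K0[OF proj_K[OF x]] t0 F.scale_zero_right add_0)
    finally show ?thesis by (simp add: proj_def)
  qed
  then have ins: "ins x f = 0" for x using cochain_ins_outside[OF f] by blast
  have "restr K f [] = 0" by (simp only: f0 zero_fun_apply)
  then have "f [] = 0" by (simp add: restr_apply)
  moreover have "f (x # xs) = 0" for x xs using ins[of x] by (simp add: fun_eq_iff)
  ultimately have "f xs = 0" for xs by (cases xs) auto
  then show "f = 0" by (simp add: fun_eq_iff)
qed

text \<open>Rank-nullity for \<open>restr K\<close>, whose kernel contraction with \<open>t\<close>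
  embeds into the functions on \<open>K\<close>. It is stated for a general \<open>V'\<close> so as
  to serve for cochains and for cocycles.\<close>

lemma split_dim:
  assumes V: "F.subspace V'" "V' \<subseteq> C K' n" and im: "restr K ` V' = V"
    and ker: "(\<lambda>f. restr K (ins t f)) ` {f \<in> V'. restr K f = 0} = W"
    and fs: "finitely_spanned scaleF V" "finitely_spanned scaleF W"
  shows "finitely_spanned scaleF V'" "F.dim V' = F.dim V + F.dim W"
proof -
  let ?N = "{f \<in> V'. restr K f = 0}"
  have N: "F.subspace ?N"
    by (rule subspace_kernel_in[OF linear_restr V(1)])
  have lin: "Vector_Spaces.linear scaleF scaleF (\<lambda>f. restr K (ins t f))"
    using Vector_Spaces.linear_compose[OF linear_ins linear_restr] by (simp add: o_def)
  have inj: "inj_on (\<lambda>f. restr K (ins t f)) ?N"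
  proof (rule inj_onI)
    fix f g assume fg: "f \<in> ?N" "g \<in> ?N" "restr K (ins t f) = restr K (ins t g)"
    have "f - g = 0"
    proof (rule cochain_K'_eq_0)
      show "f - g \<in> C K' n" using fg V(2) K'.cochain_diff by blast
      show "restr K (f - g) = 0" using fg by (simp add: restr_diff)
      show "restr K (ins t (f - g)) = 0" by (simp only: ins_diff restr_diff fg(3) diff_self)
    qed
    then show "f = g" by simp
  qed
  note iso = linear_bij_dim[OF lin N inj, unfolded ker]
  note rn = rank_nullity[OF linear_restr V(1), of K, unfolded im]
  have fN: "finitely_spanned scaleF ?N" by (rule iffD2[OF iso(1) fs(2)])
  show fV: "finitely_spanned scaleF V'" by (rule iffD2[OF rn(1)]) (intro conjI fN fs(1))
  show "F.dim V' = F.dim V + F.dim W" unfolding rn(2)[OF fV] iso(2)[OF fN] by (rule add.commute)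
qed

lemma cochains_step:
  assumes "finitely_spanned scaleF (C K (Suc n))" "finitely_spanned scaleF (C K n)"
  shows "finitely_spanned scaleF (C K' (Suc n))"
    and "F.dim (C K' (Suc n)) = F.dim (C K (Suc n)) + F.dim (C K n)"
proof -
  have "restr K ` C K' (Suc n) = C K (Suc n)"
  proof (intro equalityI subsetI)
    fix a assume a: "a \<in> C K (Suc n)"
    have "restr K' (ext a 0) \<in> C K' (Suc n)" by (rule ext_cochain[OF a zero_cochain])
    then show "a \<in> restr K ` C K' (Suc n)" using restr_ext[OF a, of 0] by (metis imageI)
  qed (use restr_K_cochain in blast)
  moreover have "(\<lambda>f. restr K (ins t f)) ` {f \<in> C K' (Suc n). restr K f = 0} = C K n"
  proof (intro equalityI subsetI)
    fix b assume b: "b \<in> C K n"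
    then have b': "b \<in> C K (Suc n - 1)" by simp
    have "restr K' (ext 0 b) \<in> C K' (Suc n)" "restr K (restr K' (ext 0 b)) = 0"
      "restr K (ins t (restr K' (ext 0 b))) = b"
      by (rule ext_cochain[OF zero_cochain b'] restr_ext[OF zero_cochain]
          restr_ins_ext[OF zero_cochain b'])+
    then show "b \<in> (\<lambda>f. restr K (ins t f)) ` {f \<in> C K' (Suc n). restr K f = 0}"
      by (metis (mono_tags, lifting) image_eqI mem_Collect_eq)
  next
    fix b assume "b \<in> (\<lambda>f. restr K (ins t f)) ` {f \<in> C K' (Suc n). restr K f = 0}"
    then obtain f where f: "f \<in> C K' (Suc n)" "b = restr K (ins t f)" by blast
    then show "b \<in> C K n" using restr_K_cochain[OF cochains_SucD(2)[OF f(1)]] by simp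
  qed
  ultimately show "finitely_spanned scaleF (C K' (Suc n))"
    "F.dim (C K' (Suc n)) = F.dim (C K (Suc n)) + F.dim (C K n)"
    by (rule split_dim[OF cochains_subspace subset_refl _ _ assms])+
qed

end

section \<open>Cocycles on \<open>K + F t\<close>\<close>

locale one_step_extension = lie_module_subalgebra scaleL bracket scaleM act K +
    adjoin_element scaleL bracket scaleM act K t K'
  for scaleL :: "'a::field \<Rightarrow> 'l::ab_group_add \<Rightarrow> 'l" and bracket
    and scaleM :: "'a \<Rightarrow> 'm::ab_group_add \<Rightarrow> 'm" and act and K :: "'l set" and t K' +
  assumes bracket_K': "x \<in> K' \<Longrightarrow> y \<in> K' \<Longrightarrow> bracket x y \<in> K'"
    and bracket_t: "x \<in> K \<Longrightarrow> bracket t x \<in> K"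
    and theta_t: "f \<in> cocycles_on K n \<Longrightarrow>
      \<exists>b \<in> C K (n - 1). restr K (lie_der (act t) (bracket t) f) = restr K (d b)"
begin

sublocale K'': lie_module_subalgebra scaleL bracket scaleM act K'
  by unfold_locales (rule bracket_K')

text \<open>By \<open>cochain_K'_eq_0\<close> the coboundary of \<open>f\<close> vanishes on
  \<open>K'\<close> once its two components do, and Cartan's formula expresses the component along
  \<open>t\<close> through the two components of \<open>f\<close>.\<close>

lemma cocycles_K'_iff:
  assumes f: "f \<in> C K' n"
  shows "f \<in> cocycles_on K' n \<longleftrightarrow> restr K f \<in> cocycles_on K n \<and>
    restr K (lie_der (act t) (bracket t) (restr K f)) = restr K (d (restr K (ins t f)))"
proof -
  let ?g = "restr K' (d f)"
  have g: "?g \<in> C K' (Suc n)" by (rule K''.restr_diff_cochain[OF f])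
  have 1: "restr K ?g = restr K (d (restr K f))"
    by (simp only: restr_K_restr_K' restr_diff_restr[OF bracket_closed])
  have "ins t ?g = restr K' (lie_der (act t) (bracket t) f - d (ins t f))"
    by (simp only: ins_restr t_K' if_True ins_diff_op)
  then have 2: "restr K (ins t ?g) = restr K (lie_der (act t) (bracket t) (restr K f)) -
      restr K (d (restr K (ins t f)))"
    by (simp only: restr_K_restr_K' restr_diff restr_diff_restr[OF bracket_closed]
        restr_lie_der_restr[OF bracket_t])
  have "?g = 0 \<longleftrightarrow> restr K ?g = 0 \<and> restr K (ins t ?g) = 0"
    using cochain_K'_eq_0[OF g] by (metis restr_zero ins_zero)
  then show ?thesis
    using f restr_K_cochain[OF f] by (simp only: cocycles_on_def mem_Collect_eq 1 2 right_minus_eq) blast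
qed

lemma cocycles_step:
  assumes "finitely_spanned scaleF (C K (Suc n))" "finitely_spanned scaleF (C K n)"
  shows "F.dim (cocycles_on K' (Suc n)) = F.dim (cocycles_on K (Suc n)) + F.dim (cocycles_on K n)"
proof -
  let ?\<theta> = "lie_der (act t) (bracket t)"
  note sub = cocycles_on_subset[of K'] cocycles_on_subset[of K]
  have im: "restr K ` cocycles_on K' (Suc n) = cocycles_on K (Suc n)"
  proof (intro equalityI subsetI)
    fix a assume aZ: "a \<in> cocycles_on K (Suc n)"
    then have a: "a \<in> C K (Suc n)" using sub by blast
    obtain b where b: "b \<in> C K (Suc n - 1)" "restr K (?\<theta> a) = restr K (d b)"
      using theta_t[OF aZ] by blast
    let ?f = "restr K' (ext a b)"
    have f: "?f \<in> C K' (Suc n)" by (rule ext_cochain[OF a b(1)])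
    \<comment> \<open>Here the hypothesis on \<open>t\<close> enters: a cocycle \<open>a\<close>
      extends to \<open>K'\<close> because \<open>b\<close> solves the equation
      \<open>?\<theta> a = d b\<close> on \<open>K\<close>.\<close>
    have "?f \<in> cocycles_on K' (Suc n)"
      unfolding cocycles_K'_iff[OF f] restr_ext[OF a] restr_ins_ext[OF a b(1)] using aZ b(2) by blast
    then show "a \<in> restr K ` cocycles_on K' (Suc n)" using restr_ext[OF a, of b] by (metis imageI)
  next
    fix a assume "a \<in> restr K ` cocycles_on K' (Suc n)"
    then obtain f where f: "f \<in> cocycles_on K' (Suc n)" "a = restr K f" by blast
    then show "a \<in> cocycles_on K (Suc n)" using cocycles_K'_iff[of f "Suc n"] sub by blast
  qed
  have theta0: "restr K (?\<theta> 0) = 0"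
    by (simp only: lie_der_zero[OF act_add_right] restr_zero)
  have ker: "(\<lambda>f. restr K (ins t f)) ` {f \<in> cocycles_on K' (Suc n). restr K f = 0} = cocycles_on K n"
  proof (intro equalityI subsetI)
    fix b assume bZ: "b \<in> cocycles_on K n"
    then have b: "b \<in> C K (Suc n - 1)" "restr K (d b) = 0" by (auto simp: cocycles_on_def)
    let ?f = "restr K' (ext 0 b)"
    have f: "?f \<in> C K' (Suc n)" "restr K ?f = 0" "restr K (ins t ?f) = b"
      by (rule ext_cochain[OF zero_cochain b(1)] restr_ext[OF zero_cochain]
          restr_ins_ext[OF zero_cochain b(1)])+
    have "?f \<in> cocycles_on K' (Suc n)"
      unfolding cocycles_K'_iff[OF f(1)] f(2,3) theta0 b(2)
      using F.subspace_0[OF cocycles_on_subspace] by simp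
    then show "b \<in> (\<lambda>f. restr K (ins t f)) ` {f \<in> cocycles_on K' (Suc n). restr K f = 0}"
      using f by (metis (mono_tags, lifting) image_eqI mem_Collect_eq)
  next
    fix b assume "b \<in> (\<lambda>f. restr K (ins t f)) ` {f \<in> cocycles_on K' (Suc n). restr K f = 0}"
    then obtain f where f: "f \<in> cocycles_on K' (Suc n)" "restr K f = 0" "b = restr K (ins t f)" by blast
    then have f': "f \<in> C K' (Suc n)" using sub by blast
    have "restr K (d b) = 0"
      using f(1) unfolding cocycles_K'_iff[OF f'] f(2) f(3)[symmetric] theta0 by simp
    moreover have "b \<in> C K n"
      using restr_K_cochain[OF cochains_SucD(2)[OF f']] f(3) by simp
    ultimately show "b \<in> cocycles_on K n" by (simp add: cocycles_on_def)
  qed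
  show ?thesis
    by (rule split_dim(2)[OF cocycles_on_subspace sub(1) im ker])
      (use assms sub F.finitely_spanned_subset in blast)+
qed

end

section \<open>Null-homotopic operators\<close>

context vector_space
begin

lemma power_commuting_difference:
  assumes P: "Vector_Spaces.linear scale scale P" and Q: "Vector_Spaces.linear scale scale Q"
    and PQ: "\<And>x. P (Q x) = Q (P x)"
  shows "((\<lambda>x. P x - Q x) ^^ n) x =
    (\<Sum>i\<le>n. scale (of_nat (n choose i) * (- 1) ^ i) ((P ^^ (n - i)) ((Q ^^ i) x)))"
proof (induction n)
  case (Suc n)
  interpret P: Vector_Spaces.linear scale scale P by fact
  interpret Q: Vector_Spaces.linear scale scale Q by fact
  have PQ': "Q ((P ^^ k) y) = (P ^^ k) (Q y)" for k y
    by (induction k) (simp_all add: PQ[symmetric])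
  define c where "c n i = (of_nat (n choose i) * (- 1) ^ i :: 'a)" for n i
  define T where "T i = (P ^^ (Suc n - i)) ((Q ^^ i) x)" for i
  have PT: "P ((P ^^ (n - i)) ((Q ^^ i) x)) = T i" and QT: "Q ((P ^^ (n - i)) ((Q ^^ i) x)) = T (Suc i)"
    if "i \<le> n" for i
    using that by (simp_all add: T_def Suc_diff_le PQ')
  have "((\<lambda>x. P x - Q x) ^^ Suc n) x = (\<Sum>i\<le>n. scale (c n i) (T i)) - (\<Sum>i\<le>n. scale (c n i) (T (Suc i)))"
    by (simp add: Suc.IH P.sum Q.sum P.scale Q.scale PT QT c_def)
  also have "(\<Sum>i\<le>n. scale (c n i) (T i)) = (\<Sum>i\<le>Suc n. scale (c n i) (T i))"
    by (simp add: c_def binomial_eq_0)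
  also have "\<dots> = scale (c n 0) (T 0) + (\<Sum>i\<le>n. scale (c n (Suc i)) (T (Suc i)))"
    by (rule sum.atMost_Suc_shift)
  also have "\<dots> - (\<Sum>i\<le>n. scale (c n i) (T (Suc i))) =
      scale (c (Suc n) 0) (T 0) + (\<Sum>i\<le>n. scale (c n (Suc i) - c n i) (T (Suc i)))"
    by (simp add: sum_subtractf scale_left_diff_distrib c_def)
  also have "(\<lambda>i. c n (Suc i) - c n i) = (\<lambda>i. c (Suc n) (Suc i))"
    by (auto simp: c_def algebra_simps)
  also have "scale (c (Suc n) 0) (T 0) + (\<Sum>i\<le>n. scale (c (Suc n) (Suc i)) (T (Suc i))) =
      (\<Sum>i\<le>Suc n. scale (c (Suc n) i) (T i))"
    by (rule sum.atMost_Suc_shift[symmetric])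
  finally show ?case by (simp only: c_def T_def)
qed simp

text \<open>The inner binomial coefficients are divisible by the characteristic, so only the two
  extreme terms of the expansion survive.\<close>

lemma power_char_commuting_difference:
  assumes P: "Vector_Spaces.linear scale scale P" and Q: "Vector_Spaces.linear scale scale Q"
    and PQ: "\<And>x. P (Q x) = Q (P x)" and p: "prime CHAR('a)"
  shows "((\<lambda>x. P x - Q x) ^^ CHAR('a)) x = (P ^^ CHAR('a)) x - (Q ^^ CHAR('a)) x"
proof -
  let ?p = "CHAR('a)"
  define t where "t i = scale (of_nat (?p choose i) * (- 1) ^ i) ((P ^^ (?p - i)) ((Q ^^ i) x))" for i
  have "t i = 0" if "i \<in> {..?p} - {0, ?p}" for i
  proof -
    have "?p dvd (?p choose i)" using that p by (intro dvd_choose_prime) auto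
    then have "of_nat (?p choose i) = (0 :: 'a)" by (simp add: of_nat_eq_0_iff_char_dvd)
    then show ?thesis by (simp add: t_def)
  qed
  then have "sum t {..?p} = sum t {0, ?p}"
    by (intro sum.mono_neutral_right) auto
  moreover have "?p \<noteq> 0" using p by (metis not_prime_0)
  \<comment> \<open>This includes \<open>?p = 2\<close>, where \<open>1\<close> and
    \<open>- 1\<close> coincide.\<close>
  moreover have "(- 1) ^ ?p = (- 1 :: 'a)"
    using minus_power_prime_CHAR[OF refl p, of 1] by simp
  ultimately have "sum t {..?p} = (P ^^ ?p) x - (Q ^^ ?p) x"
    by (simp add: t_def)
  then show ?thesis
    unfolding power_commuting_difference[OF P Q PQ] t_def .
qed

end

context lie_module
begin

text \<open>On the family \<open>\<lambda>x. ins x f\<close> the Lie derivative acts as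
  \<open>P - Q\<close>, where \<open>P\<close> differentiates each member and \<open>Q\<close>
  substitutes \<open>D x\<close> for \<open>x\<close>. These commute, so the p-th power of
  \<open>P - Q\<close> is the difference of the p-th powers, and this is the recursion for the Lie
  derivative by the p-th powers of \<open>A\<close> and \<open>D\<close>.\<close>

lemma lie_der_power:
  fixes D :: "'l \<Rightarrow> 'l"
  assumes A: "Vector_Spaces.linear scaleM scaleM A" and p: "prime CHAR('a)"
  shows "(lie_der A D ^^ CHAR('a)) f = lie_der (A ^^ CHAR('a)) (D ^^ CHAR('a)) f"
proof
  let ?p = "CHAR('a)"
  interpret A: Vector_Spaces.linear scaleM scaleM A by fact
  let ?s = "fscale (fscale scaleM) :: 'a \<Rightarrow> ('l \<Rightarrow> 'l list \<Rightarrow> 'm) \<Rightarrow> _"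
  interpret G: vector_space ?s by (rule F.vector_space_pointwise)
  define P where "P G = (\<lambda>x. lie_der A D (G x))" for G :: "'l \<Rightarrow> 'l list \<Rightarrow> 'm"
  define Q where "Q G = (\<lambda>x. G (D x))" for G :: "'l \<Rightarrow> 'l list \<Rightarrow> 'm"
  have P: "Vector_Spaces.linear ?s ?s P"
    unfolding Vector_Spaces.linear_iff
  proof (intro conjI allI G.vector_space_axioms)
    show "P (G + H) = P G + P H" for G H
      by (rule ext) (simp only: P_def plus_fun_apply lie_der_add[OF A.add])
    show "P (?s c G) = ?s c (P G)" for c G
      by (rule ext) (simp only: P_def fscale_apply lie_der_scale[of A scaleM, OF A.scale M.scale_right_diff_distrib])
  qed
  have Q: "Vector_Spaces.linear ?s ?s Q"
    unfolding Vector_Spaces.linear_iff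
  proof (intro conjI allI G.vector_space_axioms)
    show "Q (G + H) = Q G + Q H" for G H
      by (simp add: Q_def fun_eq_iff)
    show "Q (?s c G) = ?s c (Q G)" for c G
      by (simp add: Q_def fun_eq_iff)
  qed
  have PQ: "P (Q G) = Q (P G)" for G by (simp add: P_def Q_def)
  have Pn: "(P ^^ n) G x = (lie_der A D ^^ n) (G x)" for n G x
    by (induction n) (simp_all add: P_def)
  have Qn: "(Q ^^ n) G x = G ((D ^^ n) x)" for n G x
    by (induction n arbitrary: x) (simp_all add: Q_def funpow_swap1[of D])
  have ins: "ins x ((lie_der A D ^^ n) f) = ((\<lambda>G. P G - Q G) ^^ n) (\<lambda>x. ins x f) x" for n x f
  proof (induction n arbitrary: x)
    case (Suc n)
    have "ins x ((lie_der A D ^^ Suc n) f) =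
        lie_der A D (ins x ((lie_der A D ^^ n) f)) - ins (D x) ((lie_der A D ^^ n) f)"
      by (simp only: funpow.simps o_apply ins_lie_der)
    then show ?case by (simp only: Suc.IH funpow.simps o_apply minus_apply P_def Q_def)
  qed simp
  have step: "ins x ((lie_der A D ^^ ?p) f) = (lie_der A D ^^ ?p) (ins x f) - ins ((D ^^ ?p) x) f" for x f
    unfolding ins G.power_char_commuting_difference[OF P Q PQ p]
    by (simp only: minus_apply Pn Qn)
  show "(lie_der A D ^^ ?p) f xs = lie_der (A ^^ ?p) (D ^^ ?p) f xs" for xs
  proof (induction xs arbitrary: f)
    case Nil
    have "(lie_der A D ^^ n) f [] = (A ^^ n) (f [])" for n
      by (induction n) simp_all
    then show ?case by simp
  next
    case (Cons x xs)
    have "(lie_der A D ^^ ?p) f (x # xs) = (lie_der A D ^^ ?p) (ins x f) xs - f ((D ^^ ?p) x # xs)"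
      using fun_cong[OF step[of x f], of xs] by (simp only: ins_apply minus_apply)
    also have "(lie_der A D ^^ ?p) (ins x f) xs = lie_der (A ^^ ?p) (D ^^ ?p) (ins x f) xs"
      by (rule Cons.IH)
    finally show ?case by (simp only: lie_der.simps)
  qed
qed

end

section \<open>Operators that vanish on cohomology, and their closure properties\<close>

context lie_module_subalgebra
begin

text \<open>The operator induces zero on the cohomology of \<open>K\<close> in every degree. The
  cochain \<open>b\<close> may depend on \<open>f\<close> in any way; no linear homotopy is
  fixed.\<close>

definition null :: "('m \<Rightarrow> 'm) \<Rightarrow> ('l \<Rightarrow> 'l) \<Rightarrow> bool" where
  "null A D \<longleftrightarrow> (\<forall>n. \<forall>f\<in>cocycles_on K n. \<exists>b\<in>C K (n - 1). restr K (lie_der A D f) = restr K (d b))"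

lemma nullI:
  assumes "\<And>n f. f \<in> cocycles_on K n \<Longrightarrow> \<exists>b\<in>C K (n - 1). restr K (lie_der A D f) = restr K (d b)"
  shows "null A D"
  using assms by (auto simp: null_def)

lemma nullD:
  assumes "null A D" "f \<in> cocycles_on K n"
  obtains b where "b \<in> C K (n - 1)" "restr K (lie_der A D f) = restr K (d b)"
  using assms by (auto simp: null_def)

lemma coboundary_cocycle:
  assumes "b \<in> C K (n - 1)"
  shows "restr K (d b) \<in> cocycles_on K n"
proof (cases n)
  case 0
  then have "b = 0" using assms by simp
  then have "restr K (d b) = 0" by (simp only: diff_zero restr_zero)
  then show ?thesis using F.subspace_0[OF cocycles_on_subspace] by simp
next
  case (Suc m)
  have "restr K (d (restr K (d b))) = restr K (d (d b))"
    by (rule restr_diff_restr[OF bracket_closed])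
  also have "\<dots> = restr K 0"
    by (intro restr_eqI) (simp add: diff_diff[OF assms])
  finally have "restr K (d (restr K (d b))) = 0" by (simp only: restr_zero)
  moreover have "restr K (d b) \<in> C K n" using restr_diff_cochain[OF assms] Suc by simp
  ultimately show ?thesis by (simp add: cocycles_on_def)
qed

lemma null_cocycle:
  assumes "null A D" "f \<in> cocycles_on K n"
  shows "restr K (lie_der A D f) \<in> cocycles_on K n"
proof -
  obtain b where "b \<in> C K (n - 1)" "restr K (lie_der A D f) = restr K (d b)"
    by (rule nullD[OF assms])
  then show ?thesis using coboundary_cocycle by simp
qed

text \<open>By Cartan's formula, \<open>\<theta>\<^sub>x f\<close> is the coboundary of \<open>ins x f\<close> for a cocycle \<open>f\<close>.\<close>

lemma null_inner:
  assumes "x \<in> K"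
  shows "null (act x) (bracket x)"
proof (rule nullI)
  fix n f assume f: "f \<in> cocycles_on K n"
  have "restr K (d f) = 0" using f by (simp add: cocycles_on_def)
  then have "ins x (restr K (d f)) = 0" by simp
  then have "restr K (\<theta> x f) - restr K (d (ins x f)) = 0"
    using assms by (simp only: ins_restr if_True ins_diff_op restr_diff)
  moreover have "ins x f \<in> C K (n - 1)" using f by (intro ins_cochain) (simp add: cocycles_on_def)
  ultimately show "\<exists>b\<in>C K (n - 1). restr K (\<theta> x f) = restr K (d b)"
    by (intro bexI[of _ "ins x f"]) (simp_all only: right_minus_eq)
qed

lemma null_add:
  assumes "null A D" "null A' D'" "\<And>x. x \<in> K \<Longrightarrow> D x \<in> K" "\<And>x. x \<in> K \<Longrightarrow> D' x \<in> K"
  shows "null (\<lambda>m. A m + A' m) (\<lambda>x. D x + D' x)"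
proof (rule nullI)
  fix n f assume f: "f \<in> cocycles_on K n"
  then have f': "f \<in> C K n" by (simp add: cocycles_on_def)
  obtain b b' where b: "b \<in> C K (n - 1)" "restr K (lie_der A D f) = restr K (d b)"
    "b' \<in> C K (n - 1)" "restr K (lie_der A' D' f) = restr K (d b')"
    using nullD[OF assms(1) f] nullD[OF assms(2) f] by metis
  have "restr K (lie_der (\<lambda>m. A m + A' m) (\<lambda>x. D x + D' x) f) =
      restr K (lie_der A D f + lie_der A' D' f)"
    by (intro restr_eqI) (simp add: lie_der_add_ops[OF f' _ assms(3,4)])
  also have "\<dots> = restr K (d (b + b'))" by (simp only: restr_add b diff_add)
  finally show "\<exists>b\<in>C K (n - 1). restr K (lie_der (\<lambda>m. A m + A' m) (\<lambda>x. D x + D' x) f) = restr K (d b)"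
    using F.subspace_add[OF cochains_subspace b(1,3)] by blast
qed

lemma null_scale:
  assumes "null A D" "\<And>x. x \<in> K \<Longrightarrow> D x \<in> K"
  shows "null (\<lambda>m. scaleM c (A m)) (\<lambda>x. scaleL c (D x))"
proof (rule nullI)
  fix n f assume f: "f \<in> cocycles_on K n"
  then have f': "f \<in> C K n" by (simp add: cocycles_on_def)
  obtain b where b: "b \<in> C K (n - 1)" "restr K (lie_der A D f) = restr K (d b)"
    by (rule nullD[OF assms(1) f])
  have "restr K (lie_der (\<lambda>m. scaleM c (A m)) (\<lambda>x. scaleL c (D x)) f) =
      restr K (scaleF c (lie_der A D f))"
    by (intro restr_eqI) (simp add: lie_der_scale_ops[OF f' _ assms(2)])
  also have "\<dots> = restr K (d (scaleF c b))" by (simp only: restr_scale b diff_scale)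
  finally show "\<exists>b\<in>C K (n - 1). restr K (lie_der (\<lambda>m. scaleM c (A m)) (\<lambda>x. scaleL c (D x)) f) = restr K (d b)"
    using F.subspace_scale[OF cochains_subspace b(1)] by blast
qed

text \<open>Each of the two composites maps cocycles to coboundaries, since null operators preserve
  cocycles. In general, however, a composite is not the Lie derivative by a pair of operators,
  whereas the commutator is. This is why the argument closes up under commutators and p-th powers
  and not under all products in U(L).\<close>

lemma null_commutator:
  assumes A: "Vector_Spaces.linear scaleM scaleM A" and A': "Vector_Spaces.linear scaleM scaleM A'"
    and null: "null A D" "null A' D'"
    and D: "\<And>x. x \<in> K \<Longrightarrow> D x \<in> K" "\<And>x. x \<in> K \<Longrightarrow> D' x \<in> K"
  shows "null (\<lambda>m. A (A' m) - A' (A m)) (\<lambda>x. D (D' x) - D' (D x))"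
proof (rule nullI)
  fix n f assume f: "f \<in> cocycles_on K n"
  then have f': "f \<in> C K n" by (simp add: cocycles_on_def)
  obtain b where b: "b \<in> C K (n - 1)"
    "restr K (lie_der A D (restr K (lie_der A' D' f))) = restr K (d b)"
    by (rule nullD[OF null(1) null_cocycle[OF null(2) f]])
  obtain b' where b': "b' \<in> C K (n - 1)"
    "restr K (lie_der A' D' (restr K (lie_der A D f))) = restr K (d b')"
    by (rule nullD[OF null(2) null_cocycle[OF null(1) f]])
  have dd: "d (b - b') = d b - d b'" using diff_add[of "b - b'" b'] by (simp add: eq_diff_eq)
  have "restr K (lie_der (\<lambda>m. A (A' m) - A' (A m)) (\<lambda>x. D (D' x) - D' (D x)) f) =
      restr K (lie_der A D (lie_der A' D' f) - lie_der A' D' (lie_der A D f))"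
    using lie_der_commutator[OF A A' f' _ D] by (intro restr_eqI) simp
  also have "\<dots> = restr K (d (b - b'))"
    using restr_lie_der_restr[of K D A "lie_der A' D' f", OF D(1)]
      restr_lie_der_restr[of K D' A' "lie_der A D f", OF D(2)]
    by (simp only: restr_diff dd b(2) b'(2))
  finally show "\<exists>b\<in>C K (n - 1).
      restr K (lie_der (\<lambda>m. A (A' m) - A' (A m)) (\<lambda>x. D (D' x) - D' (D x)) f) = restr K (d b)"
    using cochain_diff[OF b(1) b'(1)] by blast
qed

text \<open>All iterates stay among the cocycles, and the last application produces a coboundary.
  Inserting \<open>restr K\<close> between the applications changes nothing because \<open>D\<close>
  preserves \<open>K\<close>.\<close>

lemma null_power:
  assumes A: "Vector_Spaces.linear scaleM scaleM A" and p: "prime CHAR('a)"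
    and null: "null A D" and D: "\<And>x. x \<in> K \<Longrightarrow> D x \<in> K"
  shows "null (A ^^ CHAR('a)) (D ^^ CHAR('a))"
proof (rule nullI)
  fix n f assume f: "f \<in> cocycles_on K n"
  define g where "g k = restr K ((lie_der A D ^^ k) f)" for k
  have g: "g (Suc k) = restr K (lie_der A D (g k))" for k
    by (simp only: g_def funpow.simps o_apply restr_lie_der_restr[OF D])
  have gZ: "g k \<in> cocycles_on K n" for k
  proof (induction k)
    case 0
    have "restr K f = f" using f by (intro restr_cochain) (auto simp: cocycles_on_def)
    then show ?case using f by (simp add: g_def)
  next
    case (Suc k)
    then show ?case unfolding g by (rule null_cocycle[OF null])
  qed
  obtain q where q: "CHAR('a) = Suc q" using p not0_implies_Suc by (metis not_prime_0)
  obtain b where "b \<in> C K (n - 1)" "g (Suc q) = restr K (d b)"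
    unfolding g by (rule nullD[OF null gZ])
  moreover have "g (Suc q) = restr K (lie_der (A ^^ CHAR('a)) (D ^^ CHAR('a)) f)"
    unfolding g_def q[symmetric] lie_der_power[OF A p] ..
  ultimately show "\<exists>b\<in>C K (n - 1). restr K (lie_der (A ^^ CHAR('a)) (D ^^ CHAR('a)) f) = restr K (d b)"
    by metis
qed

end

section \<open>The universal enveloping algebra and its modules\<close>

lemma poly_mapping_add_induct [case_names zero add]:
  fixes f :: "'w \<Rightarrow>\<^sub>0 'b::monoid_add"
  assumes "P 0" "\<And>f w c. P f \<Longrightarrow> P (f + Poly_Mapping.single w c)"
  shows "P f"
proof (induction f rule: update_induct)
  case (update f a b)
  have "Poly_Mapping.update a b f = f + Poly_Mapping.single a b"
    using update by (intro poly_mapping_eqI)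
      (auto simp: lookup_update lookup_add lookup_single in_keys_iff when_def)
  then show ?case using assms(2)[OF update(3)] by simp
qed (fact assms(1))

section \<open>Scalars and commutators in the free algebra\<close>

lemma free_scalar_commute:
  fixes f :: "('l, 'a::field) free_algebra"
  shows "free_scalar c * f = f * free_scalar c"
  by (induction f rule: poly_mapping_add_induct)
    (simp_all add: free_scalar_def mult_single distrib_left distrib_right mult.commute)

lemma free_scalar_left_commute:
  fixes f :: "('l, 'a::field) free_algebra"
  shows "f * (free_scalar c * g) = free_scalar c * (f * g)"
  by (metis mult.assoc free_scalar_commute)

lemma free_scalar_simps:
  "free_scalar (c + c') = (free_scalar c + free_scalar c' :: ('l, 'a::field) free_algebra)"
  "free_scalar (c * c') = (free_scalar c * free_scalar c' :: ('l, 'a::field) free_algebra)"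
  "free_scalar 1 = (1 :: ('l, 'a::field) free_algebra)"
  by (simp_all add: free_scalar_def single_add mult_single)

lemma free_algebra_vector_space:
  "vector_space (\<lambda>c f. free_scalar c * f :: ('l, 'a::field) free_algebra)"
  by unfold_locales (simp_all add: free_scalar_simps algebra_simps)

text \<open>Left and right multiplication by \<open>f\<close> are commuting operators, so the p-th
  power of their difference is the difference of their p-th powers.\<close>

lemma free_algebra_ad_power:
  fixes f g :: "('l, 'a::field) free_algebra"
  assumes "prime CHAR('a)"
  shows "((\<lambda>g. f * g - g * f) ^^ CHAR('a)) g = f ^ CHAR('a) * g - g * f ^ CHAR('a)"
proof -
  let ?s = "\<lambda>c f. free_scalar c * f :: ('l, 'a) free_algebra"
  interpret vector_space ?s by (rule free_algebra_vector_space)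
  have "Vector_Spaces.linear ?s ?s (\<lambda>g. f * g)" "Vector_Spaces.linear ?s ?s (\<lambda>g. g * f)"
    by (auto simp: Vector_Spaces.linear_iff vector_space_axioms distrib_left distrib_right
        mult.assoc free_scalar_left_commute)
  then have "((\<lambda>g. f * g - g * f) ^^ CHAR('a)) g =
      ((\<lambda>g. f * g) ^^ CHAR('a)) g - ((\<lambda>g. g * f) ^^ CHAR('a)) g"
    by (rule power_char_commuting_difference) (simp_all add: mult.assoc assms)
  moreover have "((\<lambda>g. f * g) ^^ n) g = f ^ n * g" for n
    by (induction n) (simp_all add: mult.assoc)
  moreover have "((\<lambda>g. g * f) ^^ n) g = g * f ^ n" for n
    by (induction n) (simp_all add: mult.assoc power_commutes)
  ultimately show ?thesis by simp
qed

section \<open>Calculating in U(L) with representatives from the free algebra\<close>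

context
  fixes scale :: "'a::field \<Rightarrow> 'l::ab_group_add \<Rightarrow> 'l" and bracket :: "'l \<Rightarrow> 'l \<Rightarrow> 'l"
begin

lemma uea_ideal_ideal: "ideal (uea_ideal scale bracket) class_ring"
  unfolding uea_ideal_def by (rule ring.genideal_ideal[OF class_ring.ring_axioms]) simp

lemma uea_proj_hom: "ring_hom_ring class_ring (uea scale bracket) (uea_proj scale bracket)"
proof -
  have "uea_proj scale bracket = (\<lambda>f. uea_ideal scale bracket +>\<^bsub>class_ring\<^esub> f)"
    by (rule ext) (simp add: uea_proj_def)
  then show ?thesis
    unfolding uea_def using ideal.rcos_ring_hom_ring[OF uea_ideal_ideal] by simp
qed

interpretation p: ring_hom_ring class_ring "uea scale bracket" "uea_proj scale bracket"
  by (rule uea_proj_hom)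

lemma uea_proj_add: "uea_proj scale bracket (f + g) =
    uea_proj scale bracket f \<oplus>\<^bsub>uea scale bracket\<^esub> uea_proj scale bracket g"
  using p.hom_add[of f g] by simp

lemma uea_proj_mult: "uea_proj scale bracket (f * g) =
    uea_proj scale bracket f \<otimes>\<^bsub>uea scale bracket\<^esub> uea_proj scale bracket g"
  using p.hom_mult[of f g] by simp

lemma uea_proj_zero: "uea_proj scale bracket 0 = \<zero>\<^bsub>uea scale bracket\<^esub>"
  using p.hom_zero by simp

lemma uea_proj_carrier: "uea_proj scale bracket f \<in> carrier (uea scale bracket)"
  using p.hom_closed[of f] by simp

lemma uea_proj_minus: "uea_proj scale bracket (f - g) =
    uea_proj scale bracket f \<ominus>\<^bsub>uea scale bracket\<^esub> uea_proj scale bracket g"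
proof -
  have "uea_proj scale bracket f =
      uea_proj scale bracket (f - g) \<oplus>\<^bsub>uea scale bracket\<^esub> uea_proj scale bracket g"
    by (simp flip: uea_proj_add)
  then show ?thesis
    by (simp add: a_minus_def p.S.a_assoc p.S.r_neg uea_proj_carrier)
qed

lemma uea_proj_power: "uea_proj scale bracket (f ^ n) =
    uea_proj scale bracket f [^]\<^bsub>uea scale bracket\<^esub> n"
  by (induction n)
    (use p.hom_one in \<open>simp_all add: uea_proj_mult power_Suc2 del: power_Suc\<close>)

lemma uea_proj_scale: "uea_proj scale bracket (free_scalar c * f) =
    uea_scale scale bracket c (uea_proj scale bracket f)"
  by (simp add: uea_scale_def uea_proj_mult)

lemma uea_proj_bracket: "uea_proj scale bracket (f * g - g * f) =
    uea_bracket scale bracket (uea_proj scale bracket f) (uea_proj scale bracket g)"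
  by (simp add: uea_bracket_def uea_proj_minus uea_proj_mult)

lemma uea_carrier_proj: "u \<in> carrier (uea scale bracket) \<Longrightarrow> \<exists>f. u = uea_proj scale bracket f"
  by (auto simp: uea_def FactRing_def A_RCOSETS_def' uea_proj_def)

lemma uea_proj_mem: "g \<in> uea_proj scale bracket f \<longleftrightarrow> g - f \<in> uea_ideal scale bracket"
proof -
  have "g \<in> uea_proj scale bracket f \<longleftrightarrow> (\<exists>h\<in>uea_ideal scale bracket. g = h + f)"
    by (simp add: uea_proj_def a_r_coset_def')
  also have "\<dots> \<longleftrightarrow> g - f \<in> uea_ideal scale bracket"
    by (metis add_diff_cancel_right' diff_add_cancel)
  finally show ?thesis .
qed

lemma uea_ideal_zero: "0 \<in> uea_ideal scale bracket"
proof -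
  interpret ideal "uea_ideal scale bracket" class_ring by (rule uea_ideal_ideal)
  show ?thesis using zero_closed by simp
qed

end

section \<open>The action of the free algebra on a module and its descent to U(L)\<close>

context lie_module
begin

abbreviation "fac \<equiv> free_act scaleM act"

lemma free_act_superset:
  assumes "finite S" "Poly_Mapping.keys f \<subseteq> S"
  shows "fac f m = (\<Sum>w\<in>S. scaleM (Poly_Mapping.lookup f w) (foldr act (letters w) m))"
  unfolding free_act_def using assms
  by (intro sum.mono_neutral_left) (auto simp: in_keys_iff)

lemma free_act_zero [simp]: "fac 0 m = 0"
  by (simp add: free_act_def)

lemma free_act_add: "fac (f + g) m = fac f m + fac g m"
proof -
  let ?S = "Poly_Mapping.keys f \<union> Poly_Mapping.keys g"
  have S: "finite ?S" "Poly_Mapping.keys (f + g) \<subseteq> ?S" using Poly_Mapping.keys_add[of f g] by auto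
  show ?thesis
    unfolding free_act_superset[OF S] free_act_superset[OF S(1) Un_upper1]
      free_act_superset[OF S(1) Un_upper2]
    by (simp add: lookup_add M.scale_left_distrib sum.distrib)
qed

lemma free_act_diff: "fac (f - g) m = fac f m - fac g m"
  using free_act_add[of "f - g" g m] by (simp add: eq_diff_eq)

lemma free_act_single: "fac (Poly_Mapping.single w c) m = scaleM c (foldr act (letters w) m)"
  using free_act_superset[of "{w}" "Poly_Mapping.single w c" m] by simp

lemma foldr_act_add: "foldr act ws (m + m') = foldr act ws m + foldr act ws m'"
  by (induction ws) (simp_all add: act_add_right)

lemma foldr_act_scale: "foldr act ws (scaleM c m) = scaleM c (foldr act ws m)"
  by (induction ws) (simp_all add: act_scale_right)

lemma free_act_add_right: "fac f (m + m') = fac f m + fac f m'"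
  by (simp add: free_act_def foldr_act_add M.scale_right_distrib sum.distrib)

lemma free_act_scale_right: "fac f (scaleM c m) = scaleM c (fac f m)"
  by (simp add: free_act_def foldr_act_scale M.scale_sum_right mult.commute)

lemma linear_free_act: "Vector_Spaces.linear scaleM scaleM (fac f)"
  by (auto simp: Vector_Spaces.linear_iff M.vector_space_axioms free_act_add_right free_act_scale_right)

lemma free_act_zero_right [simp]: "fac f 0 = 0"
  using free_act_add_right[of f 0 0] by simp

lemma free_act_mult: "fac (f * g) m = fac f (fac g m)"
proof (induction f rule: poly_mapping_add_induct)
  case (add f w c)
  have "fac (Poly_Mapping.single w c * g) m = fac (Poly_Mapping.single w c) (fac g m)"
    by (induction g rule: poly_mapping_add_induct)
      (simp_all add: distrib_left free_act_add free_act_add_right mult_single free_act_single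
        foldr_act_scale plus_word_def)
  then show ?case using add by (simp add: distrib_right free_act_add)
qed simp

lemma free_act_gen: "fac (free_gen x) m = act x m"
  by (simp add: free_gen_def free_act_single)

lemma free_act_scalar: "fac (free_scalar c) m = scaleM c m"
  by (simp add: free_scalar_def free_act_single zero_word_def)

lemma free_act_power: "fac (f ^ n) m = (fac f ^^ n) m"
proof (induction n)
  case 0
  show ?case using free_act_scalar[of 1 m] by (simp add: free_scalar_simps)
qed (simp add: free_act_mult)

text \<open>The elements that act as zero form a two-sided ideal, and the module axioms put the
  defining relations of U(L) into it.\<close>

lemma free_act_ideal: "f \<in> uea_ideal scaleL bracket \<Longrightarrow> fac f m = 0"
proof -
  let ?I = "{f. \<forall>m. fac f m = 0}"
  have "ideal ?I class_ring"
  proof (rule idealI)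
    show "ring (class_ring :: ('l, 'a) free_algebra ring)" by (rule class_ring.ring_axioms)
    show "subgroup ?I (add_monoid class_ring)"
    proof (rule group.subgroupI)
      show "Group.group (add_monoid (class_ring :: ('l, 'a) free_algebra ring))"
        by (rule abelian_group.a_group[OF ring.is_abelian_group[OF class_ring.ring_axioms]])
      fix a :: "('l, 'a) free_algebra" assume "a \<in> ?I"
      then have "- a \<in> ?I" using free_act_diff[of 0 a] by simp
      moreover have "\<ominus>\<^bsub>class_ring\<^esub> a = - a" by (simp only: class_ring_simps)
      ultimately show "inv\<^bsub>add_monoid class_ring\<^esub> a \<in> ?I" unfolding a_inv_def by (simp only:)
    qed (auto simp: free_act_add intro: exI[of _ 0])
  qed (auto simp: free_act_mult)
  moreover have "uea_relations scaleL bracket \<subseteq> ?I"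
    by (auto simp: uea_relations_def free_act_diff free_act_mult free_act_gen free_act_scalar
        act_add_left act_scale_left act_bracket)
  ultimately have "uea_ideal scaleL bracket \<subseteq> ?I"
    unfolding uea_ideal_def by (rule ring.genideal_minimal[OF class_ring.ring_axioms])
  then show "f \<in> uea_ideal scaleL bracket \<Longrightarrow> fac f m = 0" by blast
qed

text \<open>All representatives of a coset act alike by \<open>free_act_ideal\<close>, so the set to
  which \<open>the_elem\<close> is applied is a singleton.\<close>

lemma uea_act_proj: "uea_act scaleM act (uea_proj scaleL bracket f) m = fac f m"
proof -
  have "fac g m = fac f m" if "g \<in> uea_proj scaleL bracket f" for g
    using free_act_ideal[of "g - f" m] that by (simp add: uea_proj_mem free_act_diff)
  moreover have "f \<in> uea_proj scaleL bracket f" by (simp add: uea_proj_mem uea_ideal_zero)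
  ultimately have "(\<lambda>f. fac f m) ` uea_proj scaleL bracket f = {fac f m}" by blast
  then show ?thesis unfolding uea_act_def by simp
qed

lemma uea_act_incl: "uea_act scaleM act (uea_incl scaleL bracket x) m = act x m"
  by (simp add: uea_incl_def uea_act_proj free_act_gen)

end

section \<open>The Poincare-Birkhoff-Witt theorem: injectivity\<close>

text \<open>Finitely supported functions on multisets of indices are polynomials in commuting
  variables, a model of the symmetric algebra. The generators are to act on it as they do on U(L) by
  left multiplication, with multisets standing for ordered monomials.\<close>

abbreviation const_pm :: "'a::comm_ring_1 \<Rightarrow> nat multiset \<Rightarrow>\<^sub>0 'a" where
  "const_pm c \<equiv> Poly_Mapping.single 0 c"

abbreviation monom_pm :: "nat multiset \<Rightarrow> nat multiset \<Rightarrow>\<^sub>0 'a::comm_ring_1" where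
  "monom_pm S \<equiv> Poly_Mapping.single S 1"

lemma const_pm_sum: "const_pm (sum f I) = (\<Sum>i\<in>I. const_pm (f i))"
  by (induction I rule: infinite_finite_induct) (simp_all add: single_add)

definition lin_ext ::
  "(nat multiset \<Rightarrow> nat multiset \<Rightarrow>\<^sub>0 'a) \<Rightarrow> (nat multiset \<Rightarrow>\<^sub>0 'a::comm_ring_1) \<Rightarrow> nat multiset \<Rightarrow>\<^sub>0 'a" where
  "lin_ext g v = (\<Sum>U\<in>Poly_Mapping.keys v. const_pm (Poly_Mapping.lookup v U) * g U)"

lemma lin_ext_superset:
  assumes "finite S" "Poly_Mapping.keys v \<subseteq> S"
  shows "lin_ext g v = (\<Sum>U\<in>S. const_pm (Poly_Mapping.lookup v U) * g U)"
  unfolding lin_ext_def using assms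
  by (intro sum.mono_neutral_left) (auto simp: in_keys_iff)

lemma lin_ext_add: "lin_ext g (v + w) = lin_ext g v + lin_ext g w"
proof -
  let ?S = "Poly_Mapping.keys v \<union> Poly_Mapping.keys w"
  have S: "finite ?S" "Poly_Mapping.keys (v + w) \<subseteq> ?S" using Poly_Mapping.keys_add[of v w] by auto
  show ?thesis
    unfolding lin_ext_superset[OF S] lin_ext_superset[OF S(1) Un_upper1]
      lin_ext_superset[OF S(1) Un_upper2]
    by (simp add: lookup_add single_add distrib_right sum.distrib)
qed

lemma lin_ext_single: "lin_ext g (Poly_Mapping.single S c) = const_pm c * g S"
  using lin_ext_superset[of "{S}" "Poly_Mapping.single S c" g] by simp

lemma lin_ext_zero [simp]: "lin_ext g 0 = 0"
  by (simp add: lin_ext_def)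

lemma lin_ext_diff: "lin_ext g (v - w) = lin_ext g v - lin_ext g w"
  using lin_ext_add[of g "v - w" w] by (simp add: eq_diff_eq)

lemma lin_ext_const: "lin_ext g (const_pm c * v) = const_pm c * lin_ext g v"
proof (induction v rule: poly_mapping_add_induct)
  case (add v S a)
  have "const_pm (c * a) * g S = const_pm c * (const_pm a * g S)"
    by (simp add: mult_single flip: mult.assoc)
  then show ?case using add by (simp add: distrib_left lin_ext_add mult_single lin_ext_single)
qed simp

lemma lin_ext_sum: "lin_ext g (\<Sum>i\<in>I. v i) = (\<Sum>i\<in>I. lin_ext g (v i))"
  by (induction I rule: infinite_finite_induct) (simp_all add: lin_ext_add)

text \<open>The first \<open>n\<close> generators span a Lie algebra with structure constants \<open>c\<close>; the remaining ones,
  which only avoid bounds on the indices, are central and linearly independent of it.\<close>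

locale structure_constants =
  fixes n :: nat and c :: "nat \<Rightarrow> nat \<Rightarrow> nat \<Rightarrow> 'a::comm_ring_1"
  assumes c_self: "c i i k = 0"
    and c_swap: "c i j k = - c j i k"
    and c_jacobi: "(\<Sum>l<n. c j k l * c i l m + c k i l * c j l m + c i j l * c k l m) = 0"
begin

text \<open>The action of the \<open>i\<close>-th generator on a monomial, obtained by moving the smallest letter of the
  monomial to the front. The condition on \<open>size U\<close> is always satisfied and only makes the
  recursion terminate.\<close>

function gact :: "nat \<Rightarrow> nat multiset \<Rightarrow> nat multiset \<Rightarrow>\<^sub>0 'a" where
  "gact i S = (if \<forall>j\<in>#S. i \<le> j then monom_pm (add_mset i S)
    else let j = Min_mset S; T = S - {#j#}; w = gact i T - monom_pm (add_mset i T) in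
      monom_pm (add_mset i S) +
      (\<Sum>U\<in>Poly_Mapping.keys w. if size U < size S
        then const_pm (Poly_Mapping.lookup w U) * gact j U else 0) +
      (\<Sum>k<n. const_pm (c i j k) * gact k T))"
  by auto
termination
  by (relation "measure (\<lambda>(i, S). size S)") (auto intro!: size_Diff1_less Min_in)

declare gact.simps [simp del]

lemma gact_le: "\<forall>j\<in>#S. i \<le> j \<Longrightarrow> gact i S = monom_pm (add_mset i S)"
  by (simp add: gact.simps)

abbreviation "op i \<equiv> lin_ext (gact i)"

definition deg_le :: "(nat multiset \<Rightarrow>\<^sub>0 'a) \<Rightarrow> nat \<Rightarrow> bool" where
  "deg_le v d \<longleftrightarrow> (\<forall>U\<in>Poly_Mapping.keys v. size U \<le> d)"

lemma deg_le_add: "deg_le v d \<Longrightarrow> deg_le w d \<Longrightarrow> deg_le (v + w) d"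
  using Poly_Mapping.keys_add[of v w] by (auto simp: deg_le_def)

lemma deg_le_zero [simp]: "deg_le 0 d"
  by (simp add: deg_le_def)

lemma deg_le_sum: "(\<And>i. i \<in> I \<Longrightarrow> deg_le (v i) d) \<Longrightarrow> deg_le (\<Sum>i\<in>I. v i) d"
  by (induction I rule: infinite_finite_induct) (simp_all add: deg_le_add)

lemma deg_le_const: "deg_le v d \<Longrightarrow> deg_le (const_pm a * v) d"
  using keys_mult[of "const_pm a" v] by (fastforce simp: deg_le_def split: if_splits)

lemma deg_le_monom: "size S \<le> d \<Longrightarrow> deg_le (monom_pm S) d"
  by (simp add: deg_le_def)

lemma deg_le_mono: "deg_le v d \<Longrightarrow> d \<le> e \<Longrightarrow> deg_le v e"
  by (auto simp: deg_le_def)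

text \<open>The degree bound makes the size guard in \<open>gact\<close> true throughout, and the
  first summand is \<open>gact j\<close> of the leading monomial of \<open>gact i T\<close>. What
  results is the rule that moves generator \<open>i\<close> past \<open>j\<close>, with their
  bracket as correction.\<close>

lemma gact_unfold:
  assumes low: "deg_le (gact i T - monom_pm (add_mset i T)) (size T)"
    and j: "\<forall>x\<in>#T. j \<le> x" "j < i"
  shows "gact i (add_mset j T) = op j (gact i T) + (\<Sum>k<n. const_pm (c i j k) * gact k T)"
proof -
  let ?S = "add_mset j T" and ?w = "gact i T - monom_pm (add_mset i T)"
  have Min: "Min_mset ?S = j" using j by (intro Min_eqI) auto
  have "gact i ?S = monom_pm (add_mset i ?S) +
      (\<Sum>U\<in>Poly_Mapping.keys ?w. if size U < size ?S
        then const_pm (Poly_Mapping.lookup ?w U) * gact j U else 0) +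
      (\<Sum>k<n. const_pm (c i j k) * gact k T)"
    using j(2) by (subst gact.simps) (simp add: Min[simplified] Let_def not_le cong: if_cong)
  also have "(\<Sum>U\<in>Poly_Mapping.keys ?w. if size U < size ?S
        then const_pm (Poly_Mapping.lookup ?w U) * gact j U else 0) = op j ?w"
    unfolding lin_ext_def using low by (intro sum.cong) (auto simp: deg_le_def less_Suc_eq_le)
  also have "op j ?w = op j (gact i T) - gact j (add_mset i T)"
    by (simp add: lin_ext_diff lin_ext_single)
  also have "gact j (add_mset i T) = monom_pm (add_mset i ?S)"
    using j by (subst gact_le) (auto simp: add_mset_commute)
  finally show ?thesis by simp
qed

text \<open>Up to lower degree a generator multiplies by its own variable: the corrections arise
  from generators acting on monomials smaller than \<open>S\<close>. This bound is what discharges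
  the guard in the recursion.\<close>

lemma gact_lower: "deg_le (gact i S - monom_pm (add_mset i S)) (size S)"
proof (induction "size S" arbitrary: i S rule: less_induct)
  case less
  have deg: "deg_le (gact k U) (size S)" if "size U < size S" for k U
  proof -
    have "deg_le (gact k U - monom_pm (add_mset k U)) (size S)"
      using less(1)[OF that] that by (meson deg_le_mono less_imp_le)
    moreover have "deg_le (monom_pm (add_mset k U)) (size S)"
      using that by (intro deg_le_monom) simp
    ultimately show ?thesis using deg_le_add by fastforce
  qed
  show ?case
  proof (cases "\<forall>j\<in>#S. i \<le> j")
    case True
    then show ?thesis by (simp add: gact_le)
  next
    case False
    define j where "j = Min_mset S"
    define T where "T = S - {#j#}"
    have jS: "j \<in># S" unfolding j_def using False by (intro Min_in) auto
    then have S: "S = add_mset j T" by (simp add: T_def)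
    have "\<forall>x\<in>#S. j \<le> x" by (simp add: j_def)
    then have j: "\<forall>x\<in>#T. j \<le> x" "j < i" using False by (auto simp: S)
    let ?w = "gact i T - monom_pm (add_mset i T)"
    have low: "deg_le ?w (size T)" by (rule less(1)) (simp add: S)
    have "op j (gact i T) = op j ?w + monom_pm (add_mset i S)"
      using j by (simp add: lin_ext_diff lin_ext_single S gact_le add_mset_commute)
    then have "gact i S - monom_pm (add_mset i S) = op j ?w + (\<Sum>k<n. const_pm (c i j k) * gact k T)"
      using gact_unfold[OF low j] by (simp add: S)
    moreover have "deg_le (op j ?w) (size S)"
      unfolding lin_ext_def using low
      by (intro deg_le_sum deg_le_const deg) (auto simp: S deg_le_def less_Suc_eq_le)
    moreover have "deg_le (\<Sum>k<n. const_pm (c i j k) * gact k T) (size S)"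
      by (intro deg_le_sum deg_le_const deg) (simp add: S)
    ultimately show ?thesis by (simp add: deg_le_add)
  qed
qed

section \<open>The commutation relations of the generators\<close>

definition br :: "nat \<Rightarrow> nat \<Rightarrow> (nat multiset \<Rightarrow>\<^sub>0 'a) \<Rightarrow> nat multiset \<Rightarrow>\<^sub>0 'a" where
  "br i j v = (\<Sum>k<n. const_pm (c i j k) * op k v)"

text \<open>The defect of the representation property for two generators, to be shown to
  vanish.\<close>

definition comm :: "nat \<Rightarrow> nat \<Rightarrow> (nat multiset \<Rightarrow>\<^sub>0 'a) \<Rightarrow> nat multiset \<Rightarrow>\<^sub>0 'a" where
  "comm i j v = op i (op j v) - op j (op i v) - br i j v"

lemma br_swap: "br i j v = - br j i v"
  by (subst (1) br_def) (simp add: c_swap[of i j] br_def single_uminus sum_negf)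

lemma comm_swap: "comm i j v = - comm j i v"
  by (simp add: comm_def br_swap[of i j])

lemma comm_self: "comm i i v = 0"
  by (simp add: comm_def br_def c_self)

lemma br_add: "br i j (v + w) = br i j v + br i j w"
  by (simp add: br_def lin_ext_add distrib_left sum.distrib)

lemma comm_add: "comm i j (v + w) = comm i j v + comm i j w"
  by (simp add: comm_def lin_ext_add br_add)

lemma comm_single: "comm i j (Poly_Mapping.single S a) = const_pm a * comm i j (monom_pm S)"
proof -
  have S: "Poly_Mapping.single S a = const_pm a * monom_pm S" by (simp add: mult_single)
  have "br i j (const_pm a * v) = const_pm a * br i j v" for v
    by (simp add: br_def lin_ext_const sum_distrib_left mult.left_commute)
  then show ?thesis
    unfolding S comm_def by (simp add: lin_ext_const right_diff_distrib)
qed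

lemma comm_zeroI: "(\<And>S. S \<in> Poly_Mapping.keys v \<Longrightarrow> comm i j (monom_pm S) = 0) \<Longrightarrow> comm i j v = 0"
proof -
  assume 0: "\<And>S. S \<in> Poly_Mapping.keys v \<Longrightarrow> comm i j (monom_pm S) = 0"
  have z: "comm i j 0 = 0" using comm_add[of i j 0 0] by simp
  have sum: "comm i j (sum f I) = (\<Sum>x\<in>I. comm i j (f x))" for f :: "nat multiset \<Rightarrow> _" and I
    by (induction I rule: infinite_finite_induct) (simp_all add: comm_add z)
  have v: "v = (\<Sum>S\<in>Poly_Mapping.keys v. Poly_Mapping.single S (Poly_Mapping.lookup v S))"
    by (rule poly_mapping_eqI)
      (auto simp: lookup_sum lookup_single when_def in_keys_iff sum.delta)
  have "comm i j v = (\<Sum>S\<in>Poly_Mapping.keys v. comm i j (Poly_Mapping.single S (Poly_Mapping.lookup v S)))"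
    by (subst (1) v) (rule sum)
  also have "\<dots> = 0"
    by (rule sum.neutral) (intro ballI, subst comm_single, simp add: 0)
  finally show ?thesis .
qed

text \<open>As \<open>j\<close> is minimal, \<open>op j\<close> merely prepends it, and the
  recursion for \<open>gact i\<close> is the desired relation.\<close>

lemma comm_min:
  assumes "\<forall>x\<in>#T. j \<le> x" "j < i"
  shows "comm i j (monom_pm T) = 0"
  using assms gact_unfold[OF gact_lower assms]
  by (simp add: comm_def br_def lin_ext_single gact_le)

text \<open>The inner sum is the coefficient of generator \<open>m\<close> in the double bracket of
  \<open>k\<close> with the bracket of \<open>i\<close> and \<open>j\<close>. This is the shape in
  which the Jacobi identity enters \<open>comm_monom\<close>.\<close>

lemma op_br: 
  assumes "\<And>l. comm k l u = 0"
  shows "op k (br i j u) - br i j (op k u) =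
    (\<Sum>m<n. const_pm (\<Sum>l<n. c i j l * c k l m) * op m u)"
proof -
  have "op k (op l u) - op l (op k u) = br k l u" for l
    using assms[of l] by (simp add: comm_def)
  then have "op k (br i j u) - br i j (op k u) = (\<Sum>l<n. const_pm (c i j l) * br k l u)"
    by (simp add: br_def lin_ext_sum lin_ext_const sum_subtractf[symmetric] right_diff_distrib[symmetric])
  also have "\<dots> = (\<Sum>l<n. \<Sum>m<n. const_pm (c i j l * c k l m) * op m u)"
    by (simp add: br_def sum_distrib_left mult_single flip: mult.assoc)
  also have "\<dots> = (\<Sum>m<n. \<Sum>l<n. const_pm (c i j l * c k l m) * op m u)"
    by (rule sum.swap)
  also have "\<dots> = (\<Sum>m<n. const_pm (\<Sum>l<n. c i j l * c k l m) * op m u)"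
    by (simp add: sum_distrib_right const_pm_sum)
  finally show ?thesis .
qed

text \<open>Beyond \<open>comm_min\<close>, the smallest letter \<open>k\<close> of \<open>T\<close>
  lies below both indices. With \<open>T\<close> written as \<open>k\<close> acting on a shorter
  monomial \<open>u\<close>, both generators are moved past \<open>k\<close>, and the three double
  brackets that arise cancel by the Jacobi identity.\<close>

lemma comm_monom: "comm i j (monom_pm T) = 0"
proof (induction "size T" arbitrary: i j T rule: less_induct)
  case less
  have main: "comm i j (monom_pm T) = 0" if ij: "j < i" for i j
  proof (cases "\<forall>x\<in>#T. j \<le> x")
    case True
    then show ?thesis using ij by (rule comm_min)
  next
    case False
    define k where "k = Min_mset T"
    define U where "U = T - {#k#}"
    have kT: "k \<in># T" unfolding k_def using False by (intro Min_in) auto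
    then have T: "T = add_mset k U" by (simp add: U_def)
    have "\<forall>x\<in>#T. k \<le> x" by (simp add: k_def)
    then have k: "\<forall>x\<in>#U. k \<le> x" "k < j" "k < i" using False ij by (auto simp: T)
    define u :: "nat multiset \<Rightarrow>\<^sub>0 'a" where "u = monom_pm U"
    have Tu: "monom_pm T = op k u" using k(1) by (simp add: u_def lin_ext_single gact_le T)
    have comm_u: "comm p q u = 0" for p q unfolding u_def by (rule less) (simp add: T)
    \<comment> \<open>The degree of \<open>op q u\<close> reaches the size of \<open>T\<close>, so
      the induction does not cover it directly. Its leading monomial falls under
      \<open>comm_min\<close>, as \<open>k\<close> is still minimal there, and the rest has lower
      degree.\<close>
    have comm_op: "comm p k (op q u) = 0" if "k < p" "k < q" for p q
    proof -
      define w where "w = gact q U - monom_pm (add_mset q U)"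
      have "op q u = monom_pm (add_mset q U) + w" by (simp add: u_def w_def lin_ext_single)
      moreover have "comm p k (monom_pm (add_mset q U)) = 0"
        using k(1) that by (intro comm_min) auto
      moreover have "comm p k w = 0"
      proof (rule comm_zeroI)
        fix S assume "S \<in> Poly_Mapping.keys w"
        then have "size S < size T" using gact_lower[of q U] by (auto simp: w_def deg_le_def T less_Suc_eq_le)
        then show "comm p k (monom_pm S) = 0" by (rule less)
      qed
      ultimately show ?thesis by (simp add: comm_add)
    qed
    have jk: "op j (op k u) = op k (op j u) + br j k u" and ik: "op i (op k u) = op k (op i u) + br i k u"
      and ij': "op i (op j u) = op j (op i u) + br i j u"
      using comm_u[of j k] comm_u[of i k] comm_u[of i j] by (simp_all add: comm_def diff_diff_eq)
    have ikj: "op i (op k (op j u)) = op k (op i (op j u)) + br i k (op j u)"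
      and jki: "op j (op k (op i u)) = op k (op j (op i u)) + br j k (op i u)"
      using comm_op[OF k(3,2)] comm_op[OF k(2,3)] by (simp_all add: comm_def diff_diff_eq)
    have "comm i j (op k u) = (op k (br i j u) - br i j (op k u)) + (op i (br j k u) - br j k (op i u))
        - (op j (br i k u) - br i k (op j u))"
      unfolding comm_def jk ik by (simp add: lin_ext_add ikj jki ij' algebra_simps)
    also have "\<dots> = (\<Sum>m<n. const_pm (\<Sum>l<n. c i j l * c k l m) * op m u) +
        (\<Sum>m<n. const_pm (\<Sum>l<n. c j k l * c i l m) * op m u) -
        (\<Sum>m<n. const_pm (\<Sum>l<n. c i k l * c j l m) * op m u)"
      by (simp only: op_br[OF comm_u])
    \<comment> \<open>The minus sign of the third sum is absorbed by antisymmetry in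
      \<open>i\<close> and \<open>k\<close>.\<close>
    also have "\<dots> = (\<Sum>m<n. const_pm (\<Sum>l<n. c j k l * c i l m + c k i l * c j l m + c i j l * c k l m) * op m u)"
      by (simp add: c_swap[of k i] sum.distrib sum_subtractf sum_negf single_add single_diff
          single_uminus distrib_right left_diff_distrib)
    also have "\<dots> = 0" by (simp add: c_jacobi)
    finally show ?thesis by (simp add: Tu)
  qed
  show ?case
    using main[of j i] main[of i j] comm_self comm_swap[of i j]
    by (cases i j rule: linorder_cases) simp_all
qed

lemma op_commutator: "op i (op j v) - op j (op i v) = (\<Sum>k<n. const_pm (c i j k) * op k v)"
  using comm_zeroI[of v i j] comm_monom by (simp add: comm_def br_def)

lemma op_one: "op i 1 = monom_pm {#i#}"
proof -
  have "op i (monom_pm {#}) = monom_pm {#i#}" by (simp only: lin_ext_single) (simp add: gact_le)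
  then show ?thesis by simp
qed

end

text \<open>The structure constants of a basis make the polynomials an \<open>L\<close>-module, and
  \<open>actV x 1\<close> is the linear polynomial whose coefficients are the coordinates of
  \<open>x\<close>.\<close>

lemma (in lie_algebra) faithful_module:
  assumes fd: "fin_dim_space scale"
  obtains actV :: "'l \<Rightarrow> (nat multiset \<Rightarrow>\<^sub>0 'a) \<Rightarrow> nat multiset \<Rightarrow>\<^sub>0 'a"
  where "lie_module scale bracket (\<lambda>c v. const_pm c * v) actV" "\<And>x. actV x 1 = 0 \<Longrightarrow> x = 0"
proof -
  obtain B where "finite_dimensional_vector_space scale B"
    using fd by (auto simp: fin_dim_space_def)
  then interpret fd: finite_dimensional_vector_space scale B .
  define n where "n = card B"
  obtain b where b: "bij_betw b {..<n} B"
    using ex_bij_betw_nat_finite[OF fd.finite_Basis] by (auto simp: n_def atLeast0LessThan)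
  define co where "co k x = representation B x (b k)" for k x
  have in_span: "x \<in> span B" for x by (simp add: fd.span_Basis)
  have co_add: "co k (x + y) = co k x + co k y" and co_scale: "co k (scale r x) = r * co k x" for k x y r
    using representation_add[OF fd.independent_Basis in_span in_span]
      representation_scale[OF fd.independent_Basis in_span] by (simp_all add: co_def)
  have co_zero: "co k 0 = 0" for k using co_scale[of k 0 0] by simp
  have co_uminus: "co k (- x) = - co k x" for k x using co_scale[of k "-1" x] by simp
  have co_sum: "co k (sum f I) = (\<Sum>i\<in>I. co k (f i))" for k f and I :: "nat set"
    by (induction I rule: infinite_finite_induct) (simp_all add: co_add co_zero)
  have expand: "x = (\<Sum>k<n. scale (co k x) (b k))" for x
  proof -
    have "(\<Sum>k<n. scale (representation B x (b k)) (b k)) = (\<Sum>v\<in>B. scale (representation B x v) v)"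
      by (rule sum.reindex_bij_betw[OF b])
    also have "\<dots> = x"
      by (rule sum_representation_eq[OF fd.independent_Basis in_span fd.finite_Basis subset_refl])
    finally show ?thesis by (simp add: co_def)
  qed
  define b' where "b' i = (if i < n then b i else 0)" for i
  define c where "c i j k = co k (bracket (b' i) (b' j))" for i j k
  have bracket_sum_left: "bracket (sum f I) y = (\<Sum>i\<in>I. bracket (f i) y)" for f y and I :: "nat set"
    using bracket_scale_left[of 0 _ y]
    by (induction I rule: infinite_finite_induct) (simp_all add: bracket_add_left)
  have bracket_sum_right: "bracket y (sum f I) = (\<Sum>i\<in>I. bracket y (f i))" for f y and I :: "nat set"
    using bracket_scale_right[of y 0]
    by (induction I rule: infinite_finite_induct) (simp_all add: bracket_add_right)
  interpret structure_constants n c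
  proof
    show "c i i k = 0" for i k by (simp add: c_def bracket_self co_zero)
    show "c i j k = - c j i k" for i j k
      unfolding c_def by (subst bracket_swap) (rule co_uminus)
    have *: "(\<Sum>l<n. c j k l * c i l m) = co m (bracket (b' i) (bracket (b' j) (b' k)))" for i j k m
    proof -
      have "bracket (b' i) (bracket (b' j) (b' k)) = bracket (b' i) (\<Sum>l<n. scale (c j k l) (b l))"
        unfolding c_def by (subst (1) expand) simp
      also have "\<dots> = (\<Sum>l<n. scale (c j k l) (bracket (b' i) (b' l)))"
        by (simp add: bracket_sum_right bracket_scale_right b'_def)
      finally show ?thesis by (simp add: co_sum co_scale c_def)
    qed
    show "(\<Sum>l<n. c j k l * c i l m + c k i l * c j l m + c i j l * c k l m) = 0" for i j k m
      by (simp add: sum.distrib * jacobi co_zero flip: co_add)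
  qed
  define actV where "actV x v = (\<Sum>k<n. const_pm (co k x) * op k v)" for x v
  have "lie_module scale bracket (\<lambda>c v. const_pm c * v) actV"
  proof (rule lie_module.intro[OF lie_algebra_axioms], unfold_locales)
    fix x y v w r
    show "actV (x + y) v = actV x v + actV y v"
      by (simp add: actV_def co_add single_add distrib_right sum.distrib)
    show "actV x (v + w) = actV x v + actV x w"
      by (simp add: actV_def lin_ext_add distrib_left sum.distrib)
    show "actV (scale r x) v = const_pm r * actV x v"
      by (simp add: actV_def co_scale sum_distrib_left mult_single flip: mult.assoc)
    show "actV x (const_pm r * v) = const_pm r * actV x v"
      by (simp add: actV_def lin_ext_const sum_distrib_left mult.left_commute)
    have two: "actV x (actV y v) = (\<Sum>i<n. \<Sum>j<n. const_pm (co i x * co j y) * op i (op j v))" for x y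
      by (simp add: actV_def lin_ext_sum lin_ext_const sum_distrib_left mult_single flip: mult.assoc)
    have "actV x (actV y v) - actV y (actV x v) =
        (\<Sum>i<n. \<Sum>j<n. const_pm (co i x * co j y) * (op i (op j v) - op j (op i v)))"
    proof -
      have "actV y (actV x v) = (\<Sum>i<n. \<Sum>j<n. const_pm (co i x * co j y) * op j (op i v))"
        unfolding two by (subst sum.swap) (simp add: mult.commute)
      then show ?thesis by (simp add: two right_diff_distrib sum_subtractf)
    qed
    also have "\<dots> = (\<Sum>i<n. \<Sum>j<n. \<Sum>k<n. const_pm (co i x * co j y * c i j k) * op k v)"
      by (simp add: op_commutator sum_distrib_left mult_single flip: mult.assoc)
    also have "\<dots> = (\<Sum>i<n. \<Sum>k<n. \<Sum>j<n. const_pm (co i x * co j y * c i j k) * op k v)"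
      by (intro sum.cong refl sum.swap)
    also have "\<dots> = (\<Sum>k<n. \<Sum>i<n. \<Sum>j<n. const_pm (co i x * co j y * c i j k) * op k v)"
      by (rule sum.swap)
    also have "\<dots> = (\<Sum>k<n. const_pm (\<Sum>i<n. \<Sum>j<n. co i x * co j y * c i j k) * op k v)"
      by (simp add: const_pm_sum sum_distrib_right)
    also have "\<dots> = actV (bracket x y) v"
    proof -
      have "bracket x y = bracket (\<Sum>i<n. scale (co i x) (b i)) (\<Sum>j<n. scale (co j y) (b j))"
        by (rule arg_cong2[where f = bracket, OF expand expand])
      also have "\<dots> = (\<Sum>i<n. \<Sum>j<n. scale (co i x) (scale (co j y) (bracket (b' i) (b' j))))"
        by (simp only: bracket_sum_left bracket_scale_left)
          (simp add: bracket_sum_right bracket_scale_right b'_def scale_sum_right del: scale_scale)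
      finally have "co k (bracket x y) = (\<Sum>i<n. \<Sum>j<n. co i x * co j y * c i j k)" for k
        by (simp add: co_sum co_scale c_def mult.assoc)
      then show ?thesis by (simp add: actV_def)
    qed
    finally show "actV (bracket x y) v = actV x (actV y v) - actV y (actV x v)" by simp
  qed (simp_all add: distrib_left distrib_right single_add mult_single flip: mult.assoc)
  moreover have "x = 0" if "actV x 1 = 0" for x
  proof -
    have "actV x 1 = (\<Sum>k<n. Poly_Mapping.single {#k#} (co k x))"
      by (simp add: actV_def op_one mult_single)
    then have 0: "Poly_Mapping.lookup (\<Sum>k<n. Poly_Mapping.single {#k#} (co k x)) {#i#} = 0" for i
      using that by simp
    have "co i x = 0" if "i < n" for i
      using 0[of i] that by (simp add: lookup_sum lookup_single when_def sum.delta)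
    then show "x = 0" by (subst expand) simp
  qed
  ultimately show ?thesis by (rule that)
qed

text \<open>An element that becomes zero in U(L) acts as zero on every module, in particular on the
  vector \<open>1\<close> of the faithful one.\<close>

lemma (in lie_algebra) uea_incl_eq_zero:
  assumes "fin_dim_space scale" "uea_incl scale bracket x = uea_proj scale bracket 0"
  shows "x = 0"
proof -
  obtain actV :: "'l \<Rightarrow> (nat multiset \<Rightarrow>\<^sub>0 'a) \<Rightarrow> nat multiset \<Rightarrow>\<^sub>0 'a"
    where V: "lie_module scale bracket (\<lambda>c v. const_pm c * v) actV" and inj: "\<And>x. actV x 1 = 0 \<Longrightarrow> x = 0"
    by (rule faithful_module[OF assms(1)]) (rule that)
  interpret V: lie_module scale bracket "\<lambda>c v. const_pm c * v" actV by (rule V)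
  have "actV x 1 = uea_act (\<lambda>c v. const_pm c * v) actV (uea_proj scale bracket 0) 1"
    by (simp only: assms(2)[symmetric] V.uea_act_incl)
  also have "\<dots> = 0" by (simp only: V.uea_act_proj V.free_act_zero)
  finally show ?thesis by (rule inj)
qed

section \<open>p-envelopes\<close>

context p_envelope
begin

lemma incl_simps:
  "incl (x + y) = incl x + incl y" "incl (scaleL c x) = scaleE c (incl x)"
  "incl (bracketL x y) = bracketE (incl x) (incl y)"
  using incl_hom by (simp_all add: lie_hom_def Vector_Spaces.linear_iff)

lemma subspace_range: "E.subspace (range incl)"
  using incl_hom unfolding lie_hom_def
  by (metis L.subspace_UNIV Vector_Spaces.linear.axioms(3) module_hom.subspace_image)

lemma p_subalgebra_UNIV: "E.p_subalgebra S \<Longrightarrow> range incl \<subseteq> S \<Longrightarrow> x \<in> S"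
  using generated by blast

lemma subspace_multiplier: "E.subspace {y. \<forall>z\<in>Z. bracketE y z \<in> range incl}"
proof (rule E.subspaceI)
  have "bracketE 0 z = 0" for z using E.bracket_scale_left[of 0 0 z] by simp
  then show "0 \<in> {y. \<forall>z\<in>Z. bracketE y z \<in> range incl}"
    using E.subspace_0[OF subspace_range] by simp
qed (simp_all add: E.bracket_add_left E.bracket_scale_left E.subspace_add[OF subspace_range]
    E.subspace_scale[OF subspace_range])

text \<open>The normaliser of \<open>L\<close> in \<open>E\<close> is closed under
  \<open>pmap\<close>, because \<open>ad (pmap y)\<close> is the p-th power of \<open>ad y\<close>.
  As a p-subalgebra that contains \<open>L\<close>, it is all of \<open>E\<close>.\<close>

lemma bracket_range_range: "bracketE y (incl x) \<in> range incl"
proof -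
  let ?S = "{y. \<forall>z \<in> range incl. bracketE y z \<in> range incl}"
  have "E.p_subalgebra ?S"
    unfolding E.p_subalgebra_def
  proof (intro conjI ballI)
    show "E.subspace ?S"
      by (rule subspace_multiplier)
    fix y z assume yz: "y \<in> ?S" "z \<in> ?S"
    have yz': "bracketE y w \<in> range incl" "bracketE z w \<in> range incl" if "w \<in> range incl" for w
      using yz that by (simp_all only: mem_Collect_eq)
    have "bracketE (bracketE y z) w \<in> range incl" if "w \<in> range incl" for w
      unfolding E.bracket_bracket
      by (intro E.subspace_diff[OF subspace_range] yz' that)
    then show "bracketE y z \<in> ?S" by (intro CollectI ballI)
  next
    fix y assume y: "y \<in> ?S"
    have "(bracketE y ^^ k) z \<in> range incl" if "z \<in> range incl" for k z
      by (induction k) (use that y in auto)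
    then show "pmap y \<in> ?S" by (simp add: E.ad_pmap)
  qed
  moreover have "range incl \<subseteq> ?S" by (auto simp flip: incl_simps)
  ultimately have "y \<in> ?S" by (rule p_subalgebra_UNIV)
  from CollectD[OF this] show ?thesis by (rule bspec) (rule rangeI)
qed

text \<open>The elements that bracket all of \<open>E\<close> into \<open>L\<close> form a
  p-subalgebra, and it contains \<open>L\<close> because \<open>L\<close> is an ideal by
  \<open>bracket_range_range\<close>.\<close>

lemma bracket_range: "bracketE y z \<in> range incl"
proof -
  let ?S = "{y. \<forall>z. bracketE y z \<in> range incl}"
  have "E.p_subalgebra ?S"
    unfolding E.p_subalgebra_def
  proof (intro conjI ballI)
    show "E.subspace ?S"
      using subspace_multiplier[of UNIV] by simp
    fix y z assume yz: "y \<in> ?S" "z \<in> ?S"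
    have yz': "bracketE y w \<in> range incl" "bracketE z w \<in> range incl" for w
      using yz by (simp_all only: mem_Collect_eq)
    have "bracketE (bracketE y z) w \<in> range incl" for w
      unfolding E.bracket_bracket by (intro E.subspace_diff[OF subspace_range] yz')
    then show "bracketE y z \<in> ?S" by (intro CollectI allI)
  next
    fix y assume y: "y \<in> ?S"
    \<comment> \<open>At least one factor \<open>bracketE y\<close> is applied, and the outermost
      one already lands in \<open>L\<close>.\<close>
    have p: "CHAR('a) = Suc (CHAR('a) - 1)" using E.prime_char prime_gt_0_nat by force
    have "(bracketE y ^^ CHAR('a)) z \<in> range incl" for z
      by (subst p) (use y in simp)
    then show "pmap y \<in> ?S" by (simp add: E.ad_pmap)
  qed
  moreover have "range incl \<subseteq> ?S"
  proof safe
    fix x z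
    show "bracketE (incl x) z \<in> range incl"
      using E.subspace_neg[OF subspace_range bracket_range_range[of z x]]
      by (simp add: E.bracket_swap[of "incl x" z])
  qed
  ultimately have "y \<in> ?S" by (rule p_subalgebra_UNIV)
  from CollectD[OF this] show ?thesis by (rule spec)
qed

lemma adjoint_module: "lie_module scaleL bracketL scaleE (\<lambda>x. bracketE (incl x))"
  by unfold_locales
    (simp_all add: incl_simps E.bracket_add_left E.bracket_add_right E.bracket_scale_left
      E.bracket_scale_right E.bracket_bracket)

end

section \<open>The p-envelope acting on \<open>M\<close> through the universal p-envelope\<close>

locale p_envelope_module =
  p_envelope scaleL bracketL scaleE bracketE pmap incl + M: lie_module scaleL bracketL scaleM act
  for scaleL :: "'a::field \<Rightarrow> 'l::ab_group_add \<Rightarrow> 'l"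
    and bracketL :: "'l \<Rightarrow> 'l \<Rightarrow> 'l"
    and scaleE :: "'a \<Rightarrow> 'e::ab_group_add \<Rightarrow> 'e"
    and bracketE :: "'e \<Rightarrow> 'e \<Rightarrow> 'e"
    and pmap :: "'e \<Rightarrow> 'e"
    and incl :: "'l \<Rightarrow> 'e"
    and scaleM :: "'a \<Rightarrow> 'm::ab_group_add \<Rightarrow> 'm"
    and act :: "'l \<Rightarrow> 'm \<Rightarrow> 'm" +
  fixes \<phi> :: "'e \<Rightarrow> ('l, 'a) free_algebra set"
  assumes fin_dim: "fin_dim_space scaleL"
    and \<phi>_hom: "hom_universal_p_envelope scaleL bracketL scaleE bracketE \<phi>"
    and \<phi>_incl: "\<phi> \<circ> incl = uea_incl scaleL bracketL"
begin

sublocale Ad: lie_module scaleL bracketL scaleE "\<lambda>x. bracketE (incl x)"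
  by (rule adjoint_module)

abbreviation "U \<equiv> uea scaleL bracketL"
abbreviation "pr \<equiv> uea_proj scaleL bracketL"
abbreviation "\<rho> \<equiv> free_act scaleM act"
abbreviation "\<alpha> \<equiv> free_act scaleE (\<lambda>x. bracketE (incl x))"
abbreviation "actE g \<equiv> uea_act scaleM act (\<phi> g)"

lemma \<phi>_simps:
  "\<phi> (g + h) = \<phi> g \<oplus>\<^bsub>U\<^esub> \<phi> h"
  "\<phi> (scaleE c g) = uea_scale scaleL bracketL c (\<phi> g)"
  "\<phi> (bracketE g h) = uea_bracket scaleL bracketL (\<phi> g) (\<phi> h)"
  using \<phi>_hom by (simp_all add: hom_universal_p_envelope_def)

lemma \<phi>_incl': "\<phi> (incl x) = pr (free_gen x)"
  using fun_cong[OF \<phi>_incl, of x] by (simp add: uea_incl_def)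

text \<open>The induction principle for the universal p-envelope, with closure conditions on
  representatives so that calculations take place in the free algebra.\<close>

lemma universal_p_envelope_minimal:
  assumes "S \<subseteq> carrier U" "\<And>x. pr (free_gen x) \<in> S"
    "\<And>f g. pr f \<in> S \<Longrightarrow> pr g \<in> S \<Longrightarrow> pr (f + g) \<in> S"
    "\<And>c f. pr f \<in> S \<Longrightarrow> pr (free_scalar c * f) \<in> S"
    "\<And>f g. pr f \<in> S \<Longrightarrow> pr g \<in> S \<Longrightarrow> pr (f * g - g * f) \<in> S"
    "\<And>f. pr f \<in> S \<Longrightarrow> pr (f ^ CHAR('a)) \<in> S"
  shows "universal_p_envelope scaleL bracketL \<subseteq> S"
proof -
  have pr: "\<exists>f. u = pr f" if "u \<in> S" for u using assms(1) uea_carrier_proj that by blast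
  have "pr (free_scalar 0 * free_gen 0) \<in> S" using assms(2,4) by blast
  then have "\<zero>\<^bsub>U\<^esub> \<in> S" by (simp add: free_scalar_def uea_proj_zero)
  moreover have "u \<oplus>\<^bsub>U\<^esub> v \<in> S" if "u \<in> S" "v \<in> S" for u v
    using pr[OF that(1)] pr[OF that(2)] that assms(3) by (auto simp flip: uea_proj_add)
  moreover have "uea_scale scaleL bracketL c u \<in> S" if "u \<in> S" for c u
    using pr[OF that(1)] that assms(4) by (auto simp flip: uea_proj_scale)
  moreover have "uea_bracket scaleL bracketL u v \<in> S" if "u \<in> S" "v \<in> S" for u v
    using pr[OF that(1)] pr[OF that(2)] that assms(5) by (auto simp flip: uea_proj_bracket)
  moreover have "u [^]\<^bsub>U\<^esub> CHAR('a) \<in> S" if "u \<in> S" for u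
    using pr[OF that(1)] that assms(6) by (auto simp flip: uea_proj_power)
  moreover have "range (uea_incl scaleL bracketL) \<subseteq> S" using assms(2) by (auto simp: uea_incl_def)
  ultimately show ?thesis
    unfolding universal_p_envelope_def using assms(1) by (intro Inter_lower) auto
qed

lemma \<phi>_proj: "\<exists>f. \<phi> g = pr f"
proof -
  have "universal_p_envelope scaleL bracketL \<subseteq> carrier U"
    by (rule universal_p_envelope_minimal) (auto simp: uea_proj_carrier)
  then show ?thesis using \<phi>_hom uea_carrier_proj by (fastforce simp: hom_universal_p_envelope_def)
qed

lemma \<phi>_diff:
  assumes "\<phi> g = pr f" "\<phi> h = pr f'"
  shows "\<phi> (g - h) = pr (f - f')"
proof -
  have "\<phi> (g + scaleE (- 1) h) = pr (f + free_scalar (- 1) * f')"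
    by (simp only: \<phi>_simps assms uea_proj_add uea_proj_scale)
  moreover have "free_scalar (- 1) * f' = - f'"
    by (simp add: free_scalar_def single_uminus)
  ultimately show ?thesis by simp
qed

sublocale ME: lie_module scaleE bracketE scaleM actE
proof unfold_locales
  fix x y m m' c
  obtain f g where f: "\<phi> x = pr f" and g: "\<phi> y = pr g" using \<phi>_proj by metis
  show "actE (x + y) m = actE x m + actE y m"
    by (simp add: \<phi>_simps f g M.uea_act_proj M.free_act_add flip: uea_proj_add)
  show "actE x (m + m') = actE x m + actE x m'"
    by (simp add: f M.uea_act_proj M.free_act_add_right)
  show "actE (scaleE c x) m = scaleM c (actE x m)"
    by (simp add: \<phi>_simps f M.uea_act_proj M.free_act_mult M.free_act_scalar flip: uea_proj_scale)
  show "actE x (scaleM c m) = scaleM c (actE x m)"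
    by (simp add: f M.uea_act_proj M.free_act_scale_right)
  show "actE (bracketE x y) m = actE x (actE y m) - actE y (actE x m)"
    by (simp add: \<phi>_simps f g M.uea_act_proj M.free_act_diff M.free_act_mult flip: uea_proj_bracket)
qed

lemma actE_incl: "actE (incl x) = act x"
  by (rule ext) (simp add: \<phi>_incl' M.uea_act_proj M.free_act_gen)

lemma subalgebra:
  assumes "E.subspace K" "range incl \<subseteq> K"
  shows "lie_module_subalgebra scaleE bracketE scaleM actE K"
  using assms bracket_range by unfold_locales auto

abbreviation "null_on \<equiv> lie_module_subalgebra.null scaleE bracketE scaleM actE"

text \<open>The first two conditions prepare the identification in \<open>null_E\<close>: the values
  of \<open>\<alpha> f\<close> lie in \<open>L\<close>, where \<open>\<phi>\<close> is injective,
  and \<open>\<phi>\<close> turns \<open>\<alpha> f\<close> into the commutator with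
  \<open>f\<close> in U(L). The first one also makes \<open>\<alpha> f\<close> preserve every
  \<open>K\<close> above \<open>L\<close>, as the closure lemmas for \<open>null\<close>
  require.\<close>

definition acts_trivially :: "('l, 'a) free_algebra \<Rightarrow> bool" where
  "acts_trivially f \<longleftrightarrow> (\<forall>y. \<alpha> f y \<in> range incl) \<and>
    (\<forall>y h. \<phi> y = pr h \<longrightarrow> \<phi> (\<alpha> f y) = pr (f * h - h * f)) \<and>
    (\<forall>K. E.subspace K \<longrightarrow> range incl \<subseteq> K \<longrightarrow> null_on K (\<rho> f) (\<alpha> f))"

lemma acts_triviallyD:
  assumes "acts_trivially f"
  shows "\<alpha> f y \<in> range incl" "\<phi> y = pr h \<Longrightarrow> \<phi> (\<alpha> f y) = pr (f * h - h * f)"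
    "E.subspace K \<Longrightarrow> range incl \<subseteq> K \<Longrightarrow> null_on K (\<rho> f) (\<alpha> f)"
  using assms by (auto simp: acts_trivially_def)

lemma acts_trivially_gen: "acts_trivially (free_gen x)"
  unfolding acts_trivially_def
proof (intro conjI allI impI)
  fix y h assume h: "\<phi> y = pr h"
  have "\<phi> (bracketE (incl x) y) = pr (free_gen x * h - h * free_gen x)"
    by (simp add: \<phi>_simps \<phi>_incl' h uea_proj_bracket)
  then show "\<phi> (\<alpha> (free_gen x) y) = pr (free_gen x * h - h * free_gen x)"
    by (simp add: Ad.free_act_gen)
next
  fix K assume K: "E.subspace K" "range incl \<subseteq> K"
  interpret K: lie_module_subalgebra scaleE bracketE scaleM actE K by (rule subalgebra[OF K])
  have "null_on K (actE (incl x)) (bracketE (incl x))"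
    by (rule K.null_inner) (use K in blast)
  moreover have "\<rho> (free_gen x) = actE (incl x)" "\<alpha> (free_gen x) = bracketE (incl x)"
    by (auto simp: M.free_act_gen Ad.free_act_gen actE_incl)
  ultimately show "null_on K (\<rho> (free_gen x)) (\<alpha> (free_gen x))" by simp
qed (simp add: Ad.free_act_gen bracket_range)

lemma acts_trivially_add:
  assumes f: "acts_trivially f" and g: "acts_trivially g"
  shows "acts_trivially (f + g)"
  unfolding acts_trivially_def
proof (intro conjI allI impI)
  show "\<alpha> (f + g) y \<in> range incl" for y
    using acts_triviallyD(1)[OF f] acts_triviallyD(1)[OF g] E.subspace_add[OF subspace_range]
    by (simp add: Ad.free_act_add)
  fix y h assume h: "\<phi> y = pr h"
  have "\<phi> (\<alpha> (f + g) y) = pr ((f * h - h * f) + (g * h - h * g))"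
    by (simp only: Ad.free_act_add \<phi>_simps acts_triviallyD(2)[OF f h] acts_triviallyD(2)[OF g h] uea_proj_add)
  then show "\<phi> (\<alpha> (f + g) y) = pr ((f + g) * h - h * (f + g))" by (simp add: algebra_simps)
next
  fix K assume K: "E.subspace K" "range incl \<subseteq> K"
  interpret K: lie_module_subalgebra scaleE bracketE scaleM actE K by (rule subalgebra[OF K])
  have "null_on K (\<lambda>m. \<rho> f m + \<rho> g m) (\<lambda>y. \<alpha> f y + \<alpha> g y)"
    using acts_triviallyD(1)[OF f] acts_triviallyD(1)[OF g] K
    by (intro K.null_add acts_triviallyD(3)[OF f] acts_triviallyD(3)[OF g]) auto
  moreover have "\<rho> (f + g) = (\<lambda>m. \<rho> f m + \<rho> g m)" "\<alpha> (f + g) = (\<lambda>y. \<alpha> f y + \<alpha> g y)"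
    by (auto simp: M.free_act_add Ad.free_act_add)
  ultimately show "null_on K (\<rho> (f + g)) (\<alpha> (f + g))" by simp
qed

lemma acts_trivially_scale:
  assumes f: "acts_trivially f"
  shows "acts_trivially (free_scalar c * f)"
  unfolding acts_trivially_def
proof (intro conjI allI impI)
  show "\<alpha> (free_scalar c * f) y \<in> range incl" for y
    using acts_triviallyD(1)[OF f] E.subspace_scale[OF subspace_range]
    by (simp add: Ad.free_act_mult Ad.free_act_scalar)
  fix y h assume h: "\<phi> y = pr h"
  have "\<phi> (\<alpha> (free_scalar c * f) y) = pr (free_scalar c * (f * h - h * f))"
    by (simp only: Ad.free_act_mult Ad.free_act_scalar \<phi>_simps acts_triviallyD(2)[OF f h] uea_proj_scale)
  also have "free_scalar c * (f * h - h * f) = free_scalar c * f * h - h * (free_scalar c * f)"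
    by (simp only: right_diff_distrib mult.assoc free_scalar_left_commute)
  finally show "\<phi> (\<alpha> (free_scalar c * f) y) = pr (free_scalar c * f * h - h * (free_scalar c * f))" .
next
  fix K assume K: "E.subspace K" "range incl \<subseteq> K"
  interpret K: lie_module_subalgebra scaleE bracketE scaleM actE K by (rule subalgebra[OF K])
  have "null_on K (\<lambda>m. scaleM c (\<rho> f m)) (\<lambda>y. scaleE c (\<alpha> f y))"
    using acts_triviallyD(1)[OF f] K by (intro K.null_scale acts_triviallyD(3)[OF f]) auto
  moreover have "\<rho> (free_scalar c * f) = (\<lambda>m. scaleM c (\<rho> f m))"
    "\<alpha> (free_scalar c * f) = (\<lambda>y. scaleE c (\<alpha> f y))"
    by (auto simp: M.free_act_mult Ad.free_act_mult M.free_act_scalar Ad.free_act_scalar)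
  ultimately show "null_on K (\<rho> (free_scalar c * f)) (\<alpha> (free_scalar c * f))" by simp
qed

lemma acts_trivially_commutator:
  assumes f: "acts_trivially f" and g: "acts_trivially g"
  shows "acts_trivially (f * g - g * f)"
  unfolding acts_trivially_def
proof (intro conjI allI impI)
  show "\<alpha> (f * g - g * f) y \<in> range incl" for y
    using acts_triviallyD(1)[OF f] acts_triviallyD(1)[OF g] E.subspace_diff[OF subspace_range]
    by (simp add: Ad.free_act_diff Ad.free_act_mult)
  fix y h assume h: "\<phi> y = pr h"
  have "\<phi> (\<alpha> f (\<alpha> g y) - \<alpha> g (\<alpha> f y)) =
      pr ((f * (g * h - h * g) - (g * h - h * g) * f) - (g * (f * h - h * f) - (f * h - h * f) * g))"
    by (intro \<phi>_diff acts_triviallyD(2) f g h)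
  then show "\<phi> (\<alpha> (f * g - g * f) y) = pr ((f * g - g * f) * h - h * (f * g - g * f))"
    by (simp add: Ad.free_act_diff Ad.free_act_mult algebra_simps)
next
  fix K assume K: "E.subspace K" "range incl \<subseteq> K"
  interpret K: lie_module_subalgebra scaleE bracketE scaleM actE K by (rule subalgebra[OF K])
  have "null_on K (\<lambda>m. \<rho> f (\<rho> g m) - \<rho> g (\<rho> f m)) (\<lambda>y. \<alpha> f (\<alpha> g y) - \<alpha> g (\<alpha> f y))"
    using acts_triviallyD(1)[OF f] acts_triviallyD(1)[OF g] K
    by (intro K.null_commutator M.linear_free_act acts_triviallyD(3)[OF f] acts_triviallyD(3)[OF g]) auto
  moreover have "\<rho> (f * g - g * f) = (\<lambda>m. \<rho> f (\<rho> g m) - \<rho> g (\<rho> f m))"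
    "\<alpha> (f * g - g * f) = (\<lambda>y. \<alpha> f (\<alpha> g y) - \<alpha> g (\<alpha> f y))"
    by (auto simp: M.free_act_diff Ad.free_act_diff M.free_act_mult Ad.free_act_mult)
  ultimately show "null_on K (\<rho> (f * g - g * f)) (\<alpha> (f * g - g * f))" by simp
qed

lemma acts_trivially_power:
  assumes f: "acts_trivially f"
  shows "acts_trivially (f ^ CHAR('a))"
  unfolding acts_trivially_def
proof (intro conjI allI impI)
  let ?p = "CHAR('a)"
  obtain q where q: "?p = Suc q" using E.prime_char not0_implies_Suc by (metis not_prime_0)
  show "\<alpha> (f ^ ?p) y \<in> range incl" for y
    unfolding Ad.free_act_power using acts_triviallyD(1)[OF f] by (simp add: q)
  fix y h assume h: "\<phi> y = pr h"
  have "\<phi> ((\<alpha> f ^^ n) y) = pr (((\<lambda>h. f * h - h * f) ^^ n) h)" for n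
    by (induction n) (simp_all add: h acts_triviallyD(2)[OF f])
  then show "\<phi> (\<alpha> (f ^ ?p) y) = pr (f ^ ?p * h - h * f ^ ?p)"
    by (simp add: Ad.free_act_power free_algebra_ad_power[OF E.prime_char])
next
  let ?p = "CHAR('a)"
  fix K assume K: "E.subspace K" "range incl \<subseteq> K"
  interpret K: lie_module_subalgebra scaleE bracketE scaleM actE K by (rule subalgebra[OF K])
  have "null_on K (\<rho> f ^^ ?p) (\<alpha> f ^^ ?p)"
    using acts_triviallyD(1)[OF f] K
    by (intro K.null_power M.linear_free_act E.prime_char acts_triviallyD(3)[OF f]) auto
  moreover have "\<rho> (f ^ ?p) = \<rho> f ^^ ?p" "\<alpha> (f ^ ?p) = \<alpha> f ^^ ?p"
    by (auto simp: M.free_act_power Ad.free_act_power)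
  ultimately show "null_on K (\<rho> (f ^ ?p)) (\<alpha> (f ^ ?p))" by simp
qed

text \<open>The property is defined on representatives, while the universal p-envelope consists of
  cosets. Elements of the ideal act as zero on both modules.\<close>

lemma acts_trivially_cong:
  assumes f: "acts_trivially f" and fg: "pr f = pr g"
  shows "acts_trivially g"
proof -
  have "f - g \<in> uea_ideal scaleL bracketL"
    using fg uea_proj_mem[of f scaleL bracketL f] uea_proj_mem[of f scaleL bracketL g] uea_ideal_zero by simp
  then have eq: "\<rho> g = \<rho> f" "\<alpha> g = \<alpha> f"
    using M.free_act_ideal[of "f - g"] Ad.free_act_ideal[of "f - g"]
    by (auto simp: M.free_act_diff Ad.free_act_diff fun_eq_iff)
  have "pr (g * h - h * g) = pr (f * h - h * f)" for h
    by (simp only: uea_proj_bracket fg)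
  then show ?thesis using f by (simp add: acts_trivially_def eq)
qed

lemma null_E:
  assumes K: "E.subspace K" "range incl \<subseteq> K"
  shows "null_on K (actE g) (bracketE g)"
proof -
  let ?S = "{pr f |f. acts_trivially f}"
  have S: "acts_trivially f" if "pr f \<in> ?S" for f
    using that acts_trivially_cong by auto
  have "universal_p_envelope scaleL bracketL \<subseteq> ?S"
  proof (rule universal_p_envelope_minimal)
    show "?S \<subseteq> carrier U" by (auto simp: uea_proj_carrier)
    show "pr (free_gen x) \<in> ?S" for x using acts_trivially_gen by blast
    show "pr (f + g) \<in> ?S" if "pr f \<in> ?S" "pr g \<in> ?S" for f g
      using acts_trivially_add[OF S[OF that(1)] S[OF that(2)]] by blast
    show "pr (free_scalar c * f) \<in> ?S" if "pr f \<in> ?S" for c f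
      using acts_trivially_scale[OF S[OF that]] by blast
    show "pr (f * g - g * f) \<in> ?S" if "pr f \<in> ?S" "pr g \<in> ?S" for f g
      using acts_trivially_commutator[OF S[OF that(1)] S[OF that(2)]] by blast
    show "pr (f ^ CHAR('a)) \<in> ?S" if "pr f \<in> ?S" for f
      using acts_trivially_power[OF S[OF that]] by blast
  qed
  moreover have "\<phi> g \<in> universal_p_envelope scaleL bracketL"
    using \<phi>_hom by (simp add: hom_universal_p_envelope_def)
  ultimately obtain f where f: "\<phi> g = pr f" "acts_trivially f" by blast
  \<comment> \<open>The difference lies in \<open>L\<close>, because both sides do, and
    \<open>\<phi>\<close> maps it to zero. On \<open>L\<close> the map \<open>\<phi>\<close> is the
    injective map into U(L).\<close>
  have "\<alpha> f y = bracketE g y" for y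
  proof -
    obtain h where h: "\<phi> y = pr h" using \<phi>_proj by blast
    have "\<phi> (bracketE g y) = pr (f * h - h * f)" by (simp add: \<phi>_simps f(1) h uea_proj_bracket)
    then have *: "\<phi> (\<alpha> f y - bracketE g y) = pr 0"
      using \<phi>_diff[OF acts_triviallyD(2)[OF f(2) h]] by fastforce
    have "\<alpha> f y - bracketE g y \<in> range incl"
      using E.subspace_diff[OF subspace_range acts_triviallyD(1)[OF f(2)] bracket_range] .
    then obtain x where x: "\<alpha> f y - bracketE g y = incl x" by blast
    then have "uea_incl scaleL bracketL x = pr 0" using * by (simp add: \<phi>_incl' uea_incl_def)
    then have "x = 0" by (rule L.uea_incl_eq_zero[OF fin_dim])
    then show ?thesis using x incl_simps(1)[of 0 0] by simp
  qed
  then have "bracketE g = \<alpha> f" by auto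
  moreover have "actE g = \<rho> f" by (rule ext) (simp add: f(1) M.uea_act_proj)
  ultimately show ?thesis using acts_triviallyD(3)[OF f(2) K] by simp
qed

end

section \<open>Comparison with the Chevalley-Eilenberg complex\<close>

lemma omit_nth_simps [simp]:
  "omit_nth 0 (x # xs) = xs" "omit_nth (Suc i) (x # xs) = x # omit_nth i xs"
  by (simp_all add: omit_nth_def)

context lie_module
begin

interpretation A: lie_module_subalgebra scaleL bracket scaleM act UNIV
  by unfold_locales auto

lemma cochain_add_at:
  "f \<in> C UNIV n \<Longrightarrow> f (xs @ (x + y) # ys) = f (xs @ x # ys) + f (xs @ y # ys)"
proof (induction xs arbitrary: f n)
  case Nil
  show ?case using cochain_linear(1)[OF Nil, of x y] by (simp add: fun_eq_iff)
next
  case (Cons z xs)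
  have "ins z f (xs @ (x + y) # ys) = ins z f (xs @ x # ys) + ins z f (xs @ y # ys)"
    by (rule Cons.IH[OF ins_cochain[OF Cons.prems]])
  then show ?case by simp
qed

lemma cochain_scale_at:
  "f \<in> C UNIV n \<Longrightarrow> f (xs @ scaleL c x # ys) = scaleM c (f (xs @ x # ys))"
proof (induction xs arbitrary: f n)
  case Nil
  show ?case using cochain_linear(2)[OF Nil, of x c] by (simp add: fun_eq_iff)
next
  case (Cons z xs)
  have "ins z f (xs @ scaleL c x # ys) = scaleM c (ins z f (xs @ x # ys))"
    by (rule Cons.IH[OF ins_cochain[OF Cons.prems]])
  then show ?case by simp
qed

text \<open>If the tail has a repetition, a contraction handles it. Otherwise the first entry
  recurs; swapping it with its neighbour moves the repetition into the tail, unless these two are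
  equal and alternation applies.\<close>

lemma cochain_not_distinct: "f \<in> C UNIV n \<Longrightarrow> \<not> distinct xs \<Longrightarrow> f xs = 0"
proof (induction "length xs" arbitrary: f n xs rule: less_induct)
  case (less xs f n)
  obtain z zs where xs: "xs = z # zs" using less.prems(2) by (cases xs) auto
  show ?case
  proof (cases "distinct zs")
    case False
    have "ins z f zs = 0" by (rule less.hyps[OF _ ins_cochain[OF less.prems(1)] False]) (simp add: xs)
    then show ?thesis by (simp add: xs)
  next
    case True
    then have "z \<in> set zs" using less.prems(2) by (simp add: xs)
    then obtain w ws where zs: "zs = w # ws" by (cases zs) auto
    show ?thesis
    proof (cases "w = z")
      case True
      then show ?thesis using cochain_ins_ins[OF less.prems(1), of z] by (simp add: xs zs fun_eq_iff)
    next
      case False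
      then have "\<not> distinct (z # ws)" using \<open>z \<in> set zs\<close> by (simp add: zs)
      then have "ins w f (z # ws) = 0"
        by (intro less.hyps[OF _ ins_cochain[OF less.prems(1)]]) (simp_all add: xs zs)
      then show ?thesis using A.swap[OF less.prems(1), of z w ws] by (simp add: xs zs)
    qed
  qed
qed

lemma cochains_eq: "cochains scaleL scaleM (int n) = C UNIV (Suc n)"
proof (intro equalityI subsetI)
  fix f assume "f \<in> cochains scaleL scaleM (int n)"
  then show "f \<in> C UNIV (Suc n)"
  proof (induction n arbitrary: f)
    case 0
    then have "f xs = 0" if "xs \<noteq> []" for xs using that by (simp add: cochains_def)
    then have "ins x f = 0" for x by (simp add: fun_eq_iff)
    then show ?case by (simp add: fun_eq_iff)
  next
    case (Suc n)
    have len: "f xs = 0" if "int (length xs) \<noteq> int (Suc n)" for xs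
      using Suc.prems that unfolding cochains_def by blast
    have add: "f (xs @ (x + y) # ys) = f (xs @ x # ys) + f (xs @ y # ys)" for xs x y ys
      using Suc.prems unfolding cochains_def by blast
    have scale: "f (xs @ scaleL c x # ys) = scaleM c (f (xs @ x # ys))" for xs c x ys
      using Suc.prems unfolding cochains_def by blast
    have dist: "f xs = 0" if "\<not> distinct xs" for xs
      using Suc.prems that unfolding cochains_def by blast
    have "ins x f \<in> cochains scaleL scaleM (int n)" for x
      using len[of "x # _"] add[of "x # _"] scale[of "x # _"] dist[of "x # _"]
      by (simp add: cochains_def)
    then have "ins x f \<in> C UNIV (Suc n)" for x by (rule Suc.IH)
    moreover have "ins (x + y) f = ins x f + ins y f" for x y
      using add[of "[]"] by (simp add: fun_eq_iff)
    moreover have "ins (scaleL c x) f = scaleF c (ins x f)" for c x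
      using scale[of "[]"] by (simp add: fun_eq_iff)
    moreover have "ins x (ins x f) = 0" for x
      using dist[of "x # x # _"] by (simp add: fun_eq_iff)
    moreover have "f [] = 0" by (rule len) simp
    ultimately show ?case
      unfolding cochains_on.simps(2)[of _ _ _ "Suc n"] by (simp del: cochains_on.simps)
  qed
next
  fix f assume f: "f \<in> C UNIV (Suc n)"
  show "f \<in> cochains scaleL scaleM (int n)"
    unfolding cochains_def
    using cochain_support(2)[OF f] cochain_add_at[OF f] cochain_scale_at[OF f]
      cochain_not_distinct[OF f] by auto
qed

lemma cochains_negative: "n < 0 \<Longrightarrow> cochains scaleL scaleM n = {0}"
  by (auto simp: cochains_def fun_eq_iff)

text \<open>Moving entry \<open>j\<close> to the front costs the sign \<open>(- 1) ^ j\<close>,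
  which gives the shape of the bracket terms in \<open>coboundary\<close>.\<close>

lemma lie_der_explicit:
  "f \<in> C UNIV n \<Longrightarrow> lie_der A D f xs =
    A (f xs) - (\<Sum>j<length xs. scaleM ((- 1) ^ j) (f (D (xs ! j) # omit_nth j xs)))"
proof (induction xs arbitrary: f n)
  case (Cons x xs)
  have "lie_der A D (ins x f) xs =
      A (ins x f xs) - (\<Sum>j<length xs. scaleM ((- 1) ^ j) (ins x f (D (xs ! j) # omit_nth j xs)))"
    by (rule Cons.IH[OF ins_cochain[OF Cons.prems]])
  moreover have "f (x # y # ys) = - f (y # x # ys)" for y ys
    by (rule A.swap[OF Cons.prems])
  ultimately show ?case
    by (simp add: sum.lessThan_Suc_shift sum_negf del: sum.lessThan_Suc)
qed simp

text \<open>Split off the first argument \<open>x\<close>: the terms in which \<open>x\<close> acts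
  or is bracketed form the Lie derivative, and the others form minus the coboundary of
  \<open>ins x f\<close>. So the alternating sum satisfies Cartan's recursion.\<close>

lemma coboundary_eq: "f \<in> C UNIV n \<Longrightarrow> coboundary bracket scaleM act f = d f"
proof
  show "f \<in> C UNIV n \<Longrightarrow> coboundary bracket scaleM act f xs = d f xs" for xs
  proof (induction xs arbitrary: f n)
    case (Cons x xs)
    note f = Cons.prems
    have swap: "f (z # x # ys) = - f (x # z # ys)" for z ys
      by (rule A.swap[OF f])
    have IH: "coboundary bracket scaleM act (ins x f) xs = d (ins x f) xs"
      by (rule Cons.IH[OF ins_cochain[OF f]])
    have "coboundary bracket scaleM act f (x # xs) =
        lie_der (act x) (bracket x) f xs - coboundary bracket scaleM act (ins x f) xs"
      unfolding lie_der_explicit[OF f] coboundary_def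
      by (simp add: sum.lessThan_Suc_shift sum_negf swap sum.distrib sum_subtractf
          del: sum.lessThan_Suc)
    then show ?case by (simp add: IH)
  qed (simp add: coboundary_def)
qed

text \<open>The dimension of the coboundaries is eliminated by rank-nullity for \<open>d\<close>. On
  the right and in \<open>C UNIV n\<close>, an index is one more than the degree. The additive form
  avoids subtraction of natural numbers.\<close>

lemma cohomology_dim_eq:
  assumes fs: "\<And>n. finitely_spanned scaleF (C UNIV n)"
  shows "cohomology_dim scaleL bracket scaleM act (int n) + F.dim (C UNIV n) =
    F.dim (cocycles_on UNIV (Suc n)) + F.dim (cocycles_on UNIV n)"
proof -
  have r: "restr UNIV f = f" for f :: "'l list \<Rightarrow> 'm" by (simp add: restr_def)
  have Z: "cocycles scaleL bracket scaleM act (int n) = cocycles_on UNIV (Suc n)"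
    unfolding cocycles_def cocycles_on_def cochains_eq r
    by (auto simp: coboundary_eq simp del: cochains_on.simps)
  have B: "coboundaries scaleL bracket scaleM act (int n) = d ` C UNIV n"
  proof (cases n)
    case 0
    have "coboundary bracket scaleM act 0 = d 0" by (rule coboundary_eq[of 0 0]) simp
    moreover have "cochains scaleL scaleM (int n - 1) = C UNIV n" using 0 by (simp add: cochains_negative)
    ultimately show ?thesis unfolding coboundaries_def by (simp add: 0)
  next
    case (Suc m)
    then have "cochains scaleL scaleM (int n - 1) = C UNIV n" using cochains_eq[of m] by simp
    then show ?thesis unfolding coboundaries_def using coboundary_eq by simp
  qed
  have fsZ: "finitely_spanned scaleF (cocycles_on UNIV (Suc n))"
    by (rule F.finitely_spanned_subset[OF fs cocycles_on_subset])
  have "d b \<in> cocycles_on UNIV (Suc n)" if "b \<in> C UNIV n" for b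
    using A.coboundary_cocycle[of b "Suc n"] that by (simp only: r diff_Suc_1)
  then have BZ: "d ` C UNIV n \<subseteq> cocycles_on UNIV (Suc n)" by blast
  interpret d: Vector_Spaces.linear scaleF scaleF d by (rule linear_diff)
  have Bs: "F.subspace (d ` C UNIV n)" by (rule d.subspace_image[OF cochains_subspace])
  have sc: "scaleF = (\<lambda>c f xs. scaleM c (f xs))" by (simp add: fun_eq_iff)
  have "F.dim (cocycles_on UNIV (Suc n)) =
      cohomology_dim scaleL bracket scaleM act (int n) + F.dim (d ` C UNIV n)"
    unfolding cohomology_dim_def cohomology_def Z B sc[symmetric]
    by (rule quotient_space_dim(2)[OF F.vector_space_axioms cocycles_on_subspace Bs BZ
          F.finitely_spanned_subset[OF fsZ BZ] fsZ])
  moreover have "F.dim (C UNIV n) = F.dim (cocycles_on UNIV n) + F.dim (d ` C UNIV n)"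
    using rank_nullity(2)[OF linear_diff cochains_subspace fs] by (simp only: cocycles_on_def r)
  ultimately show ?thesis by simp
qed

lemma cohomology_dim_negative:
  assumes "n < 0"
  shows "cohomology_dim scaleL bracket scaleM act n = 0"
proof -
  have 0: "coboundary bracket scaleM act 0 = 0"
    using coboundary_eq[of 0 0] A.diff_zero by (simp only: zero_cochain)
  have Z: "cocycles scaleL bracket scaleM act n = {0}"
    unfolding cocycles_def cochains_negative[OF assms] using 0 by blast
  have B: "coboundaries scaleL bracket scaleM act n = {0}"
    unfolding coboundaries_def using assms 0 by (simp add: cochains_negative)
  have sc: "scaleF = (\<lambda>c f xs. scaleM c (f xs))" by (simp add: fun_eq_iff)
  have fs0: "finitely_spanned scaleF {0}"
    by (rule F.finitely_spannedI[of "{}"]) auto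
  show ?thesis
    using quotient_space_dim(2)[OF F.vector_space_axioms F.subspace_single_0 F.subspace_single_0 subset_refl fs0 fs0]
    unfolding cohomology_dim_def cohomology_def Z B sc[symmetric] by simp
qed

text \<open>Contractions of a cochain on the zero space vanish, so evaluation at \<open>[]\<close>
  embeds these cochains into \<open>M\<close>.\<close>

lemma cochains_0_finitely_spanned:
  assumes "fin_dim_space scaleM"
  shows "finitely_spanned scaleF (C {0} n)"
proof -
  obtain B where "finite_dimensional_vector_space scaleM B"
    using assms by (auto simp: fin_dim_space_def)
  then interpret fd: finite_dimensional_vector_space scaleM B .
  have lin: "Vector_Spaces.linear scaleF scaleM (\<lambda>f. f [])"
    by (simp add: Vector_Spaces.linear_iff F.vector_space_axioms M.vector_space_axioms)
  interpret Z: lie_module_subspace scaleL bracket scaleM act "{0}"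
    by unfold_locales (rule L.subspace_single_0)
  have inj: "inj_on (\<lambda>f. f []) (C {0} n)"
  proof (rule inj_onI)
    fix f g assume fg: "f \<in> C {0} n" "g \<in> C {0} n" "f [] = g []"
    have ins: "ins x h = 0" if h: "h \<in> C {0} n" for x h
    proof (cases "x = 0")
      case True
      show ?thesis unfolding True using cochain_linear(2)[OF h, of 0 0] by simp
    next
      case False
      then show ?thesis using cochain_ins_outside[OF h] by simp
    qed
    have "f xs = g xs" for xs
    proof (cases xs)
      case (Cons x ys)
      show ?thesis using ins[OF fg(1), of x] ins[OF fg(2), of x] by (simp add: Cons fun_eq_iff)
    qed (simp add: fg(3))
    then show "f = g" by blast
  qed
  have "finitely_spanned scaleM ((\<lambda>f. f []) ` C {0} n)"
    by (rule M.finitely_spannedI[OF fd.finite_Basis]) (simp add: fd.span_Basis)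
  then show ?thesis using linear_bij_dim(1)[OF lin cochains_subspace inj] by simp
qed

text \<open>Basis vectors are adjoined one at a time. The splitting of cochains does not involve the
  bracket, so it applies to the span of any part of the basis.\<close>

lemma cochains_finitely_spanned:
  assumes "fin_dim_space scaleL" "fin_dim_space scaleM"
  shows "finitely_spanned scaleF (C UNIV n)"
proof -
  obtain B where "finite_dimensional_vector_space scaleL B"
    using assms(1) by (auto simp: fin_dim_space_def)
  then interpret fd: finite_dimensional_vector_space scaleL B .
  have "\<forall>n. finitely_spanned scaleF (C (L.span T) n)" if "finite T" "L.independent T" for T
    using that
  proof (induction T rule: finite_induct)
    case empty
    show ?case using cochains_0_finitely_spanned[OF assms(2)] by (simp only: L.span_empty) simp
  next
    case (insert t T)
    then have T: "L.independent T" "t \<notin> L.span T"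
      using L.independent_insert by auto
    have span: "L.span (insert t T) = L.span (insert t (L.span T))"
      by (simp only: L.span_insert L.span_span)
    interpret S: adjoin_element scaleL bracket scaleM act "L.span T" t "L.span (insert t T)"
      by unfold_locales (use T span in auto)
    have "finitely_spanned scaleF (C (L.span (insert t T)) n)" for n
    proof (cases n)
      case 0
      show ?thesis unfolding 0 using insert.IH[OF T(1)] by (metis cochains_on.simps(1))
    next
      case (Suc m)
      show ?thesis unfolding Suc
        by (rule S.cochains_step(1)) (use insert.IH[OF T(1)] in blast)+
    qed
    then show ?case by blast
  qed
  from this[OF fd.finite_Basis fd.independent_Basis] show ?thesis by (simp add: fd.span_Basis)
qed

end

section \<open>Binomial transforms\<close>

text \<open>The effect of \<open>k\<close> successive steps from \<open>h n\<close> to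
  \<open>h n + h (n - 1)\<close>; on generating functions it is multiplication by the
  \<open>k\<close>-th power of \<open>1 + X\<close>.\<close>

definition binomial_transform :: "nat \<Rightarrow> (int \<Rightarrow> int) \<Rightarrow> int \<Rightarrow> int" where
  "binomial_transform k h n = (\<Sum>j = 0..k. int (k choose j) * h (n - int j))"

lemma binomial_transform_0 [simp]: "binomial_transform 0 h n = h n"
  by (simp add: binomial_transform_def)

lemma binomial_transform_Suc:
  "binomial_transform (Suc k) h n = binomial_transform k h n + binomial_transform k h (n - 1)"
proof -
  let ?t = "\<lambda>j. h (n - int j)"
  have "binomial_transform (Suc k) h n = h n + (\<Sum>j\<le>k. int (Suc k choose Suc j) * ?t (Suc j))"
    unfolding binomial_transform_def atLeast0AtMost by (subst sum.atMost_Suc_shift) simp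
  also have "\<dots> = (h n + (\<Sum>j\<le>k. int (k choose Suc j) * ?t (Suc j))) + (\<Sum>j\<le>k. int (k choose j) * ?t (Suc j))"
    by (simp add: sum.distrib distrib_right)
  also have "h n + (\<Sum>j\<le>k. int (k choose Suc j) * ?t (Suc j)) = (\<Sum>j\<le>Suc k. int (k choose j) * ?t j)"
    by (subst sum.atMost_Suc_shift) simp
  also have "\<dots> = binomial_transform k h n"
    by (simp add: binomial_transform_def atLeast0AtMost binomial_eq_0)
  also have "(\<Sum>j\<le>k. int (k choose j) * ?t (Suc j)) = binomial_transform k h (n - 1)"
    by (simp add: binomial_transform_def atLeast0AtMost algebra_simps)
  finally show ?thesis .
qed

lemma binomial_transform_negative:
  assumes "\<And>n. n < 0 \<Longrightarrow> h n = 0" "n < 0"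
  shows "binomial_transform k h n = 0"
  unfolding binomial_transform_def using assms by (intro sum.neutral) simp

text \<open>Pascal's rule; for \<open>k = 0\<close> it holds thanks to the convention for the lower
  index \<open>-1\<close>.\<close>

lemma shifted_binomial_Suc:
  "shifted_binomial (Suc \<nu>) (Suc k) = shifted_binomial (Suc \<nu>) k + shifted_binomial \<nu> (Suc k)"
  by (cases k) (simp_all add: shifted_binomial_def)

lemma shifted_binomial_0 [simp]: "shifted_binomial 0 k = 1"
  by (cases k) (simp_all add: shifted_binomial_def)

text \<open>The signed coefficients are those of the power series of \<open>1 + X\<close> to the
  power \<open>- k\<close>. Passing from \<open>r\<close> to \<open>s\<close> is one more division
  by \<open>1 + X\<close>, which is the content of \<open>sr\<close>.\<close>

lemma binomial_transform_inverse:
  assumes "\<And>n. n < 0 \<Longrightarrow> h n = 0"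
  shows "h (int n) =
    (\<Sum>\<nu> = 0..n. (- 1) ^ \<nu> * int (shifted_binomial \<nu> k) * binomial_transform k h (int n - int \<nu>))"
proof (induction k)
  case 0
  have "(\<Sum>\<nu> = 0..n. (- 1) ^ \<nu> * int (shifted_binomial \<nu> 0) * binomial_transform 0 h (int n - int \<nu>)) =
      (\<Sum>\<nu> = 0..n. if \<nu> = 0 then h (int n) else 0)"
    by (intro sum.cong) (simp_all add: shifted_binomial_def)
  then show ?case by simp
next
  case (Suc k)
  define g where "g \<nu> = binomial_transform k h (int n - int \<nu>)" for \<nu>
  define s where "s \<nu> = (- 1) ^ \<nu> * int (shifted_binomial \<nu> (Suc k))" for \<nu>
  define r where "r \<nu> = (- 1) ^ \<nu> * int (shifted_binomial \<nu> k)" for \<nu>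
  have sr: "s (Suc \<nu>) + s \<nu> = r (Suc \<nu>)" for \<nu>
    by (simp add: s_def r_def shifted_binomial_Suc algebra_simps)
  \<comment> \<open>This boundary term has degree \<open>-1\<close>. Its vanishing lets the sum run
    up to \<open>Suc n\<close>, where it lines up with the shifted one.\<close>
  have last: "g (Suc n) = 0" unfolding g_def by (rule binomial_transform_negative[OF assms]) simp_all
  have "(\<Sum>\<nu> = 0..n. (- 1) ^ \<nu> * int (shifted_binomial \<nu> (Suc k)) * binomial_transform (Suc k) h (int n - int \<nu>)) =
      (\<Sum>\<nu>\<le>n. s \<nu> * g \<nu> + s \<nu> * g (Suc \<nu>))"
    unfolding atLeast0AtMost
    by (intro sum.cong refl) (simp add: binomial_transform_Suc s_def g_def algebra_simps)
  also have "\<dots> = (\<Sum>\<nu>\<le>Suc n. s \<nu> * g \<nu>) + (\<Sum>\<nu>\<le>n. s \<nu> * g (Suc \<nu>))"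
    by (simp add: sum.distrib last)
  also have "(\<Sum>\<nu>\<le>Suc n. s \<nu> * g \<nu>) = s 0 * g 0 + (\<Sum>\<nu>\<le>n. s (Suc \<nu>) * g (Suc \<nu>))"
    by (rule sum.atMost_Suc_shift)
  also have "s 0 * g 0 + (\<Sum>\<nu>\<le>n. s (Suc \<nu>) * g (Suc \<nu>)) + (\<Sum>\<nu>\<le>n. s \<nu> * g (Suc \<nu>)) =
      r 0 * g 0 + (\<Sum>\<nu>\<le>n. r (Suc \<nu>) * g (Suc \<nu>))"
    by (simp add: sr[symmetric] distrib_right sum.distrib) (simp add: s_def r_def)
  also have "\<dots> = (\<Sum>\<nu>\<le>Suc n. r \<nu> * g \<nu>)"
    by (rule sum.atMost_Suc_shift[symmetric])
  also have "\<dots> = (\<Sum>\<nu> = 0..n. r \<nu> * g \<nu>)"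
    by (simp add: last atLeast0AtMost)
  also have "\<dots> = h (int n)" by (subst Suc.IH) (simp add: r_def g_def)
  finally show ?case by simp
qed

section \<open>Cohomology of a p-envelope\<close>

context p_envelope_module
begin

section \<open>Identifying cochains on \<open>L\<close> with cochains on its image in
  \<open>E\<close>\<close>

abbreviation "back \<equiv> inv_into UNIV incl"

definition pull :: "('e list \<Rightarrow> 'm) \<Rightarrow> 'l list \<Rightarrow> 'm" where
  "pull f = (\<lambda>xs. f (map incl xs))"

text \<open>The inverse of \<open>pull\<close> on cochains. Off the image of \<open>L\<close> the
  map \<open>back\<close> is meaningless, and cochains on \<open>range incl\<close> have to vanish
  there.\<close>

definition push :: "('l list \<Rightarrow> 'm) \<Rightarrow> 'e list \<Rightarrow> 'm" where
  "push g = (\<lambda>ys. if set ys \<subseteq> range incl then g (map back ys) else 0)"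

lemma ins_pull: "ins x (pull f) = pull (ins (incl x) f)"
  by (simp add: pull_def ins_def)

lemma ins_push: "ins y (push g) = (if y \<in> range incl then push (ins (back y) g) else 0)"
  by (auto simp: push_def ins_def fun_eq_iff)

lemma linear_pull: "Vector_Spaces.linear ME.scaleF M.scaleF pull"
  by (auto simp: Vector_Spaces.linear_iff ME.F.vector_space_axioms M.F.vector_space_axioms
      pull_def fun_eq_iff)

lemma inv_incl: "back (incl x) = x"
  using incl_inj by simp

lemma map_incl_back: "set ys \<subseteq> range incl \<Longrightarrow> map incl (map back ys) = ys"
  by (induction ys) (auto simp: f_inv_into_f)

lemma pull_push: "pull (push g) = g"
  by (auto simp: pull_def push_def fun_eq_iff inv_incl o_def)

lemma pull_cochain: "f \<in> ME.C (range incl) n \<Longrightarrow> pull f \<in> M.C UNIV n"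
proof (induction n arbitrary: f)
  case 0
  then have "f = 0" by simp
  then have "pull f = 0" by (simp only: pull_def) (simp add: fun_eq_iff)
  then show "pull f \<in> M.C UNIV 0" by simp
next
  case (Suc n)
  interpret p: Vector_Spaces.linear ME.scaleF M.scaleF pull by (rule linear_pull)
  note f = Suc.prems
  have 1: "ins x (pull f) \<in> M.C UNIV n" for x
    unfolding ins_pull by (rule Suc.IH[OF ME.cochains_SucD(2)[OF f]])
  have 2: "ins (x + y) (pull f) = ins x (pull f) + ins y (pull f)" for x y
    by (simp only: ins_pull incl_simps ME.cochain_linear(1)[OF f] rangeI p.add)
  have 3: "ins (scaleL c x) (pull f) = M.scaleF c (ins x (pull f))" for c x
    by (simp only: ins_pull incl_simps ME.cochain_linear(2)[OF f] rangeI p.scale)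
  have 4: "ins x (ins x (pull f)) = 0" for x
    by (simp only: ins_pull ME.cochain_ins_ins[OF f] p.zero)
  have 5: "pull f [] = 0" if "n \<noteq> 0"
    using ME.cochains_SucD(1)[OF f that] by (simp add: pull_def)
  show ?case using 1 2 3 4 5 by simp
qed

lemma push_cochain: "g \<in> M.C UNIV n \<Longrightarrow> push g \<in> ME.C (range incl) n"
proof (induction n arbitrary: g)
  case 0
  then have "g = 0" by simp
  then have "push g = 0" by (simp only: push_def) (simp add: fun_eq_iff)
  then show "push g \<in> ME.C (range incl) 0" by simp
next
  case (Suc n)
  note g = Suc.prems
  have push_add: "push (a + b) = push a + push b" for a b
    by (auto simp: push_def fun_eq_iff)
  have push_scale: "push (M.scaleF c a) = ME.scaleF c (push a)" for c a
    by (auto simp: push_def fun_eq_iff)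
  have push_zero: "push 0 = 0"
    by (auto simp: push_def fun_eq_iff)
  have ins: "ins (incl x) (push g) = push (ins x g)" for x
    by (simp only: ins_push rangeI if_True inv_incl)
  have out: "ins y (push g) = 0" if "y \<notin> range incl" for y
    by (simp only: ins_push that if_False)
  have 1: "ins y (push g) \<in> ME.C (range incl) n" for y
  proof (cases "y \<in> range incl")
    case True
    then obtain x where "y = incl x" by blast
    then show ?thesis by (simp only: ins Suc.IH[OF M.cochains_SucD(2)[OF g]])
  next
    case False
    show ?thesis unfolding out[OF False] by (rule ME.zero_cochain)
  qed
  have 2: "ins (y + z) (push g) = ins y (push g) + ins z (push g)"
    if yz: "y \<in> range incl" "z \<in> range incl" for y z
  proof -
    obtain u v where uv: "y = incl u" "z = incl v" using yz by blast
    show ?thesis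
      unfolding uv incl_simps(1)[symmetric]
      by (simp only: ins M.cochain_linear(1)[OF g] UNIV_I push_add)
  qed
  have 3: "ins (scaleE c y) (push g) = ME.scaleF c (ins y (push g))" if y: "y \<in> range incl" for c y
  proof -
    obtain u where u: "y = incl u" using y by blast
    show ?thesis
      unfolding u incl_simps(2)[symmetric]
      by (simp only: ins M.cochain_linear(2)[OF g] UNIV_I push_scale)
  qed
  have 4: "ins y (ins y (push g)) = 0" for y
  proof (cases "y \<in> range incl")
    case True
    then obtain u where u: "y = incl u" by blast
    show ?thesis
      by (simp only: u ins ins_push rangeI if_True inv_incl M.cochain_ins_ins[OF g] push_zero)
  next
    case False
    show ?thesis by (simp only: out[OF False] ins_zero)
  qed
  have 5: "push g [] = 0" if "n \<noteq> 0"
    using M.cochains_SucD(1)[OF g that] by (simp add: push_def)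
  show ?case using 1 2 3 4 5 out by simp
qed

lemma pull_lie_der: "lie_der (act x) (bracketL x) (pull f) = pull (lie_der (actE (incl x)) (bracketE (incl x)) f)"
proof
  show "lie_der (act x) (bracketL x) (pull f) xs =
      pull (lie_der (actE (incl x)) (bracketE (incl x)) f) xs" for xs
  proof (induction xs arbitrary: f)
    case Nil
    show ?case by (simp add: pull_def actE_incl)
  next
    case (Cons y xs)
    have "lie_der (act x) (bracketL x) (pull (ins (incl y) f)) xs =
      pull (lie_der (actE (incl x)) (bracketE (incl x)) (ins (incl y) f)) xs"
      by (rule Cons.IH)
    moreover have "pull g (z # zs) = pull (ins (incl z) g) zs" for g z zs
      by (simp add: pull_def)
    ultimately show ?case
      by (simp only: lie_der.simps ins_pull) (simp add: pull_def incl_simps)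
  qed
qed

lemma pull_diff: "M.d (pull f) = pull (ME.d f)"
proof
  show "M.d (pull f) xs = pull (ME.d f) xs" for xs
  proof (induction xs arbitrary: f)
    case Nil
    show ?case by (simp add: pull_def)
  next
    case (Cons x xs)
    have "M.d (pull (ins (incl x) f)) xs = pull (ME.d (ins (incl x) f)) xs"
      by (rule Cons.IH)
    then show ?case
      by (simp only: diff.simps ins_pull pull_lie_der) (simp add: pull_def)
  qed
qed

lemma inj_pull: "inj_on pull (ME.C (range incl) n)"
proof (rule inj_onI)
  fix f g assume fg: "f \<in> ME.C (range incl) n" "g \<in> ME.C (range incl) n" "pull f = pull g"
  have "f ys = g ys" if ys: "set ys \<subseteq> range incl" for ys
  proof -
    show ?thesis
      using fun_cong[OF fg(3), of "map back ys"] by (simp only: pull_def map_incl_back[OF ys])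
  qed
  then have "restr (range incl) f = restr (range incl) g" by (rule restr_eqI)
  then show "f = g" by (simp only: ME.restr_cochain[OF fg(1)] ME.restr_cochain[OF fg(2)])
qed

lemma pull_image: "pull ` ME.C (range incl) n = M.C UNIV n"
  using pull_cochain push_cochain pull_push by (metis image_eqI image_subsetI subset_antisym subsetI)

lemma pull_image_cocycles: "pull ` ME.cocycles_on (range incl) n = M.cocycles_on UNIV n"
proof -
  have iff: "M.d (pull f) = 0 \<longleftrightarrow> restr (range incl) (ME.d f) = 0" for f
  proof
    assume 0: "M.d (pull f) = 0"
    have "ME.d f ys = 0" if ys: "set ys \<subseteq> range incl" for ys
    proof -
      have "ME.d f ys = pull (ME.d f) (map back ys)"
        by (simp only: pull_def map_incl_back[OF ys])
      also have "\<dots> = 0" by (simp only: pull_diff[symmetric] 0 zero_fun_apply)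
      finally show ?thesis .
    qed
    then show "restr (range incl) (ME.d f) = 0" by (simp add: fun_eq_iff restr_apply)
  next
    assume 0: "restr (range incl) (ME.d f) = 0"
    have "pull (ME.d f) = pull (restr (range incl) (ME.d f))"
      by (auto simp: pull_def fun_eq_iff restr_apply)
    also have "\<dots> = 0" unfolding 0 by (auto simp: pull_def fun_eq_iff)
    finally show "M.d (pull f) = 0" by (simp only: pull_diff)
  qed
  have r: "restr UNIV f = f" for f :: "'l list \<Rightarrow> 'm" by (simp add: restr_def)
  have "M.cocycles_on UNIV n = {g \<in> pull ` ME.C (range incl) n. M.d g = 0}"
    by (simp only: M.cocycles_on_def r pull_image)
  also have "\<dots> = pull ` ME.cocycles_on (range incl) n"
    unfolding ME.cocycles_on_def using iff by blast
  finally show ?thesis ..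
qed

text \<open>The right-hand side of \<open>cohomology_dim_eq\<close> solved for the cohomology. It
  stands in for the dimension of the cohomology of \<open>K\<close>, as \<open>cohomology\<close> is
  formed only for whole types; integers accommodate the subtraction.\<close>

definition hdim :: "'e set \<Rightarrow> int \<Rightarrow> int" where
  "hdim K i = (if i < 0 then 0 else
    int (ME.F.dim (ME.cocycles_on K (Suc (nat i)))) + int (ME.F.dim (ME.cocycles_on K (nat i))) -
    int (ME.F.dim (ME.C K (nat i))))"

text \<open>All three dimensions in \<open>hdim\<close> split into those for \<open>K\<close> at two
  consecutive indices, hence so does their combination.\<close>

lemma hdim_step:
  assumes K: "E.subspace K" "range incl \<subseteq> K" and t: "t \<notin> K"
    and fs: "\<And>n. finitely_spanned ME.scaleF (ME.C K n)"
  defines "K' \<equiv> E.span (insert t K)"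
  shows "hdim K' i = hdim K i + hdim K (i - 1)" "finitely_spanned ME.scaleF (ME.C K' n)"
proof -
  interpret K: lie_module_subalgebra scaleE bracketE scaleM actE K by (rule subalgebra[OF K])
  have incl_K': "range incl \<subseteq> K'"
    using K(2) E.span_superset[of "insert t K"] unfolding K'_def by blast
  interpret S: one_step_extension scaleE bracketE scaleM actE K t K'
  proof unfold_locales
    show "t \<notin> K" by (rule t)
    show "K' = E.span (insert t K)" by (simp add: K'_def)
    show "bracketE x y \<in> K'" for x y using bracket_range incl_K' by blast
    show "bracketE t x \<in> K" for x using bracket_range K(2) by blast
    show "\<exists>b\<in>ME.C K (n - 1). restr K (lie_der (actE t) (bracketE t) f) = restr K (ME.d b)"
      if "f \<in> ME.cocycles_on K n" for f n
      using K.nullD[OF null_E[OF K] that] by metis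
  qed
  have Z0: "ME.cocycles_on K'' 0 = {0}" for K''
    using ME.F.subspace_0[OF ME.cocycles_on_subspace] ME.cocycles_on_subset[of K'' 0] by auto
  have d0: "ME.F.dim {0} = 0"
    using ME.F.dim_unique[of "{}" "{0}" 0] ME.F.independent_empty by simp
  have C0: "ME.C K'' 0 = {0}" for K'' by simp
  note c = S.cochains_step[OF fs fs] and z = S.cocycles_step[OF fs fs]
  show "finitely_spanned ME.scaleF (ME.C K' n)"
  proof (cases n)
    case 0
    show ?thesis using fs[of 0] by (simp only: 0 C0)
  next
    case (Suc m)
    show ?thesis unfolding Suc by (rule c(1))
  qed
  show "hdim K' i = hdim K i + hdim K (i - 1)"
  proof (cases "i < 0")
    case False
    then obtain m where m: "i = int m" by (metis nonneg_int_cases not_less)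
    show ?thesis
    proof (cases m)
      case 0
      \<comment> \<open>The splitting concerns only successor indices; at index \<open>0\<close> all
        spaces are zero.\<close>
      have n: "nat (int 0) = 0" "\<not> int 0 < 0" "int 0 - 1 < 0" by simp_all
      show ?thesis
        unfolding m 0 hdim_def n(1) if_not_P[OF n(2)] if_P[OF n(3)] z Z0 C0 d0 by simp
    next
      case (Suc l)
      have n: "nat (int (Suc l)) = Suc l" "nat (int (Suc l) - 1) = l"
        "\<not> int (Suc l) < 0" "\<not> int (Suc l) - 1 < 0" by simp_all
      show ?thesis
        unfolding m Suc hdim_def n(1,2) if_not_P[OF n(3)] if_not_P[OF n(4)] z c(2) by simp
    qed
  qed (simp add: hdim_def)
qed

text \<open>Every intermediate span contains the image of \<open>L\<close> and with it all brackets
  of \<open>E\<close>, so \<open>hdim_step\<close> applies to each adjoined vector, and each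
  application is one step of the binomial transform.\<close>

lemma hdim_chain:
  assumes "finite T" "E.independent (B \<union> T)" "B \<inter> T = {}" "E.span B = range incl"
    and fs: "\<And>n. finitely_spanned ME.scaleF (ME.C (range incl) n)"
  shows "(\<forall>n. finitely_spanned ME.scaleF (ME.C (E.span (B \<union> T)) n)) \<and>
    (\<forall>i. hdim (E.span (B \<union> T)) i = binomial_transform (card T) (hdim (range incl)) i)"
  using assms(1-3)
proof (induction T rule: finite_induct)
  case empty
  show ?case unfolding Un_empty_right assms(4) by (intro conjI allI fs) simp
next
  case (insert t T)
  let ?K = "E.span (B \<union> T)"
  have ind: "E.independent (B \<union> T)"
    using insert.prems(1) by (rule E.independent_mono) auto
  have t: "t \<notin> ?K"
    using insert.prems insert.hyps E.independent_insert[of t "B \<union> T"] by auto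
  have K: "E.subspace ?K" "range incl \<subseteq> ?K"
    using E.subspace_span E.span_mono[of B "B \<union> T"] by (auto simp: assms(4))
  have span: "E.span (B \<union> insert t T) = E.span (insert t ?K)"
    by (simp only: Un_insert_right E.span_insert E.span_span)
  have BT: "B \<inter> T = {}" using insert.prems(2) by blast
  note IH0 = insert.IH[OF ind BT]
  have IH: "finitely_spanned ME.scaleF (ME.C ?K n)"
    "hdim ?K i = binomial_transform (card T) (hdim (range incl)) i" for n i
    by (rule spec[OF conjunct1[OF IH0]], rule spec[OF conjunct2[OF IH0]])
  show ?case
    unfolding span
    by (intro conjI allI hdim_step(2)[OF K t IH(1)])
      (simp only: hdim_step(1)[OF K t IH(1)] IH(2) card_insert_disjoint[OF insert.hyps] binomial_transform_Suc)
qed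

lemma cohomology_dim_E:
  assumes fdM: "fin_dim_space scaleM"
    and fdQ: "vectorspace.fin_dim class_ring (quotient_space scaleE UNIV (range incl))"
  defines "k \<equiv> vectorspace.dim class_ring (quotient_space scaleE UNIV (range incl))"
  shows "int (cohomology_dim scaleE bracketE scaleM actE i) =
    binomial_transform k (\<lambda>i. int (cohomology_dim scaleL bracketL scaleM act i)) i"
proof -
  obtain BL where "finite_dimensional_vector_space scaleL BL"
    using fin_dim by (auto simp: fin_dim_space_def)
  then interpret fd: finite_dimensional_vector_space scaleL BL .
  interpret incl: Vector_Spaces.linear scaleL scaleE incl
    using incl_hom by (simp add: lie_hom_def)
  have fsI: "finitely_spanned scaleE (range incl)"
  proof (rule E.finitely_spannedI[of "incl ` BL"])
    show "range incl \<subseteq> E.span (incl ` BL)" by (simp add: incl.span_image fd.span_Basis)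
  qed (simp add: fd.finite_Basis)
  note q = quotient_space_dim[OF E.vector_space_axioms E.subspace_UNIV subspace_range subset_UNIV fsI]
  have fsE: "finitely_spanned scaleE UNIV" using q(1) fdQ by simp
  obtain B where B: "B \<subseteq> range incl" "range incl \<subseteq> E.span B" "E.independent B" "finite B"
    "card B = E.dim (range incl)"
    by (rule E.finite_basis[OF fsI])
  obtain B' where B': "B \<subseteq> B'" "UNIV \<subseteq> E.span B'" "E.independent B'" "finite B'" "card B' = E.dim UNIV"
    by (rule E.extend_to_basis[OF fsE subset_UNIV B(3)])
  \<comment> \<open>The number of vectors to be adjoined is the codimension of \<open>L\<close> in
    \<open>E\<close>.\<close>
  have k: "card (B' - B) = k"
    using q(2)[OF fsE] B B' by (simp add: card_Diff_subset k_def)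
  have spanB: "E.span B = range incl"
    by (rule E.span_subspace[OF B(1,2) subspace_range])
  have fsL: "finitely_spanned M.scaleF (M.C UNIV n)" for n
    by (rule M.cochains_finitely_spanned[OF fin_dim fdM])
  note isoC = linear_bij_dim[OF linear_pull ME.cochains_subspace inj_pull, unfolded pull_image]
  note isoZ = linear_bij_dim[OF linear_pull ME.cocycles_on_subspace inj_on_subset[OF inj_pull ME.cocycles_on_subset],
      unfolded pull_image_cocycles]
  have fsC: "finitely_spanned ME.scaleF (ME.C (range incl) n)" for n
    by (rule iffD2[OF isoC(1) fsL])
  have fsZ: "finitely_spanned ME.scaleF (ME.cocycles_on (range incl) n)" for n
    by (rule ME.F.finitely_spanned_subset[OF fsC ME.cocycles_on_subset])
  have BB: "B \<union> (B' - B) = B'" using B' by blast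
  have UNIV: "E.span B' = UNIV" using B'(2) by (simp only: top.extremum_unique)
  have prems: "finite (B' - B)" "E.independent (B \<union> (B' - B))" "B \<inter> (B' - B) = {}"
    unfolding BB by (rule finite_Diff[OF B'(4)] B'(3) Diff_disjoint)+
  note chain0 = hdim_chain[OF prems spanB fsC, unfolded BB UNIV k]
  have chain: "finitely_spanned ME.scaleF (ME.C UNIV n)"
    "hdim UNIV i = binomial_transform k (hdim (range incl)) i" for n i
    by (rule spec[OF conjunct1[OF chain0]], rule spec[OF conjunct2[OF chain0]])
  have L: "hdim (range incl) i = int (cohomology_dim scaleL bracketL scaleM act i)" for i
  proof (cases "i < 0")
    case True
    then show ?thesis by (simp add: hdim_def M.cohomology_dim_negative)
  next
    case False
    then obtain m where m: "i = int m" by (metis nonneg_int_cases not_less)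
    have "hdim (range incl) (int m) = int (M.F.dim (M.cocycles_on UNIV (Suc m))) +
        int (M.F.dim (M.cocycles_on UNIV m)) - int (M.F.dim (M.C UNIV m))"
      by (simp add: hdim_def isoC(2)[OF fsC] isoZ(2)[OF fsZ])
    then show ?thesis using M.cohomology_dim_eq[OF fsL, of m] by (simp add: m)
  qed
  have E: "hdim UNIV i = int (cohomology_dim scaleE bracketE scaleM actE i)"
  proof (cases "i < 0")
    case True
    then show ?thesis by (simp add: hdim_def ME.cohomology_dim_negative)
  next
    case False
    then obtain m where m: "i = int m" by (metis nonneg_int_cases not_less)
    show ?thesis using ME.cohomology_dim_eq[OF chain(1), of m] by (simp add: m hdim_def)
  qed
  show ?thesis using chain(2)[of i] E L by (simp add: binomial_transform_def)
qed

end

theorem theorem2p3: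
  fixes scaleL :: "'a::field \<Rightarrow> 'l::ab_group_add \<Rightarrow> 'l"
    and bracketL :: "'l \<Rightarrow> 'l \<Rightarrow> 'l"
    and scaleM :: "'a \<Rightarrow> 'm::ab_group_add \<Rightarrow> 'm"
    and act :: "'l \<Rightarrow> 'm \<Rightarrow> 'm"
    and scaleE :: "'a \<Rightarrow> 'e::ab_group_add \<Rightarrow> 'e"
    and bracketE :: "'e \<Rightarrow> 'e \<Rightarrow> 'e"
    and pmap :: "'e \<Rightarrow> 'e"
    and incl :: "'l \<Rightarrow> 'e"
    and \<phi> :: "'e \<Rightarrow> ('l, 'a) free_algebra set"
    and k :: nat
  assumes "prime CHAR('a)"
    and "lie_algebra scaleL bracketL" and "fin_dim_space scaleL"
    and "lie_module scaleL bracketL scaleM act" and "fin_dim_space scaleM"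
    and "p_envelope scaleL bracketL scaleE bracketE pmap incl"
    and "vectorspace.fin_dim class_ring (quotient_space scaleE UNIV (range incl))"
    and "k = vectorspace.dim class_ring (quotient_space scaleE UNIV (range incl))"
    and "hom_universal_p_envelope scaleL bracketL scaleE bracketE \<phi>"
    and "\<phi> \<circ> incl = uea_incl scaleL bracketL"
  shows "(\<forall>n::nat.
      cohomology_dim scaleE bracketE scaleM (\<lambda>g. uea_act scaleM act (\<phi> g)) (int n) =
      (\<Sum>j = 0..k. (k choose j) * cohomology_dim scaleL bracketL scaleM act (int n - int j))) \<and>
    (\<forall>n::nat.
      int (cohomology_dim scaleL bracketL scaleM act (int n)) =
      (\<Sum>\<nu> = 0..n. (- 1) ^ \<nu> * int (shifted_binomial \<nu> k) *
        int (cohomology_dim scaleE bracketE scaleM (\<lambda>g. uea_act scaleM act (\<phi> g))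
          (int n - int \<nu>))))"
proof -
  interpret p_envelope_module scaleL bracketL scaleE bracketE pmap incl scaleM act \<phi>
    using assms by (intro p_envelope_module.intro p_envelope_module_axioms.intro)
  note E = cohomology_dim_E[OF assms(5,7), folded assms(8)]
  have "int (cohomology_dim scaleE bracketE scaleM actE (int n)) =
      int (\<Sum>j = 0..k. (k choose j) * cohomology_dim scaleL bracketL scaleM act (int n - int j))" for n
    unfolding E binomial_transform_def by simp
  then have 1: "cohomology_dim scaleE bracketE scaleM actE (int n) =
      (\<Sum>j = 0..k. (k choose j) * cohomology_dim scaleL bracketL scaleM act (int n - int j))" for n
    by (simp only: of_nat_eq_iff)
  have 2: "int (cohomology_dim scaleL bracketL scaleM act (int n)) =
      (\<Sum>\<nu> = 0..n. (- 1) ^ \<nu> * int (shifted_binomial \<nu> k) *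
        int (cohomology_dim scaleE bracketE scaleM actE (int n - int \<nu>)))" for n
    unfolding E
    by (rule binomial_transform_inverse) (simp add: M.cohomology_dim_negative)
  show ?thesis using 1 2 by blast
qed

end
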